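(* Let $K\ge 2$, $0<p_1<\dots<p_K<p_{K+1}\le 1$, let $A\subset(1,\infty)$ be compact, let $\alpha_0$ be an interior point of $A$, and let $\{Y_i\}_{i=1}^n$ be i.i.d. Pareto with exponent $\alpha_0$ and minimum size $c>0$. Define the continuously updated minimum distance estimator (CUMDE) by $$\widehat\alpha=\operatorname*{arg\,min}_{\alpha\in A}\,(r(\alpha)-\bar s)^\top\Omega(\alpha)^{-1}(r(\alpha)-\bar s),$$ where $\bar s$, $r(\alpha)$ and $\Omega(\alpha)$ are as defined in the context. Then $$\sqrt n(\widehat\alpha-\alpha_0)\xrightarrow{d}N\bigl(0,(R^\top\Omega^{-1}R)^{-1}\bigr)$$ as $n\to\infty$, where $\Omega=\Omega(\alpha_0)$ and $R=\nabla r(\alpha_0)$ (the derivative of $\alpha\mapsto r(\alpha)\in\mathbb{R}^{K-1}$ at $\alpha_0$). The CUMDE $\widehat\alpha$ has the minimum asymptotic variance among all classical minimum distance (CMD) estimators, as defined in the context.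
   Context: Pareto with exponent $\alpha_0$ and minimum size $c$ means the CDF is $F(y)=1-(y/c)^{-\alpha_0}$ for $y\ge c$. Let $Y_{(1)}\ge\dots\ge Y_{(n)}$ denote the order statistics in decreasing order. The top income shares are $$S_k=\frac{\sum_{i=1}^{\lfloor np_k\rfloor}Y_{(i)}}{\sum_{i=1}^n Y_{(i)}},\quad k=1,\dots,K+1,$$ and the self-normalized non-overlapping top income shares are $$\bar s=(\bar s_1,\dots,\bar s_{K-1})^\top=\left(\frac{S_2-S_1}{S_{K+1}-S_K},\dots,\frac{S_K-S_{K-1}}{S_{K+1}-S_K}\right)^\top.$$ For $\alpha>1$ let $\xi=1/\alpha$, and for $0<p<q\le1$ put $$\mu(p,q)=c\,\frac{q^{1-\xi}-p^{1-\xi}}{1-\xi},$$ $$\sigma^2(p,q)=\frac{2c^2\xi^2}{1-\xi}\left(\frac{q^{1-2\xi}-p^{1-2\xi}}{1-2\xi}+p^{1-\xi}\frac{q^{-\xi}-p^{-\xi}}{\xi}+\frac{2p^{1-\xi}q^{1-\xi}-p^{2-2\xi}-q^{2-2\xi}}{2-2\xi}\right),$$ where $\frac{q^{1-2\xi}-p^{1-2\xi}}{1-2\xi}$ is interpreted as $\log\frac{q}{p}$ if $\xi=1/2$. Set $\mu_k=\mu(p_k,p_{k+1})$ for $k=1,\dots,K$, $r_k(\alpha)=\mu_k/\mu_K$, and $r(\alpha)=(r_1(\alpha),\dots,r_{K-1}(\alpha))^\top$. The $K\times K$ matrix $\Sigma$ is symmetric with $\Sigma_{kk}=\sigma^2(p_k,p_{k+1})$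 and, for $j<k$, $$\Sigma_{jk}=-c^2\xi^2\frac{p_{j+1}^{1-\xi}-p_j^{1-\xi}}{1-\xi}\left(\frac{p_{k+1}^{-\xi}-p_k^{-\xi}}{\xi}+\frac{p_{k+1}^{1-\xi}-p_k^{1-\xi}}{1-\xi}\right).$$ With the $(K-1)\times K$ matrix $H=\frac{1}{\mu_K}\begin{bmatrix} I_{K-1} & -r(\alpha)\end{bmatrix}$, define $\Omega(\alpha)=H\Sigma H^\top$. Both $r(\alpha)$ and $\Omega(\alpha)$ depend only on $\alpha$ and not on $c$, and $\Omega(\alpha)$ is positive definite. CMD estimators are the estimators $\operatorname*{arg\,min}_{\alpha\in A}(r(\alpha)-\bar s)^\top\widehat W(r(\alpha)-\bar s)$, where $\widehat W$ are symmetric positive definite (possibly random) weighting matrices with $\widehat W\xrightarrow{p}W$ for some positive definite $W$. The asymptotic variance of such an estimator (the variance of the limiting normal distribution of $\sqrt n$ times its deviation from $\alpha_0$) is $(R^\top WR)^{-1}R^\top W\Omega WR(R^\top WR)^{-1}$. *)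

theory Defs
  imports "HOL-Probability.Probability" "Jordan_Normal_Form.Gauss_Jordan_Elimination"
begin

text \<open>
  The number of percentiles \<open>K\<close> is a variable, so vectors in \<open>\<real>\<^sup>K\<^sup>-\<^sup>1\<close> and matrices are those of
  \<open>Jordan_Normal_Form\<close>.  They are indexed from \<open>0\<close>: position \<open>i\<close> of a vector below holds the
  mathematical entry \<open>i + 1\<close>.  The percentiles \<open>p\<close>, the observations \<open>y\<close>, the order statistics and
  the shares are plain functions on \<open>nat\<close> indexed from \<open>1\<close>.
\<close>

section \<open>Probabilistic notions\<close>

definition pareto_cdf :: "real \<Rightarrow> real \<Rightarrow> real \<Rightarrow> real" where
  "pareto_cdf \<alpha> c y = (if c \<le> y then 1 - (y / c) powr (- \<alpha>) else 0)"

text \<open>Parametrized by the variance \<open>v > 0\<close>, whereas \<^const>\<open>normal_density\<close> takes the standard deviation.\<close>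

definition normal_distribution :: "real \<Rightarrow> real \<Rightarrow> real measure" where
  "normal_distribution m v = density lborel (\<lambda>x. ennreal (normal_density m (sqrt v) x))"

definition has_asymptotic_variance ::
    "'a measure \<Rightarrow> real \<Rightarrow> (nat \<Rightarrow> 'a \<Rightarrow> real) \<Rightarrow> real \<Rightarrow> bool" where
  "has_asymptotic_variance M \<alpha>\<^sub>0 est v \<longleftrightarrow>
     weak_conv_m (\<lambda>n. distr M borel (\<lambda>\<omega>. sqrt (real n) * (est n \<omega> - \<alpha>\<^sub>0))) (normal_distribution 0 v)"

definition conv_in_prob :: "'a measure \<Rightarrow> (nat \<Rightarrow> 'a \<Rightarrow> real) \<Rightarrow> real \<Rightarrow> bool" where
  "conv_in_prob M X x \<longleftrightarrow>
     (\<forall>\<epsilon>>0. (\<lambda>n. measure M {\<omega> \<in> space M. \<epsilon> < \<bar>X n \<omega> - x\<bar>}) \<longlonglongrightarrow> 0)"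

section \<open>Linear algebra\<close>

definition pos_def_mat :: "nat \<Rightarrow> real mat \<Rightarrow> bool" where
  "pos_def_mat d W \<longleftrightarrow> W \<in> carrier_mat d d \<and> transpose_mat W = W \<and>
     (\<forall>x \<in> carrier_vec d. x \<noteq> 0\<^sub>v d \<longrightarrow> 0 < scalar_prod x (W *\<^sub>v x))"

text \<open>\<^const>\<open>mat_inverse\<close> returns \<open>None\<close> on singular matrices.\<close>

definition inv_mat :: "real mat \<Rightarrow> real mat" where
  "inv_mat A = the (mat_inverse A)"

section \<open>Top income shares\<close>

definition order_stat :: "nat \<Rightarrow> (nat \<Rightarrow> real) \<Rightarrow> nat \<Rightarrow> real" where
  "order_stat n y i = rev (sort (map y [1..<Suc n])) ! (i - 1)"

definition top_share :: "(nat \<Rightarrow> real) \<Rightarrow> nat \<Rightarrow> (nat \<Rightarrow> real) \<Rightarrow> nat \<Rightarrow> real" where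
  "top_share p n y k =
     (\<Sum>i = 1..nat \<lfloor>real n * p k\<rfloor>. order_stat n y i) / (\<Sum>i = 1..n. order_stat n y i)"

definition sbar :: "nat \<Rightarrow> (nat \<Rightarrow> real) \<Rightarrow> nat \<Rightarrow> (nat \<Rightarrow> real) \<Rightarrow> real Matrix.vec" where
  "sbar K p n y = Matrix.vec (K - 1) (\<lambda>i.
     (top_share p n y (i + 2) - top_share p n y (i + 1)) /
     (top_share p n y (K + 1) - top_share p n y K))"

section \<open>Population counterparts\<close>

definition mu :: "real \<Rightarrow> real \<Rightarrow> real \<Rightarrow> real \<Rightarrow> real" where
  "mu c \<alpha> p q = (let \<xi> = 1 / \<alpha> in c * ((q powr (1 - \<xi>) - p powr (1 - \<xi>)) / (1 - \<xi>)))"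

definition sigma2 :: "real \<Rightarrow> real \<Rightarrow> real \<Rightarrow> real \<Rightarrow> real" where
  "sigma2 c \<alpha> p q = (let \<xi> = 1 / \<alpha> in
     2 * c\<^sup>2 * \<xi>\<^sup>2 / (1 - \<xi>) *
     ((if \<xi> = 1 / 2 then ln (q / p)
       else (q powr (1 - 2 * \<xi>) - p powr (1 - 2 * \<xi>)) / (1 - 2 * \<xi>))
      + p powr (1 - \<xi>) * ((q powr (- \<xi>) - p powr (- \<xi>)) / \<xi>)
      + (2 * p powr (1 - \<xi>) * q powr (1 - \<xi>) - p powr (2 - 2 * \<xi>) - q powr (2 - 2 * \<xi>))
          / (2 - 2 * \<xi>)))"

definition mu_k :: "real \<Rightarrow> (nat \<Rightarrow> real) \<Rightarrow> real \<Rightarrow> nat \<Rightarrow> real" where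
  "mu_k c p \<alpha> k = mu c \<alpha> (p k) (p (k + 1))"

definition r_vec :: "real \<Rightarrow> nat \<Rightarrow> (nat \<Rightarrow> real) \<Rightarrow> real \<Rightarrow> real Matrix.vec" where
  "r_vec c K p \<alpha> = Matrix.vec (K - 1) (\<lambda>i. mu_k c p \<alpha> (i + 1) / mu_k c p \<alpha> K)"

text \<open>The entry \<open>\<Sigma>\<^sub>j\<^sub>k\<close> for \<open>j < k\<close>.\<close>

definition sigma_offdiag :: "real \<Rightarrow> (nat \<Rightarrow> real) \<Rightarrow> real \<Rightarrow> nat \<Rightarrow> nat \<Rightarrow> real" where
  "sigma_offdiag c p \<alpha> j k = (let \<xi> = 1 / \<alpha> in
     - c\<^sup>2 * \<xi>\<^sup>2 * ((p (j + 1) powr (1 - \<xi>) - p j powr (1 - \<xi>)) / (1 - \<xi>)) *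
     ((p (k + 1) powr (- \<xi>) - p k powr (- \<xi>)) / \<xi>
      + (p (k + 1) powr (1 - \<xi>) - p k powr (1 - \<xi>)) / (1 - \<xi>)))"

definition Sigma_mat :: "real \<Rightarrow> nat \<Rightarrow> (nat \<Rightarrow> real) \<Rightarrow> real \<Rightarrow> real mat" where
  "Sigma_mat c K p \<alpha> = Matrix.mat K K (\<lambda>(i, j).
     if i = j then sigma2 c \<alpha> (p (i + 1)) (p (i + 2))
     else sigma_offdiag c p \<alpha> (min i j + 1) (max i j + 1))"

text \<open>Columns \<open>0, \<dots>, K - 2\<close> form the identity block; column \<open>K - 1\<close> is \<open>- r(\<alpha>)\<close>.\<close>

definition H_mat :: "real \<Rightarrow> nat \<Rightarrow> (nat \<Rightarrow> real) \<Rightarrow> real \<Rightarrow> real mat" where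
  "H_mat c K p \<alpha> = (1 / mu_k c p \<alpha> K) \<cdot>\<^sub>m
     Matrix.mat (K - 1) K (\<lambda>(i, j).
       if j < K - 1 then (if i = j then 1 else 0) else - vec_index (r_vec c K p \<alpha>) i)"

definition Omega :: "real \<Rightarrow> nat \<Rightarrow> (nat \<Rightarrow> real) \<Rightarrow> real \<Rightarrow> real mat" where
  "Omega c K p \<alpha> = H_mat c K p \<alpha> * Sigma_mat c K p \<alpha> * transpose_mat (H_mat c K p \<alpha>)"

definition R_vec :: "real \<Rightarrow> nat \<Rightarrow> (nat \<Rightarrow> real) \<Rightarrow> real \<Rightarrow> real Matrix.vec" where
  "R_vec c K p \<alpha>\<^sub>0 =
     Matrix.vec (K - 1) (\<lambda>i. deriv (\<lambda>\<alpha>. vec_index (r_vec c K p \<alpha>) i) \<alpha>\<^sub>0)"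

section \<open>Minimum distance estimators\<close>

definition md_criterion ::
    "real \<Rightarrow> nat \<Rightarrow> (nat \<Rightarrow> real) \<Rightarrow> real mat \<Rightarrow> real Matrix.vec \<Rightarrow> real \<Rightarrow> real" where
  "md_criterion c K p W s \<alpha> =
     scalar_prod (r_vec c K p \<alpha> - s) (W *\<^sub>v (r_vec c K p \<alpha> - s))"

text \<open>
  An estimator is a measurable selection from the set of minimizers, which need not be a singleton.
  Minimization is required only for all large \<open>n\<close>: for small \<open>n\<close> the rank range
  \<open>\<lfloor>n p\<^sub>K\<rfloor> < i \<le> \<lfloor>n p\<^sub>K\<^sub>+\<^sub>1\<rfloor>\<close> can be empty, and then the denominator of \<^const>\<open>sbar\<close> is \<open>0\<close>.
\<close>

definition cumd_estimator ::
    "'a measure \<Rightarrow> (nat \<Rightarrow> 'a \<Rightarrow> real) \<Rightarrow> real \<Rightarrow> nat \<Rightarrow> (nat \<Rightarrow> real) \<Rightarrow> real set \<Rightarrow>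
     (nat \<Rightarrow> 'a \<Rightarrow> real) \<Rightarrow> bool" where
  "cumd_estimator M Y c K p A est \<longleftrightarrow>
     (\<forall>n. est n \<in> borel_measurable M) \<and>
     (\<forall>\<^sub>F n in sequentially. AE \<omega> in M.
        is_arg_min
          (\<lambda>\<alpha>. md_criterion c K p (inv_mat (Omega c K p \<alpha>)) (sbar K p n (\<lambda>i. Y i \<omega>)) \<alpha>)
          (\<lambda>\<alpha>. \<alpha> \<in> A) (est n \<omega>))"

text \<open>
  Measurability and convergence in probability of the weighting matrices \<open>What n\<close> are meant entrywise.
\<close>

definition cmd_estimator ::
    "'a measure \<Rightarrow> (nat \<Rightarrow> 'a \<Rightarrow> real) \<Rightarrow> real \<Rightarrow> nat \<Rightarrow> (nat \<Rightarrow> real) \<Rightarrow> real set \<Rightarrow>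
     (nat \<Rightarrow> 'a \<Rightarrow> real mat) \<Rightarrow> real mat \<Rightarrow> (nat \<Rightarrow> 'a \<Rightarrow> real) \<Rightarrow> bool" where
  "cmd_estimator M Y c K p A What W est \<longleftrightarrow>
     (\<forall>n. \<forall>i<K - 1. \<forall>j<K - 1. (\<lambda>\<omega>. What n \<omega> $$ (i, j)) \<in> borel_measurable M) \<and>
     (\<forall>n. AE \<omega> in M. pos_def_mat (K - 1) (What n \<omega>)) \<and>
     pos_def_mat (K - 1) W \<and>
     (\<forall>i<K - 1. \<forall>j<K - 1. conv_in_prob M (\<lambda>n \<omega>. What n \<omega> $$ (i, j)) (W $$ (i, j))) \<and>
     (\<forall>n. est n \<in> borel_measurable M) \<and>
     (\<forall>\<^sub>F n in sequentially. AE \<omega> in M.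
        is_arg_min (\<lambda>\<alpha>. md_criterion c K p (What n \<omega>) (sbar K p n (\<lambda>i. Y i \<omega>)) \<alpha>)
          (\<lambda>\<alpha>. \<alpha> \<in> A) (est n \<omega>))"

text \<open>
  Since \<open>\<alpha>\<close> is scalar, \<open>R\<close> is a vector and \<open>R\<^sup>T W R\<close> a number, so the outer inverses are inverses of reals.
\<close>

definition cumd_variance :: "real \<Rightarrow> nat \<Rightarrow> (nat \<Rightarrow> real) \<Rightarrow> real \<Rightarrow> real" where
  "cumd_variance c K p \<alpha>\<^sub>0 = (let R = R_vec c K p \<alpha>\<^sub>0 in
     inverse (scalar_prod R (inv_mat (Omega c K p \<alpha>\<^sub>0) *\<^sub>v R)))"

definition cmd_variance :: "real \<Rightarrow> nat \<Rightarrow> (nat \<Rightarrow> real) \<Rightarrow> real \<Rightarrow> real mat \<Rightarrow> real" where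
  "cmd_variance c K p \<alpha>\<^sub>0 W = (let R = R_vec c K p \<alpha>\<^sub>0 in
     inverse (scalar_prod R (W *\<^sub>v R)) *
     scalar_prod R ((W * Omega c K p \<alpha>\<^sub>0 * W) *\<^sub>v R) *
     inverse (scalar_prod R (W *\<^sub>v R)))"

end

theory Submission
  imports Defs "Jordan_Normal_Form.Determinant"
begin

text \<open>
  The total income cancels in \<open>s\<close>, so only the sums of the order statistics with ranks between
  \<open>\<lfloor>n p\<^sub>k\<rfloor>\<close> and \<open>\<lfloor>n p\<^sub>k\<^sub>+\<^sub>1\<rfloor>\<close> matter.  Let \<open>t = c p\<^sup>-\<^sup>\<xi>\<close> be the income exceeded with probability \<open>p\<close>.  The sum of the
  \<open>m = \<lfloor>n p\<rfloor>\<close> largest incomes differs from \<open>m t + \<Sum>\<^sub>i (Y\<^sub>i - t)\<^sup>+\<close> by at most the distance from \<open>m\<close> to the number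
  of incomes above \<open>t\<close>, which is of order \<open>\<surd>n\<close>, times the distance from the \<open>m\<close>-th largest income to \<open>t\<close>,
  which vanishes (\<open>top_sum_approx\<close>, \<open>top_sum_linear\<close>).  For two neighbouring percentiles the
  difference of the positive parts is bounded.  Hence the central limit theorem and Hoeffding's
  inequality apply to the resulting sums of independent variables, although the variance of an
  income is infinite when \<open>\<alpha>\<^sub>0 \<le> 2\<close>.  Writing \<open>Y = c U\<^sup>-\<^sup>\<xi>\<close> with \<open>U\<close> uniform turns the moments of these variables
  into elementary integrals: their covariance matrix is \<open>\<Sigma>\<close> (\<open>Sigma_qform_eq_variance\<close>), it is
  positive definite (\<open>Sigma_pos\<close>), and \<open>\<surd>n (s - r(\<alpha>\<^sub>0))\<close> is asymptotically normal with covariance \<open>\<Omega>\<close>.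

  Every minimum distance estimator considered minimizes \<open>(r(\<alpha>) - s)\<^sup>T V(\<alpha>) (r(\<alpha>) - s)\<close>, where \<open>V\<close> is bounded
  below and converges uniformly on \<open>A\<close> to a function that is continuous at \<open>\<alpha>\<^sub>0\<close>, with a positive definite
  value \<open>W\<close> there.  Comparing the criterion at the minimizer and at \<open>\<alpha>\<^sub>0\<close> shows that \<open>r\<close> of the estimator is
  within order \<open>1/\<surd>n\<close> of \<open>r(\<alpha>\<^sub>0)\<close>, and so is the estimator of \<open>\<alpha>\<^sub>0\<close>, because the derivative of the first
  component of \<open>r\<close> has no zero.  In the scale \<open>h = \<surd>n (\<alpha> - \<alpha>\<^sub>0)\<close> the criterion converges to the quadratic
  function \<open>(R h - z)\<^sup>T W (R h - z)\<close> with \<open>z = \<surd>n (s - r(\<alpha>\<^sub>0))\<close>, so the rescaled estimator approaches the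
  minimizer \<open>R\<^sup>T W z / (R\<^sup>T W R)\<close> (\<open>argmin_expansion\<close>).  This is linear in \<open>z\<close> and has the asserted
  variance.  No derivative of the weights enters; this is why the weights \<open>\<Omega>(\<alpha>)\<^sup>-\<^sup>1\<close>, which vary with
  \<open>\<alpha>\<close>, behave like the constant weights \<open>\<Omega>(\<alpha>\<^sub>0)\<^sup>-\<^sup>1\<close>.

  Optimality is the Cauchy--Schwarz inequality for the form of \<open>\<Omega>\<close> at the vectors \<open>W R\<close> and \<open>\<Omega>\<^sup>-\<^sup>1 R\<close>.
\<close>

section \<open>Asymptotic statements that hold with high probability\<close>

text \<open>
  Asking for an event on which \<open>P\<close> holds, instead of the probability of \<open>P\<close>, makes the notion
  meaningful for predicates that are not known to be measurable, such as bounds that are uniform in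
  \<open>\<alpha> \<in> A\<close>.
\<close>

definition (in prob_space) likely :: "real \<Rightarrow> ('a \<Rightarrow> bool) \<Rightarrow> bool" where
  "likely \<eta> P \<longleftrightarrow> (\<exists>E\<in>events. 1 - \<eta> \<le> prob E \<and> (\<forall>\<omega>\<in>E. P \<omega>))"

definition (in prob_space) whp :: "(nat \<Rightarrow> 'a \<Rightarrow> bool) \<Rightarrow> bool" where
  "whp P \<longleftrightarrow> (\<forall>\<eta>>0. \<forall>\<^sub>F n in sequentially. likely \<eta> (P n))"

definition (in prob_space) bounded_in_prob :: "(nat \<Rightarrow> 'a \<Rightarrow> real) \<Rightarrow> bool" where
  "bounded_in_prob X \<longleftrightarrow> (\<forall>\<eta>>0. \<exists>B. \<forall>\<^sub>F n in sequentially. likely \<eta> (\<lambda>\<omega>. \<bar>X n \<omega>\<bar> \<le> B))"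

definition (in prob_space) vanishes_in_prob :: "(nat \<Rightarrow> 'a \<Rightarrow> real) \<Rightarrow> bool" where
  "vanishes_in_prob X \<longleftrightarrow> (\<forall>\<epsilon>>0. whp (\<lambda>n \<omega>. \<bar>X n \<omega>\<bar> \<le> \<epsilon>))"

context prob_space
begin

lemma vanishesD: "vanishes_in_prob X \<Longrightarrow> \<epsilon> > 0 \<Longrightarrow> whp (\<lambda>n \<omega>. \<bar>X n \<omega>\<bar> \<le> \<epsilon>)"
  by (simp add: vanishes_in_prob_def)

lemma likely_mono:
  assumes "likely \<eta> P" and "\<And>\<omega>. \<omega> \<in> space M \<Longrightarrow> P \<omega> \<Longrightarrow> Q \<omega>"
  shows "likely \<eta> Q"
proof -
  obtain E where E: "E \<in> events" "1 - \<eta> \<le> prob E" "\<forall>\<omega>\<in>E. P \<omega>"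
    using assms(1) unfolding likely_def by blast
  have "E \<subseteq> space M" using E(1) by (rule sets.sets_into_space)
  then show ?thesis using E assms(2) unfolding likely_def by blast
qed

lemma likely_conj:
  assumes "likely (\<eta> / 2) P" "likely (\<eta> / 2) Q"
  shows "likely \<eta> (\<lambda>\<omega>. P \<omega> \<and> Q \<omega>)"
proof -
  obtain E F where E: "E \<in> events" "1 - \<eta>/2 \<le> prob E" "\<forall>\<omega>\<in>E. P \<omega>"
    and F: "F \<in> events" "1 - \<eta>/2 \<le> prob F" "\<forall>\<omega>\<in>F. Q \<omega>"
    using assms unfolding likely_def by blast
  have "prob (E \<union> F) = prob E + prob (F - E)" "prob (F - E) = prob F - prob (E \<inter> F)"
    using E F finite_measure_Union'[of E F] finite_measure_Diff'[of F E] by (simp_all add: Int_commute)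
  moreover have "prob (E \<union> F) \<le> 1" by simp
  ultimately have "1 - \<eta> \<le> prob (E \<inter> F)" using E(2) F(2) by linarith
  then show ?thesis using E F unfolding likely_def by (intro bexI[of _ "E \<inter> F"]) auto
qed

lemma whp_mono:
  assumes "whp P" and "\<forall>\<^sub>F n in sequentially. \<forall>\<omega>\<in>space M. P n \<omega> \<longrightarrow> Q n \<omega>"
  shows "whp Q"
  unfolding whp_def
proof (intro allI impI)
  fix \<eta> :: real assume "\<eta> > 0"
  then have "\<forall>\<^sub>F n in sequentially. likely \<eta> (P n)" using assms(1) unfolding whp_def by blast
  with assms(2) show "\<forall>\<^sub>F n in sequentially. likely \<eta> (Q n)"
    by eventually_elim (auto elim: likely_mono)
qed

lemma whp_conj:
  assumes "whp P" "whp Q"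
  shows "whp (\<lambda>n \<omega>. P n \<omega> \<and> Q n \<omega>)"
  unfolding whp_def
proof (intro allI impI)
  fix \<eta> :: real assume "\<eta> > 0"
  then have "\<forall>\<^sub>F n in sequentially. likely (\<eta>/2) (P n)" "\<forall>\<^sub>F n in sequentially. likely (\<eta>/2) (Q n)"
    using assms unfolding whp_def by (meson half_gt_zero)+
  then show "\<forall>\<^sub>F n in sequentially. likely \<eta> (\<lambda>\<omega>. P n \<omega> \<and> Q n \<omega>)"
    by eventually_elim (rule likely_conj)
qed

lemma whp_AE:
  assumes "\<forall>\<^sub>F n in sequentially. AE \<omega> in M. P n \<omega>"
  shows "whp P"
  unfolding whp_def
proof (intro allI impI)
  fix \<eta> :: real assume "\<eta> > 0"
  from assms show "\<forall>\<^sub>F n in sequentially. likely \<eta> (P n)"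
  proof eventually_elim
    case (elim n)
    then obtain E where "E \<in> events" "prob E = 1" "E \<subseteq> {\<omega>\<in>space M. P n \<omega>}"
      using AE_E_prob[of "P n"] by metis
    then show ?case using \<open>\<eta> > 0\<close> unfolding likely_def by (intro bexI[of _ E]) auto
  qed
qed

lemma whp_eventually:
  assumes "\<forall>\<^sub>F n in sequentially. \<forall>\<omega>\<in>space M. P n \<omega>"
  shows "whp P"
  by (rule whp_AE, use assms in eventually_elim) (auto intro: AE_I2)

lemma whp_ball:
  assumes "finite I" "\<And>i. i \<in> I \<Longrightarrow> whp (P i)"
  shows "whp (\<lambda>n \<omega>. \<forall>i\<in>I. P i n \<omega>)"
  using assms
proof (induction I rule: finite_induct)
  case empty
  show ?case by (rule whp_eventually) simp
next
  case (insert x F)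
  then have "whp (\<lambda>n \<omega>. P x n \<omega> \<and> (\<forall>i\<in>F. P i n \<omega>))" by (intro whp_conj) auto
  then show ?case by simp
qed

text \<open>
  When proving that something holds with high probability, a sequence that is bounded in probability
  may be treated as bounded by a constant.
\<close>

lemma whp_of_bounded:
  assumes "bounded_in_prob X" and "\<And>B. whp (\<lambda>n \<omega>. \<bar>X n \<omega>\<bar> \<le> B \<longrightarrow> Q n \<omega>)"
  shows "whp Q"
  unfolding whp_def
proof (intro allI impI)
  fix \<eta> :: real assume "\<eta> > 0"
  then have \<eta>: "\<eta> / 2 > 0" by simp
  then obtain B where "\<forall>\<^sub>F n in sequentially. likely (\<eta>/2) (\<lambda>\<omega>. \<bar>X n \<omega>\<bar> \<le> B)"
    using assms(1) unfolding bounded_in_prob_def by blast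
  moreover have "\<forall>\<^sub>F n in sequentially. likely (\<eta>/2) (\<lambda>\<omega>. \<bar>X n \<omega>\<bar> \<le> B \<longrightarrow> Q n \<omega>)"
    using assms(2)[of B] \<eta> unfolding whp_def by blast
  ultimately show "\<forall>\<^sub>F n in sequentially. likely \<eta> (Q n)"
    by eventually_elim (auto elim: likely_mono[OF likely_conj])
qed

lemma bounded_in_prob_const: "bounded_in_prob (\<lambda>n \<omega>. b)"
  unfolding bounded_in_prob_def likely_def
  by (intro allI impI exI[of _ "\<bar>b\<bar>"] always_eventually bexI[of _ "space M"]) (auto simp: prob_space)

lemma bounded_in_prob_add:
  assumes "bounded_in_prob X" "bounded_in_prob Y"
  shows "bounded_in_prob (\<lambda>n \<omega>. X n \<omega> + Y n \<omega>)"
  unfolding bounded_in_prob_def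
proof (intro allI impI)
  fix \<eta> :: real assume "\<eta> > 0"
  then have \<eta>: "\<eta> / 2 > 0" by simp
  then obtain B B' where "\<forall>\<^sub>F n in sequentially. likely (\<eta>/2) (\<lambda>\<omega>. \<bar>X n \<omega>\<bar> \<le> B)"
    "\<forall>\<^sub>F n in sequentially. likely (\<eta>/2) (\<lambda>\<omega>. \<bar>Y n \<omega>\<bar> \<le> B')"
    using assms unfolding bounded_in_prob_def by meson
  then have "\<forall>\<^sub>F n in sequentially. likely \<eta> (\<lambda>\<omega>. \<bar>X n \<omega> + Y n \<omega>\<bar> \<le> B + B')"
    by eventually_elim (rule likely_mono[OF likely_conj], assumption+, linarith)
  then show "\<exists>B. \<forall>\<^sub>F n in sequentially. likely \<eta> (\<lambda>\<omega>. \<bar>X n \<omega> + Y n \<omega>\<bar> \<le> B)" ..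
qed

lemma bounded_in_prob_cmult:
  assumes "bounded_in_prob X" shows "bounded_in_prob (\<lambda>n \<omega>. b * X n \<omega>)"
  unfolding bounded_in_prob_def
proof (intro allI impI)
  fix \<eta> :: real assume "\<eta> > 0"
  then obtain B where "\<forall>\<^sub>F n in sequentially. likely \<eta> (\<lambda>\<omega>. \<bar>X n \<omega>\<bar> \<le> B)"
    using assms unfolding bounded_in_prob_def by blast
  then have "\<forall>\<^sub>F n in sequentially. likely \<eta> (\<lambda>\<omega>. \<bar>b * X n \<omega>\<bar> \<le> \<bar>b\<bar> * B)"
    by eventually_elim (auto elim!: likely_mono simp: abs_mult mult_left_mono)
  then show "\<exists>B. \<forall>\<^sub>F n in sequentially. likely \<eta> (\<lambda>\<omega>. \<bar>b * X n \<omega>\<bar> \<le> B)" ..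
qed

lemma bounded_in_prob_sum:
  assumes "\<And>i. i \<in> I \<Longrightarrow> bounded_in_prob (X i)"
  shows "bounded_in_prob (\<lambda>n \<omega>. \<Sum>i\<in>I. X i n \<omega>)"
  using assms
proof (induction I rule: infinite_finite_induct)
  case (insert x F)
  then show ?case by (auto intro: bounded_in_prob_add)
qed (auto intro: bounded_in_prob_const)

lemma bounded_in_prob_abs: "bounded_in_prob X \<Longrightarrow> bounded_in_prob (\<lambda>n \<omega>. \<bar>X n \<omega>\<bar>)"
  by (simp add: bounded_in_prob_def)

lemma vanishes_mono:
  assumes "vanishes_in_prob X" "whp (\<lambda>n \<omega>. \<bar>Z n \<omega>\<bar> \<le> \<bar>X n \<omega>\<bar>)"
  shows "vanishes_in_prob Z"
  unfolding vanishes_in_prob_def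
proof (intro allI impI)
  fix \<epsilon> :: real assume "\<epsilon> > 0"
  then have "whp (\<lambda>n \<omega>. \<bar>X n \<omega>\<bar> \<le> \<epsilon> \<and> \<bar>Z n \<omega>\<bar> \<le> \<bar>X n \<omega>\<bar>)"
    using assms by (intro whp_conj) (auto simp: vanishes_in_prob_def)
  then show "whp (\<lambda>n \<omega>. \<bar>Z n \<omega>\<bar> \<le> \<epsilon>)" by (rule whp_mono) auto
qed

lemma vanishes_cong:
  assumes "vanishes_in_prob X" "whp (\<lambda>n \<omega>. Z n \<omega> = X n \<omega>)"
  shows "vanishes_in_prob Z"
  by (rule vanishes_mono[OF assms(1)], rule whp_mono[OF assms(2)]) auto

lemma vanishes_imp_bounded:
  assumes "vanishes_in_prob X" shows "bounded_in_prob X"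
  using assms unfolding vanishes_in_prob_def whp_def bounded_in_prob_def
  by (intro allI impI exI[of _ 1]) auto

lemma vanishes_add:
  assumes "vanishes_in_prob X" "vanishes_in_prob Y"
  shows "vanishes_in_prob (\<lambda>n \<omega>. X n \<omega> + Y n \<omega>)"
  unfolding vanishes_in_prob_def
proof (intro allI impI)
  fix \<epsilon> :: real assume "\<epsilon> > 0"
  then have "\<epsilon> / 2 > 0" by simp
  then have "whp (\<lambda>n \<omega>. \<bar>X n \<omega>\<bar> \<le> \<epsilon>/2 \<and> \<bar>Y n \<omega>\<bar> \<le> \<epsilon>/2)"
    using assms by (intro whp_conj vanishesD)
  then show "whp (\<lambda>n \<omega>. \<bar>X n \<omega> + Y n \<omega>\<bar> \<le> \<epsilon>)"
    by (rule whp_mono) (intro always_eventually allI ballI impI, linarith)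
qed

lemma vanishes_const:
  assumes "a \<longlonglongrightarrow> 0" shows "vanishes_in_prob (\<lambda>n \<omega>. a n)"
  unfolding vanishes_in_prob_def
proof (intro allI impI whp_eventually)
  fix \<epsilon> :: real assume "\<epsilon> > 0"
  with assms have "\<forall>\<^sub>F n in sequentially. \<bar>a n\<bar> < \<epsilon>" by (auto simp: tendsto_iff)
  then show "\<forall>\<^sub>F n in sequentially. \<forall>\<omega>\<in>space M. \<bar>a n\<bar> \<le> \<epsilon>" by eventually_elim auto
qed

lemma vanishes_mult_bounded:
  assumes "vanishes_in_prob X" "bounded_in_prob Y"
  shows "vanishes_in_prob (\<lambda>n \<omega>. X n \<omega> * Y n \<omega>)"
  unfolding vanishes_in_prob_def
proof (intro allI impI)
  fix \<epsilon> :: real assume \<epsilon>: "\<epsilon> > 0"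
  show "whp (\<lambda>n \<omega>. \<bar>X n \<omega> * Y n \<omega>\<bar> \<le> \<epsilon>)"
  proof (rule whp_of_bounded[OF assms(2)])
    fix B :: real
    have "\<epsilon> / (\<bar>B\<bar> + 1) > 0" using \<epsilon> by (simp add: add_nonneg_pos)
    then have "whp (\<lambda>n \<omega>. \<bar>X n \<omega>\<bar> \<le> \<epsilon> / (\<bar>B\<bar> + 1))"
      using assms(1) by (auto simp: vanishes_in_prob_def)
    then show "whp (\<lambda>n \<omega>. \<bar>Y n \<omega>\<bar> \<le> B \<longrightarrow> \<bar>X n \<omega> * Y n \<omega>\<bar> \<le> \<epsilon>)"
    proof (rule whp_mono, intro always_eventually allI ballI impI)
      fix n \<omega> assume *: "\<bar>X n \<omega>\<bar> \<le> \<epsilon> / (\<bar>B\<bar> + 1)" "\<bar>Y n \<omega>\<bar> \<le> B"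
      have "\<bar>X n \<omega>\<bar> * \<bar>Y n \<omega>\<bar> \<le> \<epsilon> / (\<bar>B\<bar> + 1) * (\<bar>B\<bar> + 1)"
        using * \<epsilon> by (intro mult_mono) auto
      then show "\<bar>X n \<omega> * Y n \<omega>\<bar> \<le> \<epsilon>" by (simp add: abs_mult)
    qed
  qed
qed

lemma vanishes_cmult: "vanishes_in_prob X \<Longrightarrow> vanishes_in_prob (\<lambda>n \<omega>. b * X n \<omega>)"
  using vanishes_mult_bounded[OF _ bounded_in_prob_const[of b], of X] by (simp add: mult.commute)

lemma vanishes_diff:
  "vanishes_in_prob X \<Longrightarrow> vanishes_in_prob Y \<Longrightarrow> vanishes_in_prob (\<lambda>n \<omega>. X n \<omega> - Y n \<omega>)"
  using vanishes_add[OF _ vanishes_cmult[of Y "-1"], of X] by simp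

lemma vanishes_sum:
  assumes "\<And>i. i \<in> I \<Longrightarrow> vanishes_in_prob (X i)"
  shows "vanishes_in_prob (\<lambda>n \<omega>. \<Sum>i\<in>I. X i n \<omega>)"
  using assms
proof (induction I rule: infinite_finite_induct)
  case (insert x F)
  then show ?case by (auto intro: vanishes_add)
qed (auto intro: vanishes_const)

lemma bounded_in_prob_of_diff:
  assumes "vanishes_in_prob (\<lambda>n \<omega>. X n \<omega> - Y n \<omega>)" "bounded_in_prob Y"
  shows "bounded_in_prob X"
  using bounded_in_prob_add[OF vanishes_imp_bounded[OF assms(1)] assms(2)] by simp

lemma vanishes_inverse:
  assumes "vanishes_in_prob (\<lambda>n \<omega>. X n \<omega> - b)" and b: "b \<noteq> 0"
  shows "vanishes_in_prob (\<lambda>n \<omega>. inverse (X n \<omega>) - inverse b)"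
  unfolding vanishes_in_prob_def
proof (intro allI impI)
  fix \<epsilon> :: real assume \<epsilon>: "\<epsilon> > 0"
  have "isCont inverse b" using b by (intro continuous_intros) auto
  then obtain \<delta> where \<delta>: "\<delta> > 0" "\<And>x. dist x b < \<delta> \<Longrightarrow> dist (inverse x) (inverse b) < \<epsilon>"
    using \<epsilon> unfolding continuous_at_eps_delta by blast
  have "whp (\<lambda>n \<omega>. \<bar>X n \<omega> - b\<bar> \<le> \<delta> / 2)" using assms(1) \<delta>(1) by (intro vanishesD) auto
  then show "whp (\<lambda>n \<omega>. \<bar>inverse (X n \<omega>) - inverse b\<bar> \<le> \<epsilon>)"
  proof (rule whp_mono, intro always_eventually allI ballI impI)
    fix n \<omega> assume "\<bar>X n \<omega> - b\<bar> \<le> \<delta> / 2"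
    then have "dist (X n \<omega>) b < \<delta>" using \<delta>(1) by (simp add: dist_real_def)
    from \<delta>(2)[OF this] show "\<bar>inverse (X n \<omega>) - inverse b\<bar> \<le> \<epsilon>" by (simp add: dist_real_def)
  qed
qed

lemma conv_in_prob_imp_vanishes:
  assumes [measurable]: "\<And>n. X n \<in> borel_measurable M" and "conv_in_prob M X x"
  shows "vanishes_in_prob (\<lambda>n \<omega>. X n \<omega> - x)"
  unfolding vanishes_in_prob_def whp_def likely_def
proof (intro allI impI)
  fix \<epsilon> \<eta> :: real assume "\<epsilon> > 0" "\<eta> > 0"
  then have "(\<lambda>n. prob {\<omega> \<in> space M. \<epsilon> < \<bar>X n \<omega> - x\<bar>}) \<longlonglongrightarrow> 0"
    using assms(2) by (auto simp: conv_in_prob_def)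
  then have "\<forall>\<^sub>F n in sequentially. prob {\<omega> \<in> space M. \<epsilon> < \<bar>X n \<omega> - x\<bar>} < \<eta>"
    by (rule order_tendstoD) fact
  then show "\<forall>\<^sub>F n in sequentially. \<exists>E\<in>events. 1 - \<eta> \<le> prob E \<and> (\<forall>\<omega>\<in>E. \<bar>X n \<omega> - x\<bar> \<le> \<epsilon>)"
  proof eventually_elim
    case (elim n)
    let ?F = "{\<omega> \<in> space M. \<epsilon> < \<bar>X n \<omega> - x\<bar>}"
    have "?F \<in> events" by measurable
    then show ?case using elim
      by (intro bexI[of _ "space M - ?F"]) (auto simp: prob_compl)
  qed
qed

end

section \<open>Central limit theorem and Slutsky's lemma\<close>

lemma norm_iexp_diff: "norm (iexp a - iexp b) \<le> \<bar>a - b\<bar>"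
proof -
  have "iexp a - iexp b = iexp b * (iexp (a - b) - 1)"
    by (simp add: algebra_simps flip: exp_add)
  then have "norm (iexp a - iexp b) = norm (iexp (a - b) - 1)" by (simp add: norm_mult)
  also have "\<dots> \<le> \<bar>a - b\<bar>" using iexp_approx1[of "a - b" 0] by simp
  finally show ?thesis .
qed

lemma (in prob_space) char_distr:
  assumes [measurable]: "X \<in> borel_measurable M"
  shows "char (distr M borel X) t = (CLINT \<omega>|M. iexp (t * X \<omega>))"
  unfolding char_def by (subst integral_distr) auto

text \<open>
  The characteristic functions of the two sequences have the same limit, because
  \<open>\<bar>e\<^sup>i\<^sup>a - e\<^sup>i\<^sup>b\<bar>\<close> is at most \<open>\<bar>a - b\<bar>\<close> where the two are close, and at most \<open>2\<close> elsewhere.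
\<close>

lemma (in prob_space) weak_conv_vanishing_diff:
  assumes [measurable]: "\<And>n. X n \<in> borel_measurable M" "\<And>n. Z n \<in> borel_measurable M"
    and van: "vanishes_in_prob (\<lambda>n \<omega>. X n \<omega> - Z n \<omega>)"
    and Z: "weak_conv_m (\<lambda>n. distr M borel (Z n)) N" and N: "real_distribution N"
  shows "weak_conv_m (\<lambda>n. distr M borel (X n)) N"
proof (rule levy_continuity[OF _ N])
  show "real_distribution (distr M borel (X n))" for n by (rule real_distribution_distr) simp
  fix t :: real
  have "(\<lambda>n. char (distr M borel (Z n)) t) \<longlonglongrightarrow> char N t"
    by (rule levy_continuity1[OF _ N Z]) (rule real_distribution_distr, simp)
  moreover have "(\<lambda>n. char (distr M borel (X n)) t - char (distr M borel (Z n)) t) \<longlonglongrightarrow> 0"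
  proof (rule tendstoI)
    fix e :: real assume e: "e > 0"
    define \<epsilon> where "\<epsilon> = e / (4 * (\<bar>t\<bar> + 1))"
    have \<epsilon>: "\<epsilon> > 0" using e by (simp add: \<epsilon>_def add_nonneg_pos)
    have t\<epsilon>: "\<bar>t\<bar> * \<epsilon> \<le> e / 4"
    proof -
      have "\<bar>t\<bar> * \<epsilon> \<le> (\<bar>t\<bar> + 1) * \<epsilon>" using \<epsilon> by simp
      also have "\<dots> = e / 4" by (simp add: \<epsilon>_def field_simps) (simp add: add_nonneg_eq_0_iff)?
      finally show ?thesis .
    qed
    have "\<forall>\<^sub>F n in sequentially. \<exists>E\<in>events. 1 - e/8 \<le> prob E \<and> (\<forall>\<omega>\<in>E. \<bar>X n \<omega> - Z n \<omega>\<bar> \<le> \<epsilon>)"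
      using van \<epsilon> e unfolding vanishes_in_prob_def whp_def likely_def by auto
    then show "\<forall>\<^sub>F n in sequentially.
        dist (char (distr M borel (X n)) t - char (distr M borel (Z n)) t) 0 < e"
    proof eventually_elim
      case (elim n)
      then obtain E where E[measurable]: "E \<in> events" and pE: "1 - e/8 \<le> prob E"
        and XZ: "\<And>\<omega>. \<omega> \<in> E \<Longrightarrow> \<bar>X n \<omega> - Z n \<omega>\<bar> \<le> \<epsilon>" by blast
      let ?d = "\<lambda>\<omega>. iexp (t * X n \<omega>) - iexp (t * Z n \<omega>)"
      have int: "integrable M (\<lambda>\<omega>. iexp (t * X n \<omega>))" "integrable M (\<lambda>\<omega>. iexp (t * Z n \<omega>))"
        by (auto intro!: integrable_iexp)
      have i0: "integrable M (indicat_real (space M - E))"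
        by (rule integrable_real_indicator) (simp_all add: emeasure_eq_measure)
      have ind: "integrable M (\<lambda>\<omega>. e/4 + 2 * indicator (space M - E) \<omega> :: real)"
        by (intro Bochner_Integration.integrable_add integrable_const integrable_mult_right i0)
      have bound: "norm (?d \<omega>) \<le> e/4 + 2 * indicator (space M - E) \<omega>" if "\<omega> \<in> space M" for \<omega>
      proof (cases "\<omega> \<in> E")
        case True
        have "norm (?d \<omega>) \<le> \<bar>t * X n \<omega> - t * Z n \<omega>\<bar>" by (rule norm_iexp_diff)
        also have "\<dots> = \<bar>t\<bar> * \<bar>X n \<omega> - Z n \<omega>\<bar>" by (simp flip: abs_mult right_diff_distrib)
        also have "\<dots> \<le> \<bar>t\<bar> * \<epsilon>" using XZ[OF True] by (intro mult_left_mono) auto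
        finally show ?thesis using t\<epsilon> True by simp
      next
        case False
        have "norm (?d \<omega>) \<le> norm (iexp (t * X n \<omega>)) + norm (iexp (t * Z n \<omega>))" by (rule norm_triangle_ineq4)
        then show ?thesis using that False e by simp
      qed
      have "char (distr M borel (X n)) t - char (distr M borel (Z n)) t = (CLINT \<omega>|M. ?d \<omega>)"
        using int by (simp add: char_distr)
      then have "norm (char (distr M borel (X n)) t - char (distr M borel (Z n)) t)
          \<le> (LINT \<omega>|M. norm (?d \<omega>))"
        by (simp only: integral_norm_bound)
      also have "\<dots> \<le> (LINT \<omega>|M. e/4 + 2 * indicator (space M - E) \<omega>)"
      proof (rule integral_mono)
        show "integrable M (\<lambda>\<omega>. norm (?d \<omega>))"
          by (intro integrable_norm Bochner_Integration.integrable_diff int)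
        show "integrable M (\<lambda>\<omega>. e/4 + 2 * indicator (space M - E) \<omega>)" by (rule ind)
      qed (rule bound)
      also have "\<dots> = e/4 + 2 * prob (space M - E)"
        using i0 by (subst Bochner_Integration.integral_add) (auto simp: prob_space)
      also have "\<dots> < e" using pE e by (simp add: prob_compl)
      finally show ?case by simp
    qed
  qed
  ultimately show "(\<lambda>n. char (distr M borel (X n)) t) \<longlonglongrightarrow> char N t"
    using tendsto_add[of "\<lambda>n. char (distr M borel (Z n)) t"] by fastforce
qed

text \<open>
  The central limit theorem normalizes to variance \<open>1\<close>; this form and the resulting characteristic
  function undo the normalization.
\<close>

lemma normal_distribution_eq_distr:
  assumes "v > 0"
  shows "normal_distribution 0 v = distr std_normal_distribution borel (\<lambda>x. sqrt v * x)"
proof -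
  interpret prob_space std_normal_distribution by (rule prob_space_normal_density) simp
  have "distributed std_normal_distribution lborel (\<lambda>x. x) (normal_density 0 1)"
    by (auto simp: distributed_def distr_id2 sets_density measurable_ident_sets)
  from normal_density_affine[OF this, of "sqrt v" 0] assms
  have "distributed std_normal_distribution lborel (\<lambda>x. sqrt v * x) (normal_density 0 (sqrt v))"
    by simp
  then have "distr std_normal_distribution lborel (\<lambda>x. sqrt v * x)
      = density lborel (\<lambda>x. ennreal (normal_density 0 (sqrt v) x))"
    by (simp add: distributed_def)
  moreover have "distr std_normal_distribution lborel (\<lambda>x. sqrt v * x)
      = distr std_normal_distribution borel (\<lambda>x. sqrt v * x)"
    by (rule distr_cong) auto
  ultimately show ?thesis by (simp add: normal_distribution_def)
qed

lemma
  assumes v: "v > 0"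
  shows char_normal_distribution: "char (normal_distribution 0 v) t = char std_normal_distribution (sqrt v * t)"
    and real_distribution_normal: "real_distribution (normal_distribution 0 v)"
proof -
  interpret prob_space std_normal_distribution by (rule prob_space_normal_density) simp
  show "char (normal_distribution 0 v) t = char std_normal_distribution (sqrt v * t)"
    unfolding normal_distribution_eq_distr[OF v] by (subst char_distr) (auto simp: char_def mult_ac)
  show "real_distribution (normal_distribution 0 v)"
    unfolding normal_distribution_eq_distr[OF v] by (rule real_distribution_distr) simp
qed

lemma (in prob_space) indep_vars_Suc:
  assumes "indep_vars (\<lambda>i. N) Y {1..}"
  shows "indep_vars (\<lambda>i. N) (\<lambda>i. Y (Suc i)) UNIV"
proof -
  have ind: "indep_sets (\<lambda>i. {Y i -` A \<inter> space M |A. A \<in> sets N}) {1..}"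
    using assms by (simp add: indep_vars_def2)
  have "indep_sets (\<lambda>i. {Y (Suc i) -` A \<inter> space M |A. A \<in> sets N}) UNIV"
    unfolding indep_sets_def
  proof (intro conjI ballI allI impI)
    fix i show "{Y (Suc i) -` A \<inter> space M |A. A \<in> sets N} \<subseteq> events"
      using ind by (auto simp: indep_sets_def)
  next
    fix J :: "nat set" and A
    assume J: "J \<noteq> {}" "finite J" and A: "A \<in> (\<Pi> i\<in>J. {Y (Suc i) -` A \<inter> space M |A. A \<in> sets N})"
    have "prob (\<Inter>k\<in>Suc ` J. A (k - 1)) = (\<Prod>k\<in>Suc ` J. prob (A (k - 1)))"
    proof (rule indep_setsD[OF ind])
      show "\<forall>k\<in>Suc ` J. A (k - 1) \<in> {Y k -` B \<inter> space M |B. B \<in> sets N}"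
      proof (intro ballI)
        fix k assume "k \<in> Suc ` J"
        then obtain j where "j \<in> J" "k = Suc j" by blast
        then show "A (k - 1) \<in> {Y k -` B \<inter> space M |B. B \<in> sets N}"
          using Pi_mem[OF A, of j] by simp
      qed
    qed (use J in auto)
    then show "prob (\<Inter> (A ` J)) = (\<Prod>j\<in>J. prob (A j))"
      by (simp add: prod.reindex)
  qed
  then show ?thesis using assms by (simp add: indep_vars_def2)
qed

lemma (in prob_space) clt_bounded_function:
  fixes g :: "real \<Rightarrow> real" and Y :: "nat \<Rightarrow> 'a \<Rightarrow> real"
  assumes indep: "indep_vars (\<lambda>i. borel) Y {1..}"
    and ident: "\<And>i. i \<ge> 1 \<Longrightarrow> distr M borel (Y i) = \<mu>"
    and g[measurable]: "g \<in> borel_measurable borel" and bound: "\<And>x. \<bar>g x\<bar> \<le> B"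
    and mean: "(LINT x|\<mu>. g x) = 0" and var: "(LINT x|\<mu>. (g x)\<^sup>2) = v" and v: "v > 0"
  shows "weak_conv_m (\<lambda>n. distr M borel (\<lambda>\<omega>. (\<Sum>i=1..n. g (Y i \<omega>)) / sqrt n)) (normal_distribution 0 v)"
proof -
  have Y[measurable]: "Y (Suc i) \<in> borel_measurable M" for i
    using indep by (auto simp: indep_vars_def)
  have "indep_vars (\<lambda>i. borel) (\<lambda>i. Y (Suc i)) UNIV"
    using indep by (rule indep_vars_Suc)
  then have indep': "indep_vars (\<lambda>i. borel) (\<lambda>i \<omega>. g (Y (Suc i) \<omega>)) UNIV"
    by (rule indep_vars_compose2[where X="\<lambda>i. Y (Suc i)" and M'="\<lambda>_. borel"]) auto
  have id: "distr M borel (\<lambda>\<omega>. g (Y (Suc i) \<omega>)) = distr \<mu> borel g" for i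
    using ident[of "Suc i"] by (auto simp: distr_distr comp_def)
  have int: "(LINT \<omega>|M. h (Y (Suc i) \<omega>)) = (LINT x|\<mu>. h x)"
    if [measurable]: "h \<in> borel_measurable borel" for h :: "real \<Rightarrow> real" and i
    by (subst ident[of "Suc i", symmetric]) (auto simp: integral_distr)
  define S where "S n \<omega> = (\<Sum>i<n. g (Y (Suc i) \<omega>))" for n :: nat and \<omega>
  have [measurable]: "S n \<in> borel_measurable M" for n unfolding S_def by measurable
  have "weak_conv_m (\<lambda>n. distr M borel (\<lambda>\<omega>. (\<Sum>i<n. g (Y (Suc i) \<omega>)) / sqrt (real n * (sqrt v)\<^sup>2)))
      std_normal_distribution"
  proof (rule central_limit_theorem_zero_mean[OF indep'])
    show "expectation (\<lambda>\<omega>. g (Y (Suc n) \<omega>)) = 0" for n using int[OF g, of n] mean by simp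
    show "integrable M (\<lambda>\<omega>. (g (Y (Suc n) \<omega>))\<^sup>2)" for n
    proof (rule integrable_const_bound)
      show "AE \<omega> in M. norm ((g (Y (Suc n) \<omega>))\<^sup>2) \<le> B\<^sup>2"
        using bound by (auto intro!: AE_I2 simp: abs_le_square_iff[symmetric] order_trans[OF _ abs_ge_self])
    qed measurable
    show "variance (\<lambda>\<omega>. g (Y (Suc n) \<omega>)) = (sqrt v)\<^sup>2" for n
      using int[OF g, of n] int[of "\<lambda>x. (g x)\<^sup>2" n] mean var v by simp
  qed (use v id in auto)
  then have wc: "weak_conv_m (\<lambda>n. distr M borel (\<lambda>\<omega>. S n \<omega> / sqrt (real n * v))) std_normal_distribution"
    using v by (simp add: S_def)
  have sum_eq: "(\<Sum>i=1..n. g (Y i \<omega>)) = S n \<omega>" for n \<omega>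
    unfolding S_def by (rule sum.reindex_bij_witness[of _ Suc "\<lambda>i. i - 1"]) auto
  show ?thesis unfolding sum_eq
  proof (rule levy_continuity)
    show "real_distribution (distr M borel (\<lambda>\<omega>. S n \<omega> / sqrt (real n)))" for n
      by (rule real_distribution_distr) simp
    show "real_distribution (normal_distribution 0 v)" by (rule real_distribution_normal[OF v])
    fix t :: real
    have "(\<lambda>n. char (distr M borel (\<lambda>\<omega>. S n \<omega> / sqrt (real n * v))) (sqrt v * t))
        \<longlonglongrightarrow> char std_normal_distribution (sqrt v * t)"
      by (rule levy_continuity1[OF _ real_dist_normal_dist wc]) (rule real_distribution_distr, simp)
    moreover have "char (distr M borel (\<lambda>\<omega>. S n \<omega> / sqrt (real n * v))) (sqrt v * t) =
        char (distr M borel (\<lambda>\<omega>. S n \<omega> / sqrt (real n))) t" for n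
      using v by (simp add: char_distr real_sqrt_mult field_simps)
    ultimately show "(\<lambda>n. char (distr M borel (\<lambda>\<omega>. S n \<omega> / sqrt (real n))) t)
        \<longlonglongrightarrow> char (normal_distribution 0 v) t"
      by (simp add: char_normal_distribution[OF v])
  qed
qed

text \<open>Hoeffding's inequality gives tightness of normalized sums of bounded functions directly.\<close>

lemma (in prob_space) bounded_in_prob_normalized_sum:
  fixes f :: "real \<Rightarrow> real" and Y :: "nat \<Rightarrow> 'a \<Rightarrow> real"
  assumes indep: "indep_vars (\<lambda>i. borel) Y {1..}"
    and ident: "\<And>i. i \<ge> 1 \<Longrightarrow> distr M borel (Y i) = \<mu>"
    and f[measurable]: "f \<in> borel_measurable borel" and bound: "\<And>x. \<bar>f x\<bar> \<le> B"
  shows "bounded_in_prob (\<lambda>n \<omega>. ((\<Sum>i=1..n. f (Y i \<omega>)) - n * (LINT x|\<mu>. f x)) / sqrt n)"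
  unfolding bounded_in_prob_def likely_def
proof (intro allI impI)
  fix \<eta> :: real assume \<eta>: "\<eta> > 0"
  have B: "B \<ge> 0" using bound[of 0] by linarith
  define C where "C = sqrt (\<bar>ln (4 / \<eta>)\<bar> * (2 * B + 2)\<^sup>2 / 2)"
  have C: "C \<ge> 0" "2 * exp (- 2 * C\<^sup>2 / (2 * B + 2)\<^sup>2) < \<eta>"
  proof -
    show "C \<ge> 0" by (simp add: C_def)
    have "- 2 * C\<^sup>2 / (2 * B + 2)\<^sup>2 = - \<bar>ln (4 / \<eta>)\<bar>"
    proof -
      have Csq: "C\<^sup>2 = \<bar>ln (4 / \<eta>)\<bar> * (2 * B + 2)\<^sup>2 / 2" unfolding C_def by (rule real_sqrt_pow2) simp
      have "(2 * B + 2)\<^sup>2 \<noteq> 0" using B by simp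
      then show ?thesis unfolding Csq by simp
    qed
    then have "2 * exp (- 2 * C\<^sup>2 / (2 * B + 2)\<^sup>2) \<le> 2 * exp (- ln (4 / \<eta>))" by simp
    also have "\<dots> < \<eta>" using \<eta> by (simp add: exp_minus)
    finally show "2 * exp (- 2 * C\<^sup>2 / (2 * B + 2)\<^sup>2) < \<eta>" .
  qed
  have Y[measurable]: "Y i \<in> borel_measurable M" if "i \<in> {1..}" for i
    using indep that by (auto simp: indep_vars_def)
  have "\<exists>E\<in>events. 1 - \<eta> \<le> prob E \<and>
      (\<forall>\<omega>\<in>E. \<bar>((\<Sum>i=1..n. f (Y i \<omega>)) - n * (LINT x|\<mu>. f x)) / sqrt n\<bar> \<le> C)" if n: "n \<ge> 1" for n :: nat
  proof -
    have [measurable]: "(\<lambda>\<omega>. \<Sum>i=1..n. f (Y i \<omega>)) \<in> borel_measurable M"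
    proof (rule borel_measurable_sum)
      fix i assume "i \<in> {1..n}"
      then show "(\<lambda>\<omega>. f (Y i \<omega>)) \<in> borel_measurable M"
        by (intro measurable_compose[OF Y f]) simp
    qed
    have iv: "indep_vars (\<lambda>i. borel) (\<lambda>i \<omega>. f (Y i \<omega>)) {1..n}"
      by (rule indep_vars_compose2[where X=Y and M'="\<lambda>_. borel"])
        (auto intro: indep_vars_subset[OF indep])
    interpret H: Hoeffding_ineq M "{1..n}" "\<lambda>i \<omega>. f (Y i \<omega>)" "\<lambda>_. - B - 1" "\<lambda>_. B + 1"
      "\<Sum>i\<in>{1..n}. expectation (\<lambda>\<omega>. f (Y i \<omega>))"
    proof unfold_locales
      show "AE x in M. f (Y i x) \<in> {- B - 1..B + 1}" for i
      proof (rule AE_I2)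
        fix x show "f (Y i x) \<in> {- B - 1..B + 1}" using bound[of "Y i x"] by simp linarith
      qed
    qed (use iv in auto)
    have ex: "expectation (\<lambda>\<omega>. f (Y i \<omega>)) = (LINT x|\<mu>. f x)" if "i \<in> {1..n}" for i
    proof -
      have "(LINT x|distr M borel (Y i). f x) = expectation (\<lambda>\<omega>. f (Y i \<omega>))"
        using that by (intro integral_distr Y f) simp
      then show ?thesis using ident[of i] that by simp
    qed
    have mean: "(\<Sum>i\<in>{1..n}. expectation (\<lambda>\<omega>. f (Y i \<omega>))) = n * (LINT x|\<mu>. f x)"
      using ex by simp
    let ?F = "{\<omega>\<in>space M. C * sqrt n \<le> \<bar>(\<Sum>i=1..n. f (Y i \<omega>)) - n * (LINT x|\<mu>. f x)\<bar>}"
    have "prob ?F \<le> 2 * exp (- 2 * (C * sqrt n)\<^sup>2 / (\<Sum>i\<in>{1..n}. ((B + 1) - (- B - 1))\<^sup>2))"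
      unfolding mean[symmetric]
    proof (rule H.Hoeffding_ineq_abs_ge)
      show "0 \<le> C * sqrt n" using C by simp
      have "0 < (B + 1 - (- B - 1))\<^sup>2" using B by (intro zero_less_power) linarith
      then show "0 < (\<Sum>i\<in>{1..n}. (B + 1 - (- B - 1))\<^sup>2)" using n by (intro sum_pos) auto
    qed
    also have "(\<Sum>i\<in>{1..n}. ((B + 1) - (- B - 1))\<^sup>2) = n * (2 * B + 2)\<^sup>2"
    proof -
      have "(B + 1) - (- B - 1) = 2 * B + 2" by simp
      then show ?thesis by (simp only: sum_constant card_atLeastAtMost) simp
    qed
    also have "- 2 * (C * sqrt n)\<^sup>2 / (n * (2 * B + 2)\<^sup>2) = - 2 * C\<^sup>2 / (2 * B + 2)\<^sup>2"
    proof -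
      have "(C * sqrt n)\<^sup>2 = C\<^sup>2 * n" by (simp add: power_mult_distrib)
      then show ?thesis using n by (simp only: minus_mult_minus) (simp add: field_simps)?
    qed
    finally have F: "prob ?F < \<eta>" using C by linarith
    have "?F \<in> events" by measurable
    moreover have "\<bar>((\<Sum>i=1..n. f (Y i \<omega>)) - n * (LINT x|\<mu>. f x)) / sqrt n\<bar> \<le> C"
      if "\<omega> \<in> space M - ?F" for \<omega>
      using that n by (auto simp: abs_divide divide_le_eq)
    ultimately show ?thesis using F
      by (intro bexI[of _ "space M - ?F"]) (auto simp: prob_compl)
  qed
  then show "\<exists>C. \<forall>\<^sub>F n in sequentially. \<exists>E\<in>events. 1 - \<eta> \<le> prob E \<and>
      (\<forall>\<omega>\<in>E. \<bar>((\<Sum>i=1..n. f (Y i \<omega>)) - n * (LINT x|\<mu>. f x)) / sqrt n\<bar> \<le> C)"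
    by (intro exI[of _ C] eventually_sequentiallyI[of 1])
qed

section \<open>Partial sums of order statistics\<close>

definition count_above :: "nat \<Rightarrow> (nat \<Rightarrow> real) \<Rightarrow> real \<Rightarrow> nat" where
  "count_above n y t = card {i\<in>{1..n}. t < y i}"

definition top_sum :: "(nat \<Rightarrow> real) \<Rightarrow> nat \<Rightarrow> nat \<Rightarrow> real" where
  "top_sum y n m = (\<Sum>i=1..m. order_stat n y i)"

lemma order_stat_antimono:
  assumes "1 \<le> i" "i \<le> j" "j \<le> n"
  shows "order_stat n y j \<le> order_stat n y i"
proof -
  let ?l = "sort (map y [1..<Suc n])"
  have "rev ?l ! (j - 1) = ?l ! (n - j)" "rev ?l ! (i - 1) = ?l ! (n - i)"
    using assms by (simp_all add: rev_nth del: upt_Suc)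
  moreover have "?l ! (n - j) \<le> ?l ! (n - i)"
    using assms by (intro sorted_nth_mono) (auto simp del: upt_Suc)
  ultimately show ?thesis by (simp add: order_stat_def del: upt_Suc)
qed

lemma image_mset_order_stat:
  "image_mset (order_stat n y) (mset_set {1..n}) = image_mset y (mset_set {1..n})"
proof -
  let ?l = "rev (sort (map y [1..<Suc n]))"
  have upt: "mset_set {1..n} = mset [1..<Suc n]"
    unfolding mset_upt atLeastLessThanSuc_atLeastAtMost ..
  have "image_mset (order_stat n y) (mset_set {1..n}) = mset (map (order_stat n y) [1..<Suc n])"
    unfolding upt mset_map ..
  also have "map (order_stat n y) [1..<Suc n] = ?l"
    by (rule nth_equalityI) (auto simp: order_stat_def simp del: upt_Suc)
  also have "mset ?l = image_mset y (mset_set {1..n})"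
    unfolding upt by simp
  finally show ?thesis .
qed

lemma sum_order_stat: "(\<Sum>i=1..n. h (order_stat n y i)) = (\<Sum>i=1..n. h (y i))"
proof -
  have "(\<Sum>i=1..n. h (order_stat n y i)) = \<Sum>\<^sub># (image_mset h (image_mset (order_stat n y) (mset_set {1..n})))"
    by (simp add: sum_unfold_sum_mset multiset.map_comp comp_def)
  also have "\<dots> = (\<Sum>i=1..n. h (y i))"
    unfolding image_mset_order_stat by (simp add: sum_unfold_sum_mset multiset.map_comp comp_def)
  finally show ?thesis .
qed

lemma count_above_eq_sum: "count_above n y t = (\<Sum>i=1..n. if t < y i then 1 else 0)"
  unfolding count_above_def by (simp add: sum.If_cases Int_def)

lemma count_above_order_stat: "count_above n (order_stat n y) t = count_above n y t"
  unfolding count_above_eq_sum by (rule sum_order_stat)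

lemma order_stat_above_iff:
  assumes i: "1 \<le> i" "i \<le> n"
  shows "t < order_stat n y i \<longleftrightarrow> i \<le> count_above n y t"
proof
  assume t: "t < order_stat n y i"
  have "{1..i} \<subseteq> {j\<in>{1..n}. t < order_stat n y j}"
    using i t order_stat_antimono[of _ i n y] by (fastforce intro: less_le_trans)
  then have "card {1..i} \<le> count_above n (order_stat n y) t"
    unfolding count_above_def by (intro card_mono) auto
  then show "i \<le> count_above n y t" by (simp add: count_above_order_stat)
next
  assume c: "i \<le> count_above n y t"
  show "t < order_stat n y i"
  proof (rule ccontr)
    assume nt: "\<not> t < order_stat n y i"
    have "{j\<in>{1..n}. t < order_stat n y j} \<subseteq> {1..<i}"
    proof
      fix j assume j: "j \<in> {j\<in>{1..n}. t < order_stat n y j}"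
      have "j < i"
      proof (rule ccontr)
        assume "\<not> j < i"
        then have "order_stat n y j \<le> order_stat n y i"
          using i j by (intro order_stat_antimono) auto
        then show False using j nt by auto
      qed
      then show "j \<in> {1..<i}" using j by simp
    qed
    then have "count_above n (order_stat n y) t \<le> card {1..<i}"
      unfolding count_above_def by (intro card_mono) auto
    then show False using c i by (simp add: count_above_order_stat)
  qed
qed

lemma count_above_le: "count_above n y t \<le> n"
proof -
  have "card {i\<in>{1..n}. t < y i} \<le> card {1..n}" by (rule card_mono) auto
  then show ?thesis by (simp add: count_above_def)
qed

lemma sum_positive_part_order_stat:
  "(\<Sum>i=1..n. max (y i - t) 0) = (\<Sum>i=1..count_above n y t. order_stat n y i - t)"
proof -
  let ?N = "count_above n y t"
  have "(\<Sum>i=1..n. max (y i - t) 0) = (\<Sum>i=1..n. max (order_stat n y i - t) 0)"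
    by (rule sum_order_stat[of "\<lambda>x. max (x - t) 0", symmetric])
  also have "\<dots> = (\<Sum>i=1..?N. max (order_stat n y i - t) 0)"
  proof (rule sum.mono_neutral_right)
    show "\<forall>i\<in>{1..n} - {1..?N}. max (order_stat n y i - t) 0 = 0"
    proof
      fix i assume "i \<in> {1..n} - {1..?N}"
      then show "max (order_stat n y i - t) 0 = 0" using order_stat_above_iff[of i n t y] by auto
    qed
  qed (use count_above_le[of n y t] in auto)
  also have "\<dots> = (\<Sum>i=1..?N. order_stat n y i - t)"
  proof (intro sum.cong refl)
    fix i assume "i \<in> {1..?N}"
    then have "t < order_stat n y i"
      using order_stat_above_iff[of i n t y] count_above_le[of n y t] by auto
    then show "max (order_stat n y i - t) 0 = order_stat n y i - t" by simp
  qed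
  finally show ?thesis .
qed

lemma sum_upto_diff_le:
  fixes f :: "nat \<Rightarrow> real"
  assumes "\<And>i. min m N < i \<Longrightarrow> i \<le> max m N \<Longrightarrow> \<bar>f i\<bar> \<le> \<delta>"
  shows "\<bar>(\<Sum>i=1..m. f i) - (\<Sum>i=1..N. f i)\<bar> \<le> \<bar>real m - real N\<bar> * \<delta>"
  using assms
proof (induction m N rule: linorder_wlog)
  case (le m N)
  have "(\<Sum>i=1..m. f i) - (\<Sum>i=1..N. f i) = - (\<Sum>i=m+1..N. f i)"
    using le sum.ub_add_nat[of 1 m f "N - m"] by simp
  then have "\<bar>(\<Sum>i=1..m. f i) - (\<Sum>i=1..N. f i)\<bar> \<le> (\<Sum>i=m+1..N. \<bar>f i\<bar>)"
    by (simp add: sum_abs)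
  also have "\<dots> \<le> (\<Sum>i=m+1..N. \<delta>)" using le by (intro sum_mono) auto
  also have "\<dots> = \<bar>real m - real N\<bar> * \<delta>" using le by simp
  finally show ?case .
next
  case (sym m N)
  then show ?case by (simp add: min.commute max.commute abs_minus_commute)
qed

text \<open>
  The sum of \<open>y\<^sub>i - t\<close> over the \<open>N\<close> entries above \<open>t\<close> is the sum of the positive parts.  Replacing \<open>N\<close> by \<open>m\<close>
  changes it by the terms with ranks between \<open>m\<close> and \<open>N\<close>, and each of them lies between \<open>0\<close> and the \<open>m\<close>-th
  largest entry minus \<open>t\<close>.  The hypotheses on the counts say that this entry is within \<open>\<delta>\<close> of \<open>t\<close>.
\<close>

lemma top_sum_approx:
  assumes m: "m \<le> n" and hi: "count_above n y (t + \<delta>) < m" and lo: "m \<le> count_above n y (t - \<delta>)"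
  shows "\<bar>top_sum y n m - (m * t + (\<Sum>i=1..n. max (y i - t) 0))\<bar> \<le> \<bar>real m - count_above n y t\<bar> * \<delta>"
proof -
  let ?N = "count_above n y t" and ?o = "order_stat n y"
  have m1: "1 \<le> m" using hi by simp
  have om: "?o m \<le> t + \<delta>" "t - \<delta> < ?o m"
    using order_stat_above_iff[of m n "t + \<delta>" y] order_stat_above_iff[of m n "t - \<delta>" y] m1 m hi lo
    by auto
  have "top_sum y n m - m * t = (\<Sum>i=1..m. ?o i - t)" by (simp add: top_sum_def sum_subtractf)
  then have "top_sum y n m - (m * t + (\<Sum>i=1..n. max (y i - t) 0)) = (\<Sum>i=1..m. ?o i - t) - (\<Sum>i=1..?N. ?o i - t)"
    unfolding sum_positive_part_order_stat[of y t n] by linarith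
  moreover have "\<bar>?o i - t\<bar> \<le> \<delta>" if i: "min m ?N < i" "i \<le> max m ?N" for i
  proof (cases "m \<le> ?N")
    case True
    then have "t < ?o i" "?o i \<le> ?o m"
      using i m1 order_stat_above_iff[of i n t y] order_stat_antimono[of m i n y] count_above_le[of n y t] by auto
    then show ?thesis using om by simp
  next
    case False
    then have "\<not> t < ?o i" "?o m \<le> ?o i"
      using i m order_stat_above_iff[of i n t y] order_stat_antimono[of i m n y] by auto
    then show ?thesis using om by simp
  qed
  ultimately show ?thesis using sum_upto_diff_le[of m ?N "\<lambda>i. ?o i - t" \<delta>] by simp
qed

section \<open>Quantile bands of a uniform variable\<close>

text \<open>
  The quantile function \<open>u \<mapsto> c u\<^sup>-\<^sup>\<xi>\<close>, constant outside \<open>[p, q]\<close> and shifted to vanish beyond \<open>q\<close>.  Clamping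
  the argument instead of the value keeps it continuous at \<open>u = 0\<close>.
\<close>

definition band :: "real \<Rightarrow> real \<Rightarrow> real \<Rightarrow> real \<Rightarrow> real \<Rightarrow> real" where
  "band c \<xi> p q u = c * max p (min u q) powr (- \<xi>) - c * q powr (- \<xi>)"

lemma band_eq_0: "p \<le> q \<Longrightarrow> q \<le> u \<Longrightarrow> band c \<xi> p q u = 0"
  by (simp add: band_def)

lemma band_eq_full: "p \<le> q \<Longrightarrow> u \<le> p \<Longrightarrow> band c \<xi> p q u = c * p powr (- \<xi>) - c * q powr (- \<xi>)"
  by (simp add: band_def)

lemma band_eq_inside: "p \<le> u \<Longrightarrow> u \<le> q \<Longrightarrow> band c \<xi> p q u = c * u powr (- \<xi>) - c * q powr (- \<xi>)"
  by (simp add: band_def)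

lemma continuous_on_band: "0 < p \<Longrightarrow> continuous_on S (band c \<xi> p q)"
  unfolding band_def by (intro continuous_intros) (auto simp: max_def)

lemma has_integral_band:
  assumes p: "0 < p" "p < q" "q \<le> 1" and h0: "h 0 = (0::real)"
    and I: "((\<lambda>u. h (c * u powr (- \<xi>) - c * q powr (- \<xi>))) has_integral I) {p..q}"
  shows "((\<lambda>u. h (band c \<xi> p q u)) has_integral
      p * h (c * p powr (- \<xi>) - c * q powr (- \<xi>)) + I) {0..1}"
proof -
  have "((\<lambda>u. h (c * p powr (- \<xi>) - c * q powr (- \<xi>))) has_integral
      p * h (c * p powr (- \<xi>) - c * q powr (- \<xi>))) {0..p}"
    using has_integral_const_real[of "h (c * p powr (- \<xi>) - c * q powr (- \<xi>))" 0 p] p by simp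
  then have 1: "((\<lambda>u. h (band c \<xi> p q u)) has_integral
      p * h (c * p powr (- \<xi>) - c * q powr (- \<xi>))) {0..p}"
    by (rule has_integral_eq[rotated]) (use p in \<open>auto simp: band_eq_full\<close>)
  have 2: "((\<lambda>u. h (band c \<xi> p q u)) has_integral I) {p..q}"
    using I by (rule has_integral_eq[rotated]) (use p in \<open>auto simp: band_eq_inside\<close>)
  have 3: "((\<lambda>u. h (band c \<xi> p q u)) has_integral 0) {q..1}"
    by (rule has_integral_is_0) (use p h0 in \<open>auto simp: band_eq_0\<close>)
  have "((\<lambda>u. h (band c \<xi> p q u)) has_integral
      p * h (c * p powr (- \<xi>) - c * q powr (- \<xi>)) + I) {0..q}"
    by (rule has_integral_combine[OF _ _ 1 2]) (use p in auto)
  from has_integral_combine[OF _ _ this 3] p show ?thesis by simp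
qed

lemma has_integral_powr_neg:
  assumes "0 < p" "p \<le> q" "\<xi> \<noteq> (1::real)"
  shows "((\<lambda>u. u powr (- \<xi>)) has_integral (q powr (1 - \<xi>) - p powr (1 - \<xi>)) / (1 - \<xi>)) {p..q}"
proof -
  have "((\<lambda>u. u powr (- \<xi>)) has_integral (q powr (1 - \<xi>) / (1 - \<xi>) - p powr (1 - \<xi>) / (1 - \<xi>))) {p..q}"
  proof (rule fundamental_theorem_of_calculus)
    fix u assume "u \<in> {p..q}"
    then have "((\<lambda>u. u powr (1 - \<xi>) / (1 - \<xi>)) has_real_derivative u powr (- \<xi>)) (at u)"
      using assms by (auto intro!: derivative_eq_intros)
    then show "((\<lambda>u. u powr (1 - \<xi>) / (1 - \<xi>)) has_vector_derivative u powr (- \<xi>)) (at u within {p..q})"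
      by (auto simp: has_real_derivative_iff_has_vector_derivative intro: has_vector_derivative_at_within)
  qed fact
  then show ?thesis by (simp add: diff_divide_distrib)
qed

text \<open>
  The integral of \<open>u\<^sup>-\<^sup>2\<^sup>\<xi>\<close> from \<open>p\<close> to \<open>q\<close>.
\<close>

definition powr_integral :: "real \<Rightarrow> real \<Rightarrow> real \<Rightarrow> real" where
  "powr_integral \<xi> p q =
     (if \<xi> = 1/2 then ln (q / p) else (q powr (1 - 2 * \<xi>) - p powr (1 - 2 * \<xi>)) / (1 - 2 * \<xi>))"

lemma has_integral_powr_neg_double:
  assumes "0 < p" "p \<le> q"
  shows "((\<lambda>u. u powr (- 2 * \<xi>)) has_integral powr_integral \<xi> p q) {p..q}"
proof (cases "\<xi> = 1/2")
  case True
  have "((\<lambda>u. u powr (- 2 * \<xi>)) has_integral (ln q - ln p)) {p..q}"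
  proof (rule fundamental_theorem_of_calculus)
    fix u assume u: "u \<in> {p..q}"
    then have "(ln has_real_derivative inverse u) (at u)"
      using assms by (intro DERIV_ln) auto
    moreover have "u powr (- 2 * \<xi>) = inverse u"
    proof -
      have "- 2 * \<xi> = - 1" using True by simp
      then show ?thesis using u assms by (simp only:) (simp add: powr_minus)
    qed
    ultimately show "(ln has_vector_derivative u powr (- 2 * \<xi>)) (at u within {p..q})"
      by (metis has_real_derivative_iff_has_vector_derivative has_vector_derivative_at_within)
  qed fact
  moreover have "powr_integral \<xi> p q = ln q - ln p" using assms True by (simp add: powr_integral_def ln_div)
  ultimately show ?thesis by (simp only:)
next
  case False
  then show ?thesis using has_integral_powr_neg[of p q "2 * \<xi>"] assms by (simp add: powr_integral_def)
qed

definition band_mean :: "real \<Rightarrow> real \<Rightarrow> real \<Rightarrow> real \<Rightarrow> real" where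
  "band_mean c \<xi> p q = c * \<xi> * (q powr (1 - \<xi>) - p powr (1 - \<xi>)) / (1 - \<xi>)"

lemma powr_one_minus: "0 < x \<Longrightarrow> x powr (1 - \<xi>) = x * x powr (- \<xi>)" for x :: real
  by (simp add: powr_diff powr_minus divide_inverse)

lemma band_mean_eq_mu:
  assumes p: "0 < p" "0 < q" and \<alpha>: "\<alpha> > 1"
  shows "band_mean c (1/\<alpha>) p q =
    mu c \<alpha> p q + p * (c * p powr (- (1/\<alpha>))) - q * (c * q powr (- (1/\<alpha>)))"
proof -
  define \<xi> where "\<xi> = 1/\<alpha>"
  have \<xi>: "\<xi> < 1" using \<alpha> by (simp add: \<xi>_def)
  define a b where "a = p powr (- \<xi>)" "b = q powr (- \<xi>)"
  have "band_mean c \<xi> p q = c * ((q * b - p * a) / (1 - \<xi>)) + p * (c * a) - q * (c * b)"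
    using \<xi> p unfolding band_mean_def a_b_def by (simp add: powr_one_minus field_simps)
  then show ?thesis using p unfolding mu_def Let_def \<xi>_def[symmetric]
    by (simp add: powr_one_minus a_b_def)
qed

lemma integral_band:
  assumes p: "0 < p" "p < q" "q \<le> 1" and \<xi>: "\<xi> < 1"
  shows "(band c \<xi> p q has_integral band_mean c \<xi> p q) {0..1}"
proof -
  define a b where "a = p powr (- \<xi>)" "b = q powr (- \<xi>)"
  have P: "p powr (1 - \<xi>) = p * a" and Q: "q powr (1 - \<xi>) = q * b"
    using p by (auto simp: a_b_def powr_one_minus)
  have "((\<lambda>u. c * u powr (- \<xi>) - c * b) has_integral c * ((q * b - p * a) / (1 - \<xi>)) - c * b * (q - p)) {p..q}"
    using has_integral_diff[OF has_integral_mult_right[OF has_integral_powr_neg[of p q \<xi>], of c]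
      has_integral_const_real[of "c * b" p q]] p \<xi> by (simp add: P Q mult_ac)
  from has_integral_band[of p q "\<lambda>x. x", OF p refl this[unfolded a_b_def]]
  have "(band c \<xi> p q has_integral
      p * (c * a - c * b) + (c * ((q * b - p * a) / (1 - \<xi>)) - c * b * (q - p))) {0..1}"
    by (simp add: a_b_def)
  moreover have "p * (c * a - c * b) + (c * ((q * b - p * a) / (1 - \<xi>)) - c * b * (q - p)) =
      band_mean c \<xi> p q"
    using \<xi> by (simp add: band_mean_def P Q field_simps)
  ultimately show ?thesis by simp
qed

text \<open>
  The integral and the formula are rational in \<open>\<xi>\<close>, \<open>p\<close>, \<open>q\<close>, \<open>p\<^sup>-\<^sup>\<xi>\<close>, \<open>q\<^sup>-\<^sup>\<xi>\<close> and the integral of \<open>u\<^sup>-\<^sup>2\<^sup>\<xi>\<close>, and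
  they agree because \<open>1 - 2 \<xi>\<close> times that integral is \<open>q\<^sup>1\<^sup>-\<^sup>2\<^sup>\<xi> - p\<^sup>1\<^sup>-\<^sup>2\<^sup>\<xi>\<close>, also when \<open>\<xi> = 1/2\<close>.
\<close>

lemma integral_band_sq:
  assumes p: "0 < p" "p < q" "q \<le> 1" and \<alpha>: "\<alpha> > 1"
  shows "((\<lambda>u. (band c (1/\<alpha>) p q u)\<^sup>2) has_integral sigma2 c \<alpha> p q + (band_mean c (1/\<alpha>) p q)\<^sup>2) {0..1}"
proof -
  define \<xi> where "\<xi> = 1/\<alpha>"
  have \<xi>: "\<xi> < 1" "0 < \<xi>" using \<alpha> by (auto simp: \<xi>_def)
  define a b D where "a = p powr (- \<xi>)" "b = q powr (- \<xi>)" "D = powr_integral \<xi> p q"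
  have P: "p powr (1 - \<xi>) = p * a" and Q: "q powr (1 - \<xi>) = q * b"
    using p by (auto simp: a_b_D_def powr_one_minus)
  have PP: "p powr (2 - 2 * \<xi>) = (p * a)\<^sup>2" and QQ: "q powr (2 - 2 * \<xi>) = (q * b)\<^sup>2"
    unfolding P[symmetric] Q[symmetric] power2_eq_square by (simp_all flip: powr_add)
  have sq: "x powr (1 - 2 * \<xi>) = x * (x powr (- \<xi>))\<^sup>2" if "x > 0" for x
    using that powr_one_minus[of x "2 * \<xi>"] by (simp add: power2_eq_square flip: powr_add)
  have D: "(1 - 2 * \<xi>) * D = q * b\<^sup>2 - p * a\<^sup>2"
  proof (cases "\<xi> = 1/2")
    case True
    then have z: "1 - 2 * \<xi> = 0" by simp
    have "q * b\<^sup>2 = 1" "p * a\<^sup>2 = 1"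
      using sq[of p] sq[of q] p unfolding z by (simp_all add: a_b_D_def)
    then show ?thesis using True by simp
  next
    case False
    then show ?thesis using sq[of p] sq[of q] p by (simp add: a_b_D_def powr_integral_def)
  qed
  have "((\<lambda>u. c\<^sup>2 * u powr (- 2 * \<xi>) - 2 * c\<^sup>2 * b * u powr (- \<xi>) + c\<^sup>2 * b\<^sup>2) has_integral
      c\<^sup>2 * D - 2 * c\<^sup>2 * b * ((q * b - p * a) / (1 - \<xi>)) + c\<^sup>2 * b\<^sup>2 * (q - p)) {p..q}"
    using has_integral_add[OF has_integral_diff[OF
        has_integral_mult_right[OF has_integral_powr_neg_double[of p q \<xi>], of "c\<^sup>2"]
        has_integral_mult_right[OF has_integral_powr_neg[of p q \<xi>], of "2 * c\<^sup>2 * b"]]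
        has_integral_const_real[of "c\<^sup>2 * b\<^sup>2" p q]] p \<xi>
    by (simp add: P Q a_b_D_def mult_ac)
  then have "((\<lambda>u. (c * u powr (- \<xi>) - c * b)\<^sup>2) has_integral
      c\<^sup>2 * D - 2 * c\<^sup>2 * b * ((q * b - p * a) / (1 - \<xi>)) + c\<^sup>2 * b\<^sup>2 * (q - p)) {p..q}"
  proof (rule has_integral_eq[rotated])
    fix u assume "u \<in> {p..q}"
    have "u powr (- 2 * \<xi>) = (u powr (- \<xi>))\<^sup>2" by (simp add: power2_eq_square flip: powr_add)
    then show "c\<^sup>2 * u powr (- 2 * \<xi>) - 2 * c\<^sup>2 * b * u powr (- \<xi>) + c\<^sup>2 * b\<^sup>2 = (c * u powr (- \<xi>) - c * b)\<^sup>2"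
      by (simp add: power2_eq_square algebra_simps)
  qed
  from has_integral_band[of p q "\<lambda>x. x\<^sup>2", OF p _ this[unfolded a_b_D_def(2)]]
  have "((\<lambda>u. (band c \<xi> p q u)\<^sup>2) has_integral p * (c * a - c * b)\<^sup>2 +
      (c\<^sup>2 * D - 2 * c\<^sup>2 * b * ((q * b - p * a) / (1 - \<xi>)) + c\<^sup>2 * b\<^sup>2 * (q - p))) {0..1}"
    by (simp add: a_b_D_def)
  moreover have "p * (c * a - c * b)\<^sup>2 +
      (c\<^sup>2 * D - 2 * c\<^sup>2 * b * ((q * b - p * a) / (1 - \<xi>)) + c\<^sup>2 * b\<^sup>2 * (q - p)) =
      sigma2 c \<alpha> p q + (band_mean c \<xi> p q)\<^sup>2"
  proof -
    have s: "sigma2 c \<alpha> p q = 2 * c\<^sup>2 * \<xi>\<^sup>2 / (1 - \<xi>) * (D + p * a * ((b - a) / \<xi>)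
        - (q * b - p * a)\<^sup>2 / (2 - 2 * \<xi>))"
      unfolding sigma2_def Let_def \<xi>_def[symmetric] P Q PP QQ a_b_D_def powr_integral_def
      by (simp add: power2_eq_square algebra_simps diff_divide_distrib add_divide_distrib)
    obtain e where e: "e * (1 - \<xi>) = 1" "\<And>x. x / (1 - \<xi>) = x * e"
      using \<xi> by (metis divide_inverse less_irrefl mult.commute right_inverse right_minus_eq)
    have "(sigma2 c \<alpha> p q + (band_mean c \<xi> p q)\<^sup>2) * (1 - \<xi>) = c\<^sup>2 * (2 * \<xi>\<^sup>2 * D + 2 * \<xi> * p * a * (b - a))"
    proof -
      have d: "2 - 2 * \<xi> = 2 * (1 - \<xi>)" by simp
      obtain f where f: "f * \<xi> = 1" "\<And>x. x / \<xi> = x * f"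
        using \<xi> by (metis divide_inverse less_irrefl mult.commute right_inverse)
      obtain g where g: "(q * b - p * a)\<^sup>2 / 2 = g" by blast
      then have g': "(q * b - p * a)\<^sup>2 = 2 * g" by simp
      have "(2 * c\<^sup>2 * \<xi>\<^sup>2 * e * (D + p * a * ((b - a) * f) - g * e) + (c * \<xi> * (q * b - p * a) * e)\<^sup>2) * (1 - \<xi>)
        = 2 * c\<^sup>2 * \<xi>\<^sup>2 * (e * (1 - \<xi>)) * D + 2 * c\<^sup>2 * \<xi> * (f * \<xi>) * (e * (1 - \<xi>)) * (p * a * (b - a))
          + c\<^sup>2 * \<xi>\<^sup>2 * e\<^sup>2 * (1 - \<xi>) * ((q * b - p * a)\<^sup>2 - 2 * g)"
        by (simp add: power2_eq_square algebra_simps)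
      also have "\<dots> = c\<^sup>2 * (2 * \<xi>\<^sup>2 * D + 2 * \<xi> * p * a * (b - a))"
        unfolding e(1) f(1) g' by (simp add: algebra_simps)
      finally show ?thesis
        unfolding s band_mean_def P Q d divide_divide_eq_left[symmetric] g e(2) f(2) .
    qed
    also have "\<dots> = (p * (c * a - c * b)\<^sup>2 +
        (c\<^sup>2 * D - 2 * c\<^sup>2 * b * ((q * b - p * a) / (1 - \<xi>)) + c\<^sup>2 * b\<^sup>2 * (q - p))) * (1 - \<xi>)"
    proof -
      have "(p * (c * a - c * b)\<^sup>2 + (c\<^sup>2 * D - 2 * c\<^sup>2 * b * ((q * b - p * a) * e) + c\<^sup>2 * b\<^sup>2 * (q - p))) * (1 - \<xi>)
        = c\<^sup>2 * (1 - \<xi>) * (p * (a - b)\<^sup>2 + D + b\<^sup>2 * (q - p)) - 2 * c\<^sup>2 * b * (q * b - p * a) * (e * (1 - \<xi>))"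
        by (simp add: power2_eq_square algebra_simps)
      also have "\<dots> = c\<^sup>2 * (2 * \<xi>\<^sup>2 * D + 2 * \<xi> * p * a * (b - a))
          + c\<^sup>2 * (1 + \<xi>) * ((1 - 2 * \<xi>) * D - (q * b\<^sup>2 - p * a\<^sup>2))"
        unfolding e(1) by (simp add: power2_eq_square algebra_simps)
      finally show ?thesis unfolding e(2) D by simp
    qed
    finally show ?thesis using \<xi> by simp
  qed
  ultimately show ?thesis by (simp add: \<xi>_def)
qed

text \<open>
  Where the left band does not vanish, the right one still has its full height, so the product
  reduces to a multiple of the left band.
\<close>

lemma integral_band_mult:
  assumes p: "0 < p" "p < q" "q \<le> p'" "p' < q'" "q' \<le> 1" and \<xi>: "\<xi> < 1"
  shows "((\<lambda>u. band c \<xi> p q u * band c \<xi> p' q' u) has_integral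
    band_mean c \<xi> p q * (c * p' powr (- \<xi>) - c * q' powr (- \<xi>))) {0..1}"
proof -
  have "((\<lambda>u. band c \<xi> p q u * (c * p' powr (- \<xi>) - c * q' powr (- \<xi>))) has_integral
    band_mean c \<xi> p q * (c * p' powr (- \<xi>) - c * q' powr (- \<xi>))) {0..1}"
    using p by (intro has_integral_mult_left integral_band \<xi>) auto
  then show ?thesis
  proof (rule has_integral_eq[rotated])
    fix u :: real
    show "band c \<xi> p q u * (c * p' powr (- \<xi>) - c * q' powr (- \<xi>)) = band c \<xi> p q u * band c \<xi> p' q' u"
      using p by (cases "u \<le> q") (auto simp: band_eq_0 band_eq_full)
  qed
qed

section \<open>Minimum distance: from the moments to the minimizer\<close>

definition qform :: "nat \<Rightarrow> (nat \<Rightarrow> nat \<Rightarrow> real) \<Rightarrow> (nat \<Rightarrow> real) \<Rightarrow> real" where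
  "qform d W x = (\<Sum>i<d. \<Sum>j<d. x i * W i j * x j)"

lemma qform_scale: "qform d W (\<lambda>i. t * x i) = t\<^sup>2 * qform d W x"
  by (simp add: qform_def sum_distrib_left power2_eq_square mult_ac)

lemma qform_cong: "(\<And>i. i < d \<Longrightarrow> x i = y i) \<Longrightarrow> qform d W x = qform d W y"
  by (simp add: qform_def)

text \<open>
  The line \<open>h \<mapsto> R h\<close> is closest to \<open>\<zeta>\<close>, in the form of \<open>W\<close>, at \<open>h = \<eta>\<close>; completing the square there.
\<close>

lemma qform_line:
  assumes sym: "\<And>i j. i < d \<Longrightarrow> j < d \<Longrightarrow> W i j = W j i" and pos: "qform d W R \<noteq> 0"
    and \<eta>: "\<eta> = (\<Sum>i<d. (\<Sum>j<d. W i j * R j) / qform d W R * \<zeta> i)"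
  shows "qform d W (\<lambda>i. R i * h - \<zeta> i) = qform d W (\<lambda>i. R i * \<eta> - \<zeta> i) + qform d W R * (h - \<eta>)\<^sup>2"
proof -
  define b where "b = (\<Sum>i<d. \<Sum>j<d. \<zeta> i * W i j * R j)"
  have b: "b = qform d W R * \<eta>"
    using pos by (simp add: \<eta> b_def sum_distrib_left sum_distrib_right sum_divide_distrib mult_ac)
  have b': "(\<Sum>i<d. \<Sum>j<d. R i * W i j * \<zeta> j) = b"
    unfolding b_def by (subst sum.swap) (intro sum.cong refl, simp add: sym mult_ac)
  have expand: "qform d W (\<lambda>i. R i * x - \<zeta> i) = qform d W R * x\<^sup>2 - 2 * b * x + qform d W \<zeta>" for x
  proof -
    have "qform d W (\<lambda>i. R i * x - \<zeta> i) =
      (\<Sum>i<d. \<Sum>j<d. x\<^sup>2 * (R i * W i j * R j) - x * (\<zeta> i * W i j * R j)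
         - x * (R i * W i j * \<zeta> j) + \<zeta> i * W i j * \<zeta> j)"
      unfolding qform_def by (intro sum.cong refl) (simp add: algebra_simps power2_eq_square)
    also have "\<dots> = x\<^sup>2 * qform d W R - x * b - x * b + qform d W \<zeta>"
      unfolding sum.distrib sum_subtractf sum_distrib_left[symmetric] b' qform_def
      by (simp add: b_def)
    finally show ?thesis by simp
  qed
  show ?thesis unfolding expand b by (simp add: power2_eq_square algebra_simps)
qed

lemma qform_le:
  assumes "\<And>i j. i < d \<Longrightarrow> j < d \<Longrightarrow> \<bar>W i j\<bar> \<le> U i j" and "\<And>i. i < d \<Longrightarrow> \<bar>x i\<bar> \<le> B"
  shows "qform d W x \<le> (\<Sum>i<d. \<Sum>j<d. U i j) * B\<^sup>2"
proof -
  have "qform d W x \<le> (\<Sum>i<d. \<Sum>j<d. U i j * B\<^sup>2)"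
    unfolding qform_def
  proof (intro sum_mono)
    fix i j assume i: "i \<in> {..<d}" and j: "j \<in> {..<d}"
    have B: "0 \<le> B" using assms(2)[of i] i by auto
    have "x i * W i j * x j \<le> \<bar>W i j\<bar> * (\<bar>x i\<bar> * \<bar>x j\<bar>)"
      by (rule order_trans[OF abs_ge_self]) (simp add: abs_mult mult_ac)
    also have "\<dots> \<le> U i j * (B * B)"
      using assms i j B by (intro mult_mono) (auto intro: order_trans[OF abs_ge_zero])
    finally show "x i * W i j * x j \<le> U i j * B\<^sup>2" by (simp add: power2_eq_square)
  qed
  then show ?thesis by (simp add: sum_distrib_right)
qed

lemma common_convergent_subseq:
  fixes x :: "nat \<Rightarrow> nat \<Rightarrow> real"
  assumes "\<And>i n. i < k \<Longrightarrow> \<bar>x n i\<bar> \<le> B i"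
  shows "\<exists>\<sigma> l. strict_mono \<sigma> \<and> (\<forall>i<k. (\<lambda>n. x (\<sigma> n) i) \<longlonglongrightarrow> l i)"
  using assms
proof (induction k)
  case 0
  show ?case by (intro exI[of _ id]) (simp add: strict_mono_def)
next
  case (Suc k)
  then obtain \<sigma> l where \<sigma>: "strict_mono \<sigma>" "\<And>i. i < k \<Longrightarrow> (\<lambda>n. x (\<sigma> n) i) \<longlonglongrightarrow> l i"
    by (metis less_SucI)
  have sc: "seq_compact {- B k..B k}" by (rule compact_imp_seq_compact) simp
  have "\<forall>n. x (\<sigma> n) k \<in> {- B k..B k}"
  proof
    fix n show "x (\<sigma> n) k \<in> {- B k..B k}" using Suc.prems[of k "\<sigma> n"] by auto
  qed
  then obtain m \<rho> where \<rho>: "strict_mono \<rho>" "((\<lambda>n. x (\<sigma> n) k) \<circ> \<rho>) \<longlonglongrightarrow> m"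
    using seq_compactE[OF sc, of "\<lambda>n. x (\<sigma> n) k"] by blast
  have "(\<lambda>n. x ((\<sigma> \<circ> \<rho>) n) i) \<longlonglongrightarrow> (if i = k then m else l i)" if "i < Suc k" for i
    using that \<rho>(2) LIMSEQ_subseq_LIMSEQ[OF \<sigma>(2) \<rho>(1), of i] by (auto simp: comp_def less_Suc_eq)
  then have "\<forall>i<Suc k. (\<lambda>n. x ((\<sigma> \<circ> \<rho>) n) i) \<longlonglongrightarrow> (if i = k then m else l i)" by simp
  moreover have "strict_mono (\<sigma> \<circ> \<rho>)" using \<sigma>(1) \<rho>(1) by (rule strict_mono_o)
  ultimately show ?case
    by (intro exI[of _ "\<sigma> \<circ> \<rho>"] exI[of _ "\<lambda>i. if i = k then m else l i"] conjI)
qed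

text \<open>
  Gathers what has to hold with high probability: \<open>a\<close> minimizes the criterion with shares \<open>s\<close> and
  weights \<open>V\<close> close to \<open>G\<close>.  The lower bound \<open>\<kappa>\<close> is what makes a small criterion force \<open>r(a)\<close> to be close to \<open>s\<close>.
\<close>

definition min_dist_at :: "nat \<Rightarrow> (nat \<Rightarrow> real \<Rightarrow> real) \<Rightarrow> (real \<Rightarrow> nat \<Rightarrow> nat \<Rightarrow> real) \<Rightarrow> real set \<Rightarrow> real \<Rightarrow> real \<Rightarrow>
    (nat \<Rightarrow> real) \<Rightarrow> (real \<Rightarrow> nat \<Rightarrow> nat \<Rightarrow> real) \<Rightarrow> real \<Rightarrow> bool" where
  "min_dist_at d r G A \<kappa> \<delta> s V a \<longleftrightarrow>
     (\<forall>\<alpha>\<in>A. \<forall>i<d. \<forall>j<d. \<bar>V \<alpha> i j - G \<alpha> i j\<bar> \<le> \<delta>) \<and>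
     (\<forall>\<alpha>\<in>A. \<forall>x. \<kappa> * (\<Sum>i<d. (x i)\<^sup>2) \<le> qform d (V \<alpha>) x) \<and>
     a \<in> A \<and> (\<forall>\<alpha>\<in>A. qform d (V a) (\<lambda>i. r i a - s i) \<le> qform d (V \<alpha>) (\<lambda>i. r i \<alpha> - s i))"

text \<open>
  The estimator \<open>a\<close> is close to a linear function of the rescaled deviations \<open>z\<close> of \<open>s\<close>, uniformly over all
  \<open>s\<close> with \<open>z\<close> bounded by \<open>B\<close> and all weights \<open>V\<close> near \<open>G\<close>.  This uniform statement about numbers carries over
  to random \<open>s\<close>, \<open>V\<close> and \<open>a\<close> on an event where the hypotheses hold.

  The proof is by contradiction: counterexamples for larger and larger \<open>n\<close> have bounded \<open>z\<close> and, by the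
  rate hypothesis, bounded \<open>h = \<surd>n (a - \<alpha>\<^sub>0)\<close>.  Along a subsequence both converge, to \<open>\<zeta>\<close> and \<open>\<eta>\<close>.
  The criterion at \<open>a\<close> is at most the criterion at the point that corresponds to the linear function of
  \<open>z\<close>.  In the limit \<open>\<eta>\<close> must therefore minimize the limiting quadratic function, whose minimizer is
  unique.
\<close>

lemma argmin_expansion:
  fixes r :: "nat \<Rightarrow> real \<Rightarrow> real" and R :: "nat \<Rightarrow> real" and G :: "real \<Rightarrow> nat \<Rightarrow> nat \<Rightarrow> real"
  assumes d: "d > 0"
    and deriv: "\<And>i. i < d \<Longrightarrow> (r i has_field_derivative R i) (at \<alpha>\<^sub>0)"
    and rate: "\<And>\<alpha>. \<alpha> \<in> A \<Longrightarrow> \<bar>\<alpha> - \<alpha>\<^sub>0\<bar> \<le> C * \<bar>r 0 \<alpha> - r 0 \<alpha>\<^sub>0\<bar>"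
    and G: "\<And>i j. i < d \<Longrightarrow> j < d \<Longrightarrow> isCont (\<lambda>\<alpha>. G \<alpha> i j) \<alpha>\<^sub>0"
    and sym: "\<And>i j. i < d \<Longrightarrow> j < d \<Longrightarrow> G \<alpha>\<^sub>0 i j = G \<alpha>\<^sub>0 j i"
    and pos: "qform d (G \<alpha>\<^sub>0) R > 0" and int: "\<alpha>\<^sub>0 \<in> interior A"
    and \<epsilon>: "\<epsilon> > 0" and \<kappa>: "\<kappa> > 0"
  defines "w \<equiv> \<lambda>i. (\<Sum>j<d. G \<alpha>\<^sub>0 i j * R j) / qform d (G \<alpha>\<^sub>0) R"
  shows "\<exists>\<delta>>0. \<exists>N. \<forall>n\<ge>N. \<forall>s V a.
      (\<forall>i<d. \<bar>sqrt (real n) * (s i - r i \<alpha>\<^sub>0)\<bar> \<le> B) \<longrightarrow>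
      min_dist_at d r G A \<kappa> \<delta> s V a \<longrightarrow>
      \<bar>sqrt (real n) * (a - \<alpha>\<^sub>0) - (\<Sum>i<d. w i * (sqrt (real n) * (s i - r i \<alpha>\<^sub>0)))\<bar> \<le> \<epsilon>"
proof (rule ccontr)
  let ?W = "G \<alpha>\<^sub>0"
  define bad where "bad \<delta> n s V a \<longleftrightarrow>
      (\<forall>i<d. \<bar>sqrt (real n) * (s i - r i \<alpha>\<^sub>0)\<bar> \<le> B) \<and>
      min_dist_at d r G A \<kappa> \<delta> s V a \<and>
      \<not> \<bar>sqrt (real n) * (a - \<alpha>\<^sub>0) - (\<Sum>i<d. w i * (sqrt (real n) * (s i - r i \<alpha>\<^sub>0)))\<bar> \<le> \<epsilon>"
    for \<delta> n s V a
  assume "\<not> ?thesis"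
  then have neg: "\<exists>n\<ge>N. \<exists>s V a. bad \<delta> n s V a" if "\<delta> > 0" for \<delta> N
    using that unfolding bad_def by blast
  have "\<forall>N. \<exists>n s V a. n \<ge> Suc N \<and> bad (1 / real (Suc N)) n s V a"
    using neg[of "1 / real (Suc N)" "Suc N" for N] by (metis of_nat_0_less_iff zero_less_Suc zero_less_divide_1_iff)
  then obtain \<nu> s V a where \<nu>: "\<And>N. \<nu> N \<ge> Suc N"
    and bad: "\<And>N. bad (1 / real (Suc N)) (\<nu> N) (s N) (V N) (a N)" by metis
  define \<tau> where "\<tau> N = sqrt (real (\<nu> N))" for N
  have \<tau>_pos: "\<tau> N > 0" for N using \<nu>[of N] by (simp add: \<tau>_def)
  have \<tau>_lim: "filterlim \<tau> at_top sequentially"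
  proof (rule filterlim_at_top_mono)
    show "filterlim (\<lambda>N. sqrt (real N)) at_top sequentially"
      by (rule filterlim_compose[OF sqrt_at_top filterlim_real_sequentially])
    show "\<forall>\<^sub>F N in sequentially. sqrt (real N) \<le> \<tau> N"
      unfolding \<tau>_def by (intro always_eventually allI) (use \<nu> in \<open>simp add: Suc_leD\<close>)
  qed
  have A0: "\<alpha>\<^sub>0 \<in> A" using int interior_subset by blast
  define z where "z N i = \<tau> N * (s N i - r i \<alpha>\<^sub>0)" for N i
  define h where "h N = \<tau> N * (a N - \<alpha>\<^sub>0)" for N
  have zB: "\<bar>z N i\<bar> \<le> B" if "i < d" for N i
    using bad[of N] that by (simp add: bad_def z_def \<tau>_def)
  have VG: "\<bar>V N \<alpha> i j - G \<alpha> i j\<bar> \<le> 1 / real (Suc N)" if "\<alpha> \<in> A" "i < d" "j < d" for N \<alpha> i j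
    using bad[of N] that unfolding bad_def min_dist_at_def by blast
  have aA: "a N \<in> A" for N using bad[of N] by (simp add: bad_def min_dist_at_def)
  have opt: "qform d (V N (a N)) (\<lambda>i. \<tau> N * (r i (a N) - s N i)) \<le> qform d (V N \<alpha>) (\<lambda>i. \<tau> N * (r i \<alpha> - s N i))"
    if "\<alpha> \<in> A" for N \<alpha>
    unfolding qform_scale using bad[of N] that by (intro mult_left_mono) (auto simp: bad_def min_dist_at_def)
  have lower: "\<kappa> * (\<Sum>i<d. (x i)\<^sup>2) \<le> qform d (V N \<alpha>) x" if "\<alpha> \<in> A" for N \<alpha> x
    using bad[of N] that unfolding bad_def min_dist_at_def by blast
  have far: "\<bar>h N - (\<Sum>i<d. w i * z N i)\<bar> > \<epsilon>" for N
    using bad[of N] by (simp add: bad_def h_def z_def \<tau>_def)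

  \<comment> \<open>\<open>Q\<close> bounds the rescaled criterion at \<open>\<alpha>\<^sub>0\<close>, hence at the minimizer.\<close>
  define Q where "Q = (\<Sum>i<d. \<Sum>j<d. \<bar>?W i j\<bar> + 1) * B\<^sup>2"
  have hB: "\<bar>h N\<bar> \<le> \<bar>C\<bar> * (sqrt (Q / \<kappa>) + B)" for N
  proof -
    let ?u = "\<lambda>i. \<tau> N * (r i (a N) - s N i)"
    have "\<kappa> * (?u 0)\<^sup>2 \<le> \<kappa> * (\<Sum>i<d. (?u i)\<^sup>2)"
      using d \<kappa> member_le_sum[of 0 "{..<d}" "\<lambda>i. (?u i)\<^sup>2"] by (intro mult_left_mono) auto
    also have "\<dots> \<le> qform d (V N (a N)) ?u" by (rule lower[OF aA])
    also have "\<dots> \<le> qform d (V N \<alpha>\<^sub>0) (\<lambda>i. \<tau> N * (r i \<alpha>\<^sub>0 - s N i))" by (rule opt[OF A0])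
    also have "\<dots> \<le> Q" unfolding Q_def
    proof (rule qform_le)
      fix i j assume ij: "i < d" "j < d"
      have "1 / real (Suc N) \<le> 1" by simp
      then show "\<bar>V N \<alpha>\<^sub>0 i j\<bar> \<le> \<bar>?W i j\<bar> + 1" using VG[OF A0 ij, of N] by linarith
    next
      fix i assume "i < d"
      from zB[OF this, of N] show "\<bar>\<tau> N * (r i \<alpha>\<^sub>0 - s N i)\<bar> \<le> B"
        by (simp add: z_def abs_mult abs_minus_commute)
    qed
    finally have "(?u 0)\<^sup>2 \<le> Q / \<kappa>" using \<kappa> by (simp add: pos_le_divide_eq mult.commute)
    then have u0: "\<bar>?u 0\<bar> \<le> sqrt (Q / \<kappa>)" by (rule real_le_rsqrt[of "\<bar>?u 0\<bar>", simplified])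
    have "\<bar>h N\<bar> = \<tau> N * \<bar>a N - \<alpha>\<^sub>0\<bar>" using \<tau>_pos[of N] by (simp add: h_def abs_mult)
    also have "\<dots> \<le> \<tau> N * (\<bar>C\<bar> * \<bar>r 0 (a N) - r 0 \<alpha>\<^sub>0\<bar>)"
      using rate[OF aA[of N]] \<tau>_pos[of N]
      by (intro mult_left_mono order_trans[OF rate[OF aA]] mult_right_mono) auto
    also have "\<dots> = \<bar>C\<bar> * \<bar>?u 0 + z N 0\<bar>"
      using \<tau>_pos[of N] by (simp add: z_def abs_mult mult_ac flip: distrib_left)
    also have "\<dots> \<le> \<bar>C\<bar> * (sqrt (Q / \<kappa>) + B)"
      using u0 zB[OF d, of N] by (intro mult_left_mono) linarith+
    finally show ?thesis .
  qed

  \<comment> \<open>Appending \<open>h\<close> as the last coordinate extracts one subsequence for both.\<close>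
  define x where "x N i = (if i < d then z N i else h N)" for N i
  obtain \<sigma> l where \<sigma>: "strict_mono \<sigma>" and "\<forall>i<Suc d. (\<lambda>N. x (\<sigma> N) i) \<longlonglongrightarrow> l i"
  proof -
    have "\<bar>x N i\<bar> \<le> (if i < d then B else \<bar>C\<bar> * (sqrt (Q / \<kappa>) + B))" for N i
      using zB hB by (simp add: x_def)
    then show thesis using that common_convergent_subseq[of "Suc d" x] by meson
  qed
  then obtain \<zeta> \<eta> where z_lim: "\<And>i. i < d \<Longrightarrow> (\<lambda>N. z (\<sigma> N) i) \<longlonglongrightarrow> \<zeta> i"
    and h_lim: "(\<lambda>N. h (\<sigma> N)) \<longlonglongrightarrow> \<eta>"
    by (auto simp: x_def less_Suc_eq all_conj_distrib)
  define \<eta>' where "\<eta>' = (\<Sum>i<d. w i * \<zeta> i)"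
  define h' where "h' N = (\<Sum>i<d. w i * z N i)" for N
  have h'_lim: "(\<lambda>N. h' (\<sigma> N)) \<longlonglongrightarrow> \<eta>'"
    unfolding h'_def \<eta>'_def by (intro tendsto_sum tendsto_mult tendsto_const z_lim) simp
  have \<tau>_sub: "filterlim (\<lambda>N. \<tau> (\<sigma> N)) at_top sequentially"
    using filterlim_compose[OF \<tau>_lim filterlim_subseq[OF \<sigma>]] by simp

  have shrink: "(\<lambda>N. \<alpha>\<^sub>0 + k N / \<tau> (\<sigma> N)) \<longlonglongrightarrow> \<alpha>\<^sub>0" if "k \<longlonglongrightarrow> m" for k m
    using tendsto_add[OF tendsto_const tendsto_divide_0[OF that filterlim_at_top_imp_at_infinity[OF \<tau>_sub]], of \<alpha>\<^sub>0]
    by simp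

  \<comment> \<open>The rescaled criterion at \<open>\<alpha>\<^sub>0 + k / \<tau>\<close> converges to the limiting quadratic function of \<open>k\<close>.\<close>
  have crit_lim: "(\<lambda>N. qform d (V (\<sigma> N) (b N)) (\<lambda>i. \<tau> (\<sigma> N) * (r i (b N) - s (\<sigma> N) i)))
      \<longlonglongrightarrow> qform d ?W (\<lambda>i. R i * m - \<zeta> i)"
    if k: "k \<longlonglongrightarrow> m" and b: "\<And>N. b N = \<alpha>\<^sub>0 + k N / \<tau> (\<sigma> N)" and bA: "\<forall>\<^sub>F N in sequentially. b N \<in> A"
    for k m b
  proof -
    have b_lim: "b \<longlonglongrightarrow> \<alpha>\<^sub>0" using shrink[OF k] by (simp add: b[abs_def])
    have u: "(\<lambda>N. \<tau> (\<sigma> N) * (r i (b N) - s (\<sigma> N) i)) \<longlonglongrightarrow> R i * m - \<zeta> i" if i: "i < d" for i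
    proof -
      obtain g where g: "\<And>y. r i y - r i \<alpha>\<^sub>0 = g y * (y - \<alpha>\<^sub>0)" "isCont g \<alpha>\<^sub>0" "g \<alpha>\<^sub>0 = R i"
        using deriv[OF i] unfolding CARAT_DERIV by blast
      have "(\<lambda>N. g (b N)) \<longlonglongrightarrow> R i"
        using isCont_tendsto_compose[OF g(2) b_lim] g(3) by simp
      then have "(\<lambda>N. g (b N) * k N - z (\<sigma> N) i) \<longlonglongrightarrow> R i * m - \<zeta> i"
        by (intro tendsto_diff tendsto_mult k z_lim i)
      moreover have "\<tau> (\<sigma> N) * (r i (b N) - s (\<sigma> N) i) = g (b N) * k N - z (\<sigma> N) i" for N
      proof -
        have "\<tau> (\<sigma> N) * (r i (b N) - s (\<sigma> N) i) = \<tau> (\<sigma> N) * (r i (b N) - r i \<alpha>\<^sub>0) - z (\<sigma> N) i"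
          by (simp add: z_def algebra_simps)
        also have "\<tau> (\<sigma> N) * (r i (b N) - r i \<alpha>\<^sub>0) = g (b N) * k N"
          using \<tau>_pos[of "\<sigma> N"] by (simp add: g(1)) (simp add: b)
        finally show ?thesis .
      qed
      ultimately show ?thesis by simp
    qed
    have v: "(\<lambda>N. V (\<sigma> N) (b N) i j) \<longlonglongrightarrow> ?W i j" if ij: "i < d" "j < d" for i j
    proof -
      have "(\<lambda>N. V (\<sigma> N) (b N) i j - G (b N) i j) \<longlonglongrightarrow> 0"
      proof (rule Lim_null_comparison)
        show "\<forall>\<^sub>F N in sequentially. norm (V (\<sigma> N) (b N) i j - G (b N) i j) \<le> 1 / real (Suc (\<sigma> N))"
          using bA by eventually_elim (use VG[OF _ ij] in auto)
        show "(\<lambda>N. 1 / real (Suc (\<sigma> N))) \<longlonglongrightarrow> 0"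
          using LIMSEQ_subseq_LIMSEQ[OF LIMSEQ_Suc[OF lim_1_over_n] \<sigma>] by (simp add: comp_def)
      qed
      from tendsto_add[OF this isCont_tendsto_compose[OF G[OF ij] b_lim]] show ?thesis by simp
    qed
    show ?thesis unfolding qform_def by (intro tendsto_sum tendsto_mult u v) auto
  qed
  define b where "b N = \<alpha>\<^sub>0 + h' (\<sigma> N) / \<tau> (\<sigma> N)" for N
  have "b \<longlonglongrightarrow> \<alpha>\<^sub>0" unfolding b_def by (rule shrink[OF h'_lim])
  then have "\<forall>\<^sub>F N in sequentially. b N \<in> interior A"
    using int by (rule topological_tendstoD[OF _ open_interior])
  then have bA: "\<forall>\<^sub>F N in sequentially. b N \<in> A"
    by eventually_elim (use interior_subset in blast)
  have "qform d ?W (\<lambda>i. R i * \<eta> - \<zeta> i) \<le> qform d ?W (\<lambda>i. R i * \<eta>' - \<zeta> i)"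
  proof (rule tendsto_le[OF sequentially_bot])
    show "(\<lambda>N. qform d (V (\<sigma> N) (b N)) (\<lambda>i. \<tau> (\<sigma> N) * (r i (b N) - s (\<sigma> N) i)))
      \<longlonglongrightarrow> qform d ?W (\<lambda>i. R i * \<eta>' - \<zeta> i)"
      by (rule crit_lim[OF h'_lim _ bA]) (simp add: b_def)
    show "(\<lambda>N. qform d (V (\<sigma> N) (a (\<sigma> N))) (\<lambda>i. \<tau> (\<sigma> N) * (r i (a (\<sigma> N)) - s (\<sigma> N) i)))
      \<longlonglongrightarrow> qform d ?W (\<lambda>i. R i * \<eta> - \<zeta> i)"
    proof (rule crit_lim[OF h_lim])
      show "a (\<sigma> N) = \<alpha>\<^sub>0 + h (\<sigma> N) / \<tau> (\<sigma> N)" for N using \<tau>_pos[of "\<sigma> N"] by (simp add: h_def)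
    qed (simp add: aA)
    show "\<forall>\<^sub>F N in sequentially. qform d (V (\<sigma> N) (a (\<sigma> N))) (\<lambda>i. \<tau> (\<sigma> N) * (r i (a (\<sigma> N)) - s (\<sigma> N) i))
        \<le> qform d (V (\<sigma> N) (b N)) (\<lambda>i. \<tau> (\<sigma> N) * (r i (b N) - s (\<sigma> N) i))"
      using bA by eventually_elim (rule opt)
  qed
  moreover have "qform d ?W (\<lambda>i. R i * \<eta> - \<zeta> i) = qform d ?W (\<lambda>i. R i * \<eta>' - \<zeta> i) + qform d ?W R * (\<eta> - \<eta>')\<^sup>2"
    by (rule qform_line) (use sym pos in \<open>auto simp: \<eta>'_def w_def\<close>)
  ultimately have "qform d ?W R * (\<eta> - \<eta>')\<^sup>2 \<le> 0" by simp
  then have "\<eta> = \<eta>'" using pos by (simp add: mult_le_0_iff)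
  moreover have "\<epsilon> \<le> \<bar>\<eta> - \<eta>'\<bar>"
  proof (rule tendsto_lowerbound)
    show "(\<lambda>N. \<bar>h (\<sigma> N) - h' (\<sigma> N)\<bar>) \<longlonglongrightarrow> \<bar>\<eta> - \<eta>'\<bar>" by (intro tendsto_intros h_lim h'_lim)
    show "\<forall>\<^sub>F N in sequentially. \<epsilon> \<le> \<bar>h (\<sigma> N) - h' (\<sigma> N)\<bar>"
      using far by (intro always_eventually allI) (simp add: h'_def less_imp_le)
  qed simp
  ultimately show False using \<epsilon> by simp
qed

section \<open>Positive definite matrices\<close>

lemma scalar_prod_mult_mat_vec_sum:
  assumes "W \<in> carrier_mat d d" "x \<in> carrier_vec d" "y \<in> carrier_vec d"
  shows "scalar_prod x (W *\<^sub>v y) = (\<Sum>i<d. \<Sum>j<d. vec_index x i * W $$ (i, j) * vec_index y j)"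
  using assms unfolding scalar_prod_def
  by (auto simp: scalar_prod_def sum_distrib_left mult.assoc lessThan_atLeast0 intro!: sum.cong)

lemma scalar_prod_eq_qform:
  assumes "W \<in> carrier_mat d d" "x \<in> carrier_vec d"
  shows "scalar_prod x (W *\<^sub>v x) = qform d (\<lambda>i j. W $$ (i, j)) (vec_index x)"
  unfolding scalar_prod_mult_mat_vec_sum[OF assms assms(2)] qform_def ..

lemma pos_def_matD:
  assumes "pos_def_mat d W"
  shows "W \<in> carrier_mat d d" "transpose_mat W = W"
    "\<And>x. x \<in> carrier_vec d \<Longrightarrow> x \<noteq> 0\<^sub>v d \<Longrightarrow> 0 < scalar_prod x (W *\<^sub>v x)"
    "\<And>i j. i < d \<Longrightarrow> j < d \<Longrightarrow> W $$ (i, j) = W $$ (j, i)"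
proof -
  show W: "W \<in> carrier_mat d d" and T: "transpose_mat W = W"
    and "\<And>x. x \<in> carrier_vec d \<Longrightarrow> x \<noteq> 0\<^sub>v d \<Longrightarrow> 0 < scalar_prod x (W *\<^sub>v x)"
    using assms by (auto simp: pos_def_mat_def)
  fix i j assume "i < d" "j < d"
  then have "transpose_mat W $$ (i, j) = W $$ (j, i)" using W by simp
  then show "W $$ (i, j) = W $$ (j, i)" by (simp add: T)
qed

lemma scalar_prod_transpose:
  fixes A :: "real mat"
  assumes "A \<in> carrier_mat m n" "x \<in> carrier_vec m" "y \<in> carrier_vec n"
  shows "scalar_prod x (A *\<^sub>v y) = scalar_prod (transpose_mat A *\<^sub>v x) y"
proof -
  have "scalar_prod x (A *\<^sub>v y) = (\<Sum>i<m. \<Sum>j<n. vec_index x i * A $$ (i, j) * vec_index y j)"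
    using assms unfolding scalar_prod_def
    by (auto simp: scalar_prod_def sum_distrib_left mult.assoc lessThan_atLeast0 intro!: sum.cong)
  also have "\<dots> = (\<Sum>j<n. \<Sum>i<m. vec_index x i * A $$ (i, j) * vec_index y j)" by (rule sum.swap)
  also have "\<dots> = scalar_prod (transpose_mat A *\<^sub>v x) y"
    using assms unfolding scalar_prod_def
    by (auto simp: scalar_prod_def sum_distrib_left sum_distrib_right mult_ac lessThan_atLeast0 intro!: sum.cong)
  finally show ?thesis .
qed

lemma mult_mat_zero_vec: "W \<in> carrier_mat d d \<Longrightarrow> W *\<^sub>v 0\<^sub>v d = (0\<^sub>v d :: real Matrix.vec)"
  by (intro eq_vecI) auto

lemma pos_def_det: assumes "pos_def_mat d W" shows "Determinant.det W \<noteq> 0"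
proof
  assume "Determinant.det W = 0"
  then obtain v where v: "v \<in> carrier_vec d" "v \<noteq> 0\<^sub>v d" "W *\<^sub>v v = 0\<^sub>v d"
    using det_0_iff_vec_prod_zero_field[OF pos_def_matD(1)[OF assms]] by blast
  then show False using pos_def_matD(3)[OF assms v(1,2)] by simp
qed

lemma inv_mat:
  assumes "W \<in> carrier_mat d d" "Determinant.det W \<noteq> 0"
  shows "inv_mat W \<in> carrier_mat d d" "W * inv_mat W = 1\<^sub>m d" "inv_mat W * W = 1\<^sub>m d"
proof -
  obtain B where "mat_inverse W = Some B"
    using mat_inverse(1)[OF assms(1), of "()"] det_non_zero_imp_unit[OF assms, of "()"]
    by (cases "mat_inverse W") auto
  with mat_inverse(2)[OF assms(1) this] show "inv_mat W \<in> carrier_mat d d"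
    "W * inv_mat W = 1\<^sub>m d" "inv_mat W * W = 1\<^sub>m d" by (auto simp: inv_mat_def)
qed

lemma pos_def_cauchy_schwarz:
  assumes W: "pos_def_mat d W" and x: "x \<in> carrier_vec d" and y: "y \<in> carrier_vec d"
  shows "(scalar_prod x (W *\<^sub>v y))\<^sup>2 \<le> scalar_prod x (W *\<^sub>v x) * scalar_prod y (W *\<^sub>v y)"
proof (cases "y = 0\<^sub>v d")
  case True
  then show ?thesis using x pos_def_matD(1)[OF W] by (simp add: mult_mat_zero_vec)
next
  case False
  note Wc = pos_def_matD(1)[OF W]
  let ?b = "\<lambda>u v. scalar_prod u (W *\<^sub>v v)"
  have yy: "?b y y > 0" using pos_def_matD(3)[OF W y False] .
  have xy: "?b y x = ?b x y"
    using scalar_prod_transpose[OF Wc y x] pos_def_matD(2)[OF W] Wc x y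
    by (simp add: comm_scalar_prod[of _ d])
  define t where "t = ?b x y / ?b y y"
  let ?z = "x - t \<cdot>\<^sub>v y"
  have z: "?z \<in> carrier_vec d" using x y by simp
  have "?b ?z ?z = ?b x x - t * ?b x y - t * (?b y x - t * ?b y y)"
    using x y Wc
    by (simp add: mult_minus_distrib_mat_vec[of _ d d] minus_scalar_prod_distrib[of _ d]
        scalar_prod_minus_distrib[of _ d] mult_mat_vec[of _ d d]) (simp add: algebra_simps)
  moreover have "?b ?z ?z \<ge> 0"
    using pos_def_matD(3)[OF W z] Wc by (cases "?z = 0\<^sub>v d") (auto simp: less_imp_le)
  ultimately have "0 \<le> ?b x x - 2 * t * ?b x y + t\<^sup>2 * ?b y y"
    by (simp add: xy power2_eq_square algebra_simps)
  also have "\<dots> = ?b x x - (?b x y)\<^sup>2 / ?b y y"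
    using yy by (simp add: t_def power2_eq_square field_simps)
  finally show ?thesis using yy by (simp add: field_simps)
qed

lemma pos_def_inv:
  assumes W: "pos_def_mat d W"
  shows "pos_def_mat d (inv_mat W)"
proof -
  note Wc = pos_def_matD(1)[OF W] and det = pos_def_det[OF W]
  let ?B = "inv_mat W"
  note B = inv_mat[OF Wc det]
  have "transpose_mat ?B * W = 1\<^sub>m d"
    using transpose_mult[OF Wc B(1)] B(2) pos_def_matD(2)[OF W] by simp
  then have "transpose_mat ?B * (W * ?B) = ?B"
    using assoc_mult_mat[of "transpose_mat ?B" d d W d ?B d] B Wc by simp
  then have T: "transpose_mat ?B = ?B" using B by simp
  show ?thesis unfolding pos_def_mat_def
  proof (intro conjI ballI impI)
    fix x :: "real Matrix.vec" assume x: "x \<in> carrier_vec d" "x \<noteq> 0\<^sub>v d"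
    let ?y = "?B *\<^sub>v x"
    have y: "?y \<in> carrier_vec d" using B(1) x by simp
    have Wy: "W *\<^sub>v ?y = x"
      using assoc_mult_mat_vec[OF Wc B(1) x(1)] B(2) x(1) by simp
    then have "?y \<noteq> 0\<^sub>v d" using x mult_mat_zero_vec[OF Wc] by metis
    from pos_def_matD(3)[OF W y this] show "0 < scalar_prod x (?B *\<^sub>v x)"
      unfolding Wy by (simp add: comm_scalar_prod[OF y x(1)])
  qed (use B T in auto)
qed

lemma inv_inv_mat:
  assumes "pos_def_mat d W" shows "inv_mat (inv_mat W) = W"
proof -
  note Wc = pos_def_matD(1)[OF assms]
  note B = inv_mat[OF Wc pos_def_det[OF assms]]
  note C = inv_mat[OF B(1) pos_def_det[OF pos_def_inv[OF assms]]]
  have "W = W * (inv_mat W * inv_mat (inv_mat W))" using C Wc by simp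
  also have "\<dots> = inv_mat (inv_mat W)" using assoc_mult_mat[OF Wc B(1) C(1)] B C by simp
  finally show ?thesis by simp
qed

text \<open>
  Cauchy--Schwarz for the form of \<open>W\<close>, applied to \<open>x\<close> and \<open>y = W\<^sup>-\<^sup>1 x\<close>, bounds the form of \<open>W\<^sup>-\<^sup>1\<close>
  from below by the reciprocal of a bound for the entries of \<open>W\<close>.
\<close>

lemma inverse_qform_lower:
  assumes W: "pos_def_mat d W" and U: "\<And>i j. i < d \<Longrightarrow> j < d \<Longrightarrow> \<bar>W $$ (i, j)\<bar> \<le> U" and U0: "U > 0"
  shows "(\<Sum>i<d. (x i)\<^sup>2) / (U * (real d)\<^sup>2 + 1) \<le> qform d (\<lambda>i j. inv_mat W $$ (i, j)) x"
proof -
  note Wc = pos_def_matD(1)[OF W]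
  note B = inv_mat[OF Wc pos_def_det[OF W]]
  define v where "v = Matrix.vec d x"
  have v: "v \<in> carrier_vec d" by (simp add: v_def)
  let ?y = "inv_mat W *\<^sub>v v"
  have y: "?y \<in> carrier_vec d" using B(1) v by simp
  have Wy: "W *\<^sub>v ?y = v" using assoc_mult_mat_vec[OF Wc B(1) v] B(2) v by simp
  define S where "S = (\<Sum>i<d. (x i)\<^sup>2)"
  have S0: "S \<ge> 0" by (simp add: S_def sum_nonneg)
  have vv: "scalar_prod v v = S"
    by (simp add: S_def scalar_prod_def v_def power2_eq_square lessThan_atLeast0)
  let ?q = "scalar_prod v (inv_mat W *\<^sub>v v)"
  have q0: "0 \<le> ?q"
    using pos_def_matD(1,3)[OF pos_def_inv[OF W]] v by (cases "v = 0\<^sub>v d") (auto simp: less_imp_le)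
  have CS: "S\<^sup>2 \<le> scalar_prod v (W *\<^sub>v v) * ?q"
    using pos_def_cauchy_schwarz[OF W v y] unfolding Wy vv by (simp add: comm_scalar_prod[OF y v])
  have "scalar_prod v (W *\<^sub>v v) \<le> (U * (real d)\<^sup>2 + 1) * S"
  proof -
    have "qform d (\<lambda>i j. W $$ (i, j)) (vec_index v) \<le> (\<Sum>i<d. \<Sum>j<d. U) * (sqrt S)\<^sup>2"
    proof (rule qform_le)
      fix i assume "i < d"
      then have "(x i)\<^sup>2 \<le> S" unfolding S_def by (intro member_le_sum) auto
      then show "\<bar>vec_index v i\<bar> \<le> sqrt S" using \<open>i < d\<close> by (simp add: v_def real_le_rsqrt)
    qed (use U in auto)
    then have "scalar_prod v (W *\<^sub>v v) \<le> (U * (real d)\<^sup>2) * S"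
      using scalar_prod_eq_qform[OF Wc v] S0 by (simp add: power2_eq_square mult_ac)
    then show ?thesis using S0 by (simp add: algebra_simps)
  qed
  from order_trans[OF CS mult_right_mono[OF this q0]]
  have *: "S\<^sup>2 \<le> (U * (real d)\<^sup>2 + 1) * S * ?q" .
  have U1: "U * (real d)\<^sup>2 + 1 > 0" using U0 by (simp add: add_nonneg_pos)
  have q: "?q = qform d (\<lambda>i j. inv_mat W $$ (i, j)) x"
    unfolding scalar_prod_eq_qform[OF B(1) v] by (rule qform_cong) (simp add: v_def)
  have "S / (U * (real d)\<^sup>2 + 1) \<le> ?q"
  proof (cases "S = 0")
    case True
    then show ?thesis using q0 by simp
  next
    case False
    then have "S > 0" using S0 by simp
    have "S * S \<le> S * ((U * (real d)\<^sup>2 + 1) * ?q)" using * by (simp add: power2_eq_square mult_ac)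
    then have "S \<le> (U * (real d)\<^sup>2 + 1) * ?q" using \<open>S > 0\<close> by simp
    then show ?thesis using U1 by (simp add: pos_divide_le_eq mult.commute)
  qed
  then show ?thesis unfolding q S_def .
qed

lemma entry_le_sum:
  fixes i j d :: nat
  assumes "i < d" "j < d" shows "\<bar>b i j\<bar> \<le> (\<Sum>i<d. \<Sum>j<d. \<bar>b i j :: real\<bar>)"
proof -
  have "\<bar>b i j\<bar> \<le> (\<Sum>j<d. \<bar>b i j\<bar>)" using assms by (intro member_le_sum) auto
  also have "\<dots> \<le> (\<Sum>i<d. \<Sum>j<d. \<bar>b i j\<bar>)"
    using assms by (intro member_le_sum[of i "{..<d}" "\<lambda>i. \<Sum>j<d. \<bar>b i j\<bar>"]) (auto intro: sum_nonneg)
  finally show ?thesis .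
qed

text \<open>
  \<open>W\<close> is the inverse of its inverse, so the previous bound applies with the roles exchanged.
\<close>

lemma pos_def_qform_lower:
  assumes "pos_def_mat d W"
  obtains \<kappa> where "\<kappa> > 0" "\<And>x. \<kappa> * (\<Sum>i<d. (x i)\<^sup>2) \<le> qform d (\<lambda>i j. W $$ (i, j)) x"
proof -
  let ?B = "inv_mat W"
  define U where "U = (\<Sum>i<d. \<Sum>j<d. \<bar>?B $$ (i, j)\<bar>) + 1"
  have U0: "U > 0" unfolding U_def by (intro add_nonneg_pos sum_nonneg) auto
  have "\<bar>?B $$ (i, j)\<bar> \<le> U" if "i < d" "j < d" for i j
    using entry_le_sum[OF that, of "\<lambda>i j. ?B $$ (i, j)"] by (simp add: U_def)
  from inverse_qform_lower[OF pos_def_inv[OF assms] this U0] inv_inv_mat[OF assms]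
  have "1 / (U * (real d)\<^sup>2 + 1) * (\<Sum>i<d. (x i)\<^sup>2) \<le> qform d (\<lambda>i j. W $$ (i, j)) x" for x by simp
  moreover have "1 / (U * (real d)\<^sup>2 + 1) > 0" using U0 by (simp add: add_nonneg_pos)
  ultimately show ?thesis using that by blast
qed

lemma continuous_det:
  assumes A: "\<And>t. A t \<in> carrier_mat d d" and c: "\<And>i j. i < d \<Longrightarrow> j < d \<Longrightarrow> isCont (\<lambda>t. A t $$ (i, j)) t\<^sub>0"
  shows "isCont (\<lambda>t. Determinant.det (A t) :: real) (t\<^sub>0 :: real)"
proof -
  have "isCont (\<lambda>t. \<Sum>p | p permutes {0..<d}. signof p * (\<Prod>i=0..<d. A t $$ (i, p i))) t\<^sub>0"
  proof (intro continuous_intros c)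
    fix p i assume "p \<in> {p. p permutes {0..<d}}" "i \<in> {0..<d}"
    then show "i < d" "p i < d" using permutes_in_image[of p "{0..<d}" i] by auto
  qed
  then show ?thesis unfolding det_def'[OF A] .
qed

text \<open>
  By Cramer's rule the entries of the inverse are quotients of determinants.
\<close>

lemma continuous_inv_mat:
  assumes A: "\<And>t. A t \<in> carrier_mat d d" and c: "\<And>i j. i < d \<Longrightarrow> j < d \<Longrightarrow> isCont (\<lambda>t. A t $$ (i, j)) t\<^sub>0"
    and det: "\<forall>\<^sub>F t in nhds t\<^sub>0. Determinant.det (A t) \<noteq> 0" and ij: "i < d" "j < d"
  shows "isCont (\<lambda>t. inv_mat (A t) $$ (i, j) :: real) (t\<^sub>0 :: real)"
proof -
  have eq: "inv_mat (A t) $$ (i, j) = cofactor (A t) j i / Determinant.det (A t)"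
    if "Determinant.det (A t) \<noteq> 0" for t
  proof -
    note B = inv_mat[OF A that]
    note adj = adj_mat[OF A[of t]]
    have "adj_mat (A t) = adj_mat (A t) * (A t * inv_mat (A t))" using adj B by simp
    also have "\<dots> = (adj_mat (A t) * A t) * inv_mat (A t)"
      using assoc_mult_mat[OF adj(1) A B(1)] by simp
    also have "\<dots> = Determinant.det (A t) \<cdot>\<^sub>m inv_mat (A t)"
      using adj B by (simp add: mult_smult_assoc_mat[of _ d d])
    finally have "adj_mat (A t) $$ (i, j) = (Determinant.det (A t) \<cdot>\<^sub>m inv_mat (A t)) $$ (i, j)" by simp
    moreover have "adj_mat (A t) $$ (i, j) = cofactor (A t) j i"
      using ij A[of t] by (simp add: adj_mat_def)
    ultimately show ?thesis using ij B(1) that by (simp add: field_simps)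
  qed
  have "isCont (\<lambda>t. Determinant.det (mat_delete (A t) j i)) t\<^sub>0"
  proof (rule continuous_det)
    show "mat_delete (A t) j i \<in> carrier_mat (d - 1) (d - 1)" for t
      by (rule mat_delete_carrier[OF A])
    fix k l assume kl: "k < d - 1" "l < d - 1"
    have "mat_delete (A t) j i $$ (k, l) = A t $$ (if k < j then k else Suc k, if l < i then l else Suc l)" for t
      using kl A[of t] by (simp add: mat_delete_def)
    then show "isCont (\<lambda>t. mat_delete (A t) j i $$ (k, l)) t\<^sub>0"
      using kl by (auto intro!: c)
  qed
  then have cof: "isCont (\<lambda>t. cofactor (A t) j i) t\<^sub>0"
    unfolding cofactor_def by (intro continuous_intros)
  have "isCont (\<lambda>t. cofactor (A t) j i / Determinant.det (A t)) t\<^sub>0"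
    by (intro isCont_divide cof continuous_det[where d=d] A c eventually_nhds_x_imp_x[OF det])
  moreover have "\<forall>\<^sub>F t in nhds t\<^sub>0. inv_mat (A t) $$ (i, j) = cofactor (A t) j i / Determinant.det (A t)"
    using det by eventually_elim (rule eq)
  ultimately show ?thesis by (simp cong: isCont_cong)
qed

section \<open>The covariance matrix of the bands\<close>

locale percentiles =
  fixes K :: nat and p :: "nat \<Rightarrow> real" and c :: real
  assumes K: "K \<ge> 2" and p1: "0 < p 1" and p_mono: "strict_mono_on {1..K + 1} p"
    and p_le_1: "p (K + 1) \<le> 1" and c: "c > 0"
begin

lemma p_less: "1 \<le> i \<Longrightarrow> i < j \<Longrightarrow> j \<le> K + 1 \<Longrightarrow> p i < p j"
  using p_mono by (auto simp: strict_mono_on_def)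

lemma p_le: "1 \<le> i \<Longrightarrow> i \<le> j \<Longrightarrow> j \<le> K + 1 \<Longrightarrow> p i \<le> p j"
  using p_less[of i j] by (cases "i = j") auto

lemma p_pos: "1 \<le> i \<Longrightarrow> i \<le> K + 1 \<Longrightarrow> 0 < p i"
  using p_le[of 1 i] p1 by linarith

lemma p_le1: "1 \<le> i \<Longrightarrow> i \<le> K + 1 \<Longrightarrow> p i \<le> 1"
  using p_le[of i "K + 1"] p_le_1 by linarith

text \<open>
  Shifted by one, like the positions of the vectors and matrices: \<open>kband \<alpha> i\<close> belongs to the percentiles
  \<open>p\<^sub>i\<^sub>+\<^sub>1\<close> and \<open>p\<^sub>i\<^sub>+\<^sub>2\<close>.
\<close>

definition kband :: "real \<Rightarrow> nat \<Rightarrow> real \<Rightarrow> real" where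
  "kband \<alpha> i = band c (1/\<alpha>) (p (i + 1)) (p (i + 2))"

definition kband_mean :: "real \<Rightarrow> nat \<Rightarrow> real" where
  "kband_mean \<alpha> i = band_mean c (1/\<alpha>) (p (i + 1)) (p (i + 2))"

lemma p_step: "i < K \<Longrightarrow> 0 < p (i + 1) \<and> p (i + 1) < p (i + 2) \<and> p (i + 2) \<le> 1"
  using p_pos[of "i + 1"] p_less[of "i + 1" "i + 2"] p_le1[of "i + 2"] by auto

lemma integral_kband:
  assumes "i < K" "\<alpha> > 1" shows "(kband \<alpha> i has_integral kband_mean \<alpha> i) {0..1}"
  using p_step[OF assms(1)] assms(2) unfolding kband_def kband_mean_def by (intro integral_band) auto

lemma offdiag_eq:
  assumes "i < j" "j < K" and \<alpha>: "\<alpha> > 1"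
  shows "sigma_offdiag c p \<alpha> (i + 1) (j + 1) + kband_mean \<alpha> i * kband_mean \<alpha> j =
    kband_mean \<alpha> i * (c * p (j + 1) powr (- (1/\<alpha>)) - c * p (j + 2) powr (- (1/\<alpha>)))"
proof -
  define \<xi> where "\<xi> = 1/\<alpha>"
  have \<xi>: "\<xi> > 0" "1 - \<xi> \<noteq> 0" using \<alpha> by (auto simp: \<xi>_def)
  define u where "u = p (i + 2) powr (1 - \<xi>) - p (i + 1) powr (1 - \<xi>)"
  define v where "v = p (j + 2) powr (1 - \<xi>) - p (j + 1) powr (1 - \<xi>)"
  define x where "x = p (j + 2) powr (- \<xi>) - p (j + 1) powr (- \<xi>)"
  have s: "sigma_offdiag c p \<alpha> (i + 1) (j + 1) = - c\<^sup>2 * \<xi>\<^sup>2 * (u / (1 - \<xi>)) * (x / \<xi> + v / (1 - \<xi>))"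
    by (simp add: sigma_offdiag_def Let_def \<xi>_def u_def v_def x_def)
  have m: "kband_mean \<alpha> i = c * \<xi> * (u / (1 - \<xi>))" "kband_mean \<alpha> j = c * \<xi> * (v / (1 - \<xi>))"
    by (simp_all add: kband_mean_def band_mean_def \<xi>_def u_def v_def)
  have E: "c * p (j + 1) powr (- \<xi>) - c * p (j + 2) powr (- \<xi>) = - c * x"
    by (simp add: x_def algebra_simps)
  have I: "- c\<^sup>2 * \<xi>\<^sup>2 * U * (x / \<xi> + V) + c * \<xi> * U * (c * \<xi> * V) = c * \<xi> * U * (- c * x)" for U V
    using \<xi>(1) by (simp add: power2_eq_square field_simps)
  show ?thesis unfolding s m \<xi>_def[symmetric] E by (rule I)
qed

lemma integral_kband_mult:
  assumes ij: "i < K" "j < K" and \<alpha>: "\<alpha> > 1"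
  shows "((\<lambda>u. kband \<alpha> i u * kband \<alpha> j u) has_integral
    Sigma_mat c K p \<alpha> $$ (i, j) + kband_mean \<alpha> i * kband_mean \<alpha> j) {0..1}"
proof -
  have less: "((\<lambda>u. kband \<alpha> i u * kband \<alpha> j u) has_integral
      sigma_offdiag c p \<alpha> (i + 1) (j + 1) + kband_mean \<alpha> i * kband_mean \<alpha> j) {0..1}" if "i < j" "j < K" for i j
    unfolding offdiag_eq[OF that \<alpha>] unfolding kband_def kband_mean_def
    using p_step[of i] p_step[of j] that \<alpha> p_le[of "i + 2" "j + 1"]
    by (intro integral_band_mult) auto
  consider "i = j" | "i < j" | "j < i" by linarith
  then show ?thesis
  proof cases
    case 1
    have "((\<lambda>u. (kband \<alpha> j u)\<^sup>2) has_integral sigma2 c \<alpha> (p (j + 1)) (p (j + 2)) + (kband_mean \<alpha> j)\<^sup>2) {0..1}"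
      using p_step[OF ij(2)] \<alpha> unfolding kband_def kband_mean_def by (intro integral_band_sq) auto
    then show ?thesis using 1 ij by (simp add: Sigma_mat_def power2_eq_square)
  next
    case 2
    then show ?thesis using less[of i j] ij by (simp add: Sigma_mat_def)
  next
    case 3
    then show ?thesis using less[of j i] ij by (simp add: Sigma_mat_def mult.commute)
  qed
qed

text \<open>
  The quadratic form of \<open>\<Sigma>\<close> at \<open>x\<close> is the variance of \<open>\<Sum>\<^sub>i x\<^sub>i b\<^sub>i(U)\<close>, where the \<open>b\<^sub>i\<close> are the bands
  and \<open>U\<close> is uniform.
\<close>

lemma Sigma_qform_eq_variance:
  assumes \<alpha>: "\<alpha> > 1"
  shows "((\<lambda>u. (\<Sum>i<K. x i * (kband \<alpha> i u - kband_mean \<alpha> i))\<^sup>2) has_integral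
    qform K (\<lambda>i j. Sigma_mat c K p \<alpha> $$ (i, j)) x) {0..1}"
proof -
  have "((\<lambda>u. \<Sum>i<K. \<Sum>j<K. x i * x j * ((kband \<alpha> i u * kband \<alpha> j u) - kband_mean \<alpha> j * kband \<alpha> i u
      - kband_mean \<alpha> i * kband \<alpha> j u + kband_mean \<alpha> i * kband_mean \<alpha> j)) has_integral
    (\<Sum>i<K. \<Sum>j<K. x i * x j * ((Sigma_mat c K p \<alpha> $$ (i, j) + kband_mean \<alpha> i * kband_mean \<alpha> j)
       - kband_mean \<alpha> j * kband_mean \<alpha> i - kband_mean \<alpha> i * kband_mean \<alpha> j + kband_mean \<alpha> i * kband_mean \<alpha> j))) {0..1}"
  proof (intro has_integral_sum finite_lessThan)
    fix i j assume "i \<in> {..<K}" "j \<in> {..<K}"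
    then have ij: "i < K" "j < K" by auto
    have const: "((\<lambda>u::real. kband_mean \<alpha> i * kband_mean \<alpha> j) has_integral kband_mean \<alpha> i * kband_mean \<alpha> j) {0..1}"
      using has_integral_const_real[of "kband_mean \<alpha> i * kband_mean \<alpha> j" 0 1] by simp
    show "((\<lambda>u. x i * x j * ((kband \<alpha> i u * kband \<alpha> j u) - kband_mean \<alpha> j * kband \<alpha> i u
        - kband_mean \<alpha> i * kband \<alpha> j u + kband_mean \<alpha> i * kband_mean \<alpha> j)) has_integral
      x i * x j * ((Sigma_mat c K p \<alpha> $$ (i, j) + kband_mean \<alpha> i * kband_mean \<alpha> j)
        - kband_mean \<alpha> j * kband_mean \<alpha> i - kband_mean \<alpha> i * kband_mean \<alpha> j + kband_mean \<alpha> i * kband_mean \<alpha> j)) {0..1}"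
      by (rule has_integral_mult_right[OF has_integral_add[OF has_integral_diff[OF has_integral_diff[OF
        integral_kband_mult[OF ij \<alpha>] has_integral_mult_right[OF integral_kband[OF ij(1) \<alpha>]]]
        has_integral_mult_right[OF integral_kband[OF ij(2) \<alpha>]]] const]])
  qed
  moreover have "(\<Sum>i<K. \<Sum>j<K. x i * x j * ((kband \<alpha> i u * kband \<alpha> j u) - kband_mean \<alpha> j * kband \<alpha> i u
      - kband_mean \<alpha> i * kband \<alpha> j u + kband_mean \<alpha> i * kband_mean \<alpha> j)) = (\<Sum>i<K. x i * (kband \<alpha> i u - kband_mean \<alpha> i))\<^sup>2" for u
    unfolding power2_eq_square sum_product by (intro sum.cong refl) (simp add: algebra_simps)
  moreover have "(\<Sum>i<K. \<Sum>j<K. x i * x j * ((Sigma_mat c K p \<alpha> $$ (i, j) + kband_mean \<alpha> i * kband_mean \<alpha> j)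
       - kband_mean \<alpha> j * kband_mean \<alpha> i - kband_mean \<alpha> i * kband_mean \<alpha> j + kband_mean \<alpha> i * kband_mean \<alpha> j)) =
     qform K (\<lambda>i j. Sigma_mat c K p \<alpha> $$ (i, j)) x"
    unfolding qform_def by (intro sum.cong refl) (simp add: algebra_simps)
  ultimately show ?thesis by simp
qed

text \<open>
  A combination of bands with zero variance is constant.  Between the two percentiles of the band \<open>k\<close>
  only that band varies, so the combination changes by \<open>x\<^sub>k\<close> times its height, which is positive.
\<close>

lemma Sigma_pos:
  assumes \<alpha>: "\<alpha> > 1" and k: "k < K" "x k \<noteq> 0"
  shows "qform K (\<lambda>i j. Sigma_mat c K p \<alpha> $$ (i, j)) x > 0"
proof -
  let ?q = "qform K (\<lambda>i j. Sigma_mat c K p \<alpha> $$ (i, j)) x"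
  define X where "X u = (\<Sum>i<K. x i * (kband \<alpha> i u - kband_mean \<alpha> i))" for u
  have int: "((\<lambda>u. (X u)\<^sup>2) has_integral ?q) (cbox 0 1)"
    using Sigma_qform_eq_variance[OF \<alpha>, of x] by (simp add: X_def)
  have cont: "continuous_on (cbox 0 1) (\<lambda>u. (X u)\<^sup>2)"
    unfolding X_def kband_def using p_step by (intro continuous_intros continuous_on_band) auto
  have "?q \<ge> 0" by (rule has_integral_nonneg[OF int]) simp
  moreover have "?q \<noteq> 0"
  proof
    assume "?q = 0"
    then have X0: "X u = 0" if "u \<in> cbox 0 1" for u
      using has_integral_0_cbox_imp_0[OF cont _ int[unfolded \<open>?q = 0\<close>] _ that] by auto
    have pp: "0 < p (k + 1)" "p (k + 1) < p (k + 2)" "p (k + 2) \<le> 1" using p_step[OF k(1)] by auto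
    have "X (p (k + 1)) - X (p (k + 2)) =
        (\<Sum>i<K. x i * (kband \<alpha> i (p (k + 1)) - kband \<alpha> i (p (k + 2))))"
      unfolding X_def by (simp add: sum_subtractf[symmetric] algebra_simps)
    also have "\<dots> = (\<Sum>i<K. if i = k then
        x k * (c * p (k + 1) powr (- (1/\<alpha>)) - c * p (k + 2) powr (- (1/\<alpha>))) else 0)"
    proof (intro sum.cong refl)
      fix i assume i: "i \<in> {..<K}"
      have pi: "0 < p (i + 1)" "p (i + 1) < p (i + 2)" using p_step[of i] i by auto
      consider "i = k" | "i < k" | "k < i" by linarith
      then show "x i * (kband \<alpha> i (p (k + 1)) - kband \<alpha> i (p (k + 2))) = (if i = k then
        x k * (c * p (k + 1) powr (- (1/\<alpha>)) - c * p (k + 2) powr (- (1/\<alpha>))) else 0)"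
      proof cases
        case 1
        then show ?thesis using pi by (simp add: kband_def band_eq_0 band_eq_full)
      next
        case 2
        then have "p (i + 2) \<le> p (k + 1)" using k by (intro p_le) auto
        then show ?thesis using 2 pi pp by (simp add: kband_def band_eq_0)
      next
        case 3
        then have "p (k + 2) \<le> p (i + 1)" using i by (intro p_le) auto
        then show ?thesis using 3 pi pp by (simp add: kband_def band_eq_full)
      qed
    qed
    also have "\<dots> = x k * (c * (p (k + 1) powr (- (1/\<alpha>)) - p (k + 2) powr (- (1/\<alpha>))))"
      using k by (simp add: right_diff_distrib)
    finally have "x k * (c * (p (k + 1) powr (- (1/\<alpha>)) - p (k + 2) powr (- (1/\<alpha>)))) = 0"
      using X0 pp by simp
    moreover have "p (k + 2) powr (- (1/\<alpha>)) < p (k + 1) powr (- (1/\<alpha>))"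
      using pp \<alpha> by (intro powr_less_mono2_neg) auto
    ultimately show False using k c by simp
  qed
  ultimately show ?thesis by simp
qed

end

section \<open>Continuity of \<open>\<Omega>\<close> and differentiability of \<open>r\<close>\<close>

lemma DERIV_powr_diff:
  assumes "0 < p" "0 < q"
  shows "((\<lambda>a. q powr a - p powr a) has_real_derivative q powr a * ln q - p powr a * ln p) (at a)"
proof -
  have "((\<lambda>a. exp (a * ln q) - exp (a * ln p)) has_real_derivative exp (a * ln q) * ln q - exp (a * ln p) * ln p) (at a)"
    by (auto intro!: derivative_eq_intros)
  then show ?thesis using assms by (simp add: powr_def)
qed

text \<open>
  With \<open>a = 1 - 2 \<xi>\<close> this is the quotient of \<open>q\<^sup>a - p\<^sup>a\<close> by \<open>a\<close>; at \<open>a = 0\<close> it is a difference quotient, so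
  it tends to the derivative \<open>ln q - ln p\<close>, the value that the definition fills in.
\<close>

lemma isCont_powr_integral:
  assumes pq: "0 < p" "0 < q"
  shows "isCont (\<lambda>\<xi>. powr_integral \<xi> p q) \<xi>"
proof -
  define L where "L a = (if a = 0 then ln (q / p) else (q powr a - p powr a) / a)" for a
  have "isCont L a" for a
  proof (cases "a = 0")
    case True
    have "(\<lambda>h. ((q powr (0 + h) - p powr (0 + h)) - (q powr 0 - p powr 0)) / h) \<midarrow>0\<rightarrow> q powr 0 * ln q - p powr 0 * ln p"
      using DERIV_powr_diff[OF pq, of 0] unfolding DERIV_def .
    then have "(\<lambda>h. (q powr h - p powr h) / h) \<midarrow>0\<rightarrow> ln (q / p)"
      using pq by (simp add: ln_div)
    moreover have "\<forall>\<^sub>F h in at 0. (q powr h - p powr h) / h = L h"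
      by (auto simp: L_def eventually_at_filter)
    ultimately have "L \<midarrow>0\<rightarrow> ln (q / p)" by (rule Lim_transform_eventually)
    then show ?thesis using True by (simp add: isCont_def L_def)
  next
    case False
    have "\<forall>\<^sub>F b in nhds a. b \<noteq> 0" using False by (rule t1_space_nhds)
    then have "\<forall>\<^sub>F b in nhds a. L b = (q powr b - p powr b) / b"
      by eventually_elim (simp add: L_def)
    moreover have "isCont (\<lambda>b. (q powr b - p powr b) / b) a"
      using pq False by (intro continuous_intros) auto
    ultimately show ?thesis by (simp cong: isCont_cong)
  qed
  then have "isCont (\<lambda>\<xi>. L (1 - 2 * \<xi>)) \<xi>" by (intro isCont_o2[of _ "\<lambda>\<xi>. 1 - 2 * \<xi>" L]) auto
  moreover have "(\<lambda>\<xi>. L (1 - 2 * \<xi>)) = (\<lambda>\<xi>. powr_integral \<xi> p q)"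
    by (auto simp: L_def powr_integral_def)
  ultimately show ?thesis by simp
qed

lemma isCont_sigma2:
  assumes pq: "0 < p" "0 < q" and \<alpha>: "\<alpha> > 1"
  shows "isCont (\<lambda>\<alpha>. sigma2 c \<alpha> p q) \<alpha>"
proof -
  have L: "isCont (\<lambda>\<alpha>. powr_integral (1/\<alpha>) p q) \<alpha>"
    using \<alpha> by (intro isCont_o2[of _ "\<lambda>\<alpha>. 1/\<alpha>" "\<lambda>\<xi>. powr_integral \<xi> p q"] isCont_powr_integral pq continuous_intros) auto
  have eq: "sigma2 c \<alpha> p q = 2 * c\<^sup>2 * (1/\<alpha>)\<^sup>2 / (1 - 1/\<alpha>) * (powr_integral (1/\<alpha>) p q
      + p powr (1 - 1/\<alpha>) * ((q powr (- (1/\<alpha>)) - p powr (- (1/\<alpha>))) / (1/\<alpha>))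
      + (2 * p powr (1 - 1/\<alpha>) * q powr (1 - 1/\<alpha>) - p powr (2 - 2 * (1/\<alpha>)) - q powr (2 - 2 * (1/\<alpha>)))
          / (2 - 2 * (1/\<alpha>)))" for \<alpha>
    by (simp only: sigma2_def Let_def powr_integral_def)
  have inv: "isCont (\<lambda>\<alpha>. 1 / \<alpha>) \<alpha>" using \<alpha> by (intro continuous_intros) auto
  have pw: "isCont (\<lambda>\<alpha>. x powr (1 - 1/\<alpha>)) \<alpha>" "isCont (\<lambda>\<alpha>. x powr (2 - 2 * (1/\<alpha>))) \<alpha>"
    "isCont (\<lambda>\<alpha>. x powr (- (1/\<alpha>))) \<alpha>" if "0 < x" for x
    using that \<alpha> by (auto intro!: continuous_intros)
  show ?thesis unfolding eq
    by (intro isCont_add isCont_diff isCont_mult isCont_divide isCont_power L pw pq inv continuous_const)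
      (use \<alpha> in \<open>auto simp: field_simps\<close>)
qed

lemma isCont_sigma_offdiag:
  assumes "0 < p i" "0 < p (i + 1)" "0 < p j" "0 < p (j + 1)" and \<alpha>: "\<alpha> > 1"
  shows "isCont (\<lambda>\<alpha>. sigma_offdiag c p \<alpha> i j) \<alpha>"
  unfolding sigma_offdiag_def Let_def using assms by (intro continuous_intros) auto

lemma isCont_mu: assumes "0 < p" "0 < q" "\<alpha> > 1" shows "isCont (\<lambda>\<alpha>. mu c \<alpha> p q) \<alpha>"
  unfolding mu_def Let_def using assms by (intro continuous_intros) auto

lemma mu_pos: assumes "0 < p" "p < q" "\<alpha> > 1" "c > 0" shows "mu c \<alpha> p q > 0"
  unfolding mu_def Let_def using assms by (simp add: powr_less_mono2)

text \<open>
  With \<open>a = 1 - 1/\<alpha>\<close> these are the components of \<open>r(\<alpha>)\<close>: the constants \<open>c\<close> and \<open>1 - \<xi>\<close> cancel.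
\<close>

definition powr_ratio :: "real \<Rightarrow> real \<Rightarrow> real \<Rightarrow> real \<Rightarrow> real \<Rightarrow> real" where
  "powr_ratio p q t s a = (q powr a - p powr a) / (s powr a - t powr a)"

definition powr_ratio_deriv :: "real \<Rightarrow> real \<Rightarrow> real \<Rightarrow> real \<Rightarrow> real \<Rightarrow> real" where
  "powr_ratio_deriv p q t s a =
     ((q powr a * ln q - p powr a * ln p) * (s powr a - t powr a)
      - (q powr a - p powr a) * (s powr a * ln s - t powr a * ln t)) / (s powr a - t powr a)\<^sup>2"

lemma DERIV_powr_ratio:
  assumes "0 < p" "0 < q" "0 < t" "t < s" "a > 0"
  shows "(powr_ratio p q t s has_real_derivative powr_ratio_deriv p q t s a) (at a)"
proof -
  have ne: "s powr a - t powr a \<noteq> 0" using assms powr_less_mono2[of a t s] by simp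
  show ?thesis
    unfolding powr_ratio_def powr_ratio_deriv_def power2_eq_square
    using assms by (intro DERIV_divide DERIV_powr_diff ne) auto
qed

text \<open>
  Cauchy's mean value theorem for \<open>x\<^sup>a ln x\<close> and \<open>x\<^sup>a\<close>.
\<close>

lemma powr_log_mean:
  assumes "0 < p" "p < q" "a > (0::real)"
  obtains x where "p < x" "x < q"
    "q powr a * ln q - p powr a * ln p = (q powr a - p powr a) * (ln x + 1 / a)"
proof -
  have f: "((\<lambda>x. x powr a * ln x) has_real_derivative x powr (a - 1) * (a * ln x + 1)) (at x)" if "x > 0" for x
    using that by (auto intro!: derivative_eq_intros simp: algebra_simps powr_diff)
  have g: "((\<lambda>x. x powr a) has_real_derivative a * x powr (a - 1)) (at x)" if "x > 0" for x
    using that by (auto intro!: derivative_eq_intros)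
  have "\<exists>x. p < x \<and> x < q \<and> (q powr a * ln q - p powr a * ln p) * (a * x powr (a - 1)) =
      (q powr a - p powr a) * (x powr (a - 1) * (a * ln x + 1))"
  proof (rule GMVT')
    show "isCont (\<lambda>x. x powr a * ln x) z" "isCont (\<lambda>x. x powr a) z" if "p \<le> z" "z \<le> q" for z
      using DERIV_isCont[OF f, of z] DERIV_isCont[OF g, of z] that assms by auto
    show "((\<lambda>x. x powr a) has_real_derivative a * z powr (a - 1)) (at z)"
      "((\<lambda>x. x powr a * ln x) has_real_derivative z powr (a - 1) * (a * ln z + 1)) (at z)" if "p < z" "z < q" for z
      using f[of z] g[of z] that assms by auto
  qed fact
  then obtain x where x: "p < x" "x < q" "(q powr a * ln q - p powr a * ln p) * (a * x powr (a - 1)) =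
      (q powr a - p powr a) * (x powr (a - 1) * (a * ln x + 1))" by blast
  have "x powr (a - 1) > 0" using x assms by simp
  moreover have "((q powr a * ln q - p powr a * ln p) * a) * x powr (a - 1) =
      ((q powr a - p powr a) * (a * ln x + 1)) * x powr (a - 1)"
    using x(3) by (simp add: mult_ac)
  ultimately have "(q powr a * ln q - p powr a * ln p) * a = (q powr a - p powr a) * (a * ln x + 1)"
    by simp
  then have "q powr a * ln q - p powr a * ln p = (q powr a - p powr a) * (ln x + 1 / a)"
    using assms(3) by (simp add: field_simps)
  with x that show ?thesis by blast
qed

text \<open>
  By \<open>powr_log_mean\<close> the numerator has the sign of \<open>ln x - ln y\<close> with \<open>x < q \<le> t < y\<close>.
\<close>

lemma powr_ratio_deriv_neg:
  assumes "0 < p" "p < q" "q \<le> t" "t < s" "a > 0"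
  shows "powr_ratio_deriv p q t s a < 0"
proof -
  obtain x where x: "p < x" "x < q"
    "q powr a * ln q - p powr a * ln p = (q powr a - p powr a) * (ln x + 1 / a)"
    using powr_log_mean[of p q a] assms by blast
  obtain y where y: "t < y" "y < s"
    "s powr a * ln s - t powr a * ln t = (s powr a - t powr a) * (ln y + 1 / a)"
    using powr_log_mean[of t s a] assms(1-3) assms(4,5) by (metis order_less_trans order_less_le_trans)
  have pos: "q powr a - p powr a > 0" "s powr a - t powr a > 0"
    using assms powr_less_mono2[of a p q] powr_less_mono2[of a t s] by auto
  have "ln x < ln y" using x y assms by simp
  have "(q powr a * ln q - p powr a * ln p) * (s powr a - t powr a)
      - (q powr a - p powr a) * (s powr a * ln s - t powr a * ln t)
    = (q powr a - p powr a) * (s powr a - t powr a) * (ln x - ln y)"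
    unfolding x(3) y(3) by (simp add: algebra_simps)
  also have "\<dots> < 0" using pos \<open>ln x < ln y\<close> by (intro mult_pos_neg mult_pos_pos) auto
  finally show ?thesis unfolding powr_ratio_deriv_def using pos by (intro divide_neg_pos) auto
qed

context percentiles
begin

definition share_ratio :: "nat \<Rightarrow> real \<Rightarrow> real" where
  "share_ratio i \<alpha> = mu_k c p \<alpha> (i + 1) / mu_k c p \<alpha> K"

definition share_ratio_deriv :: "nat \<Rightarrow> real \<Rightarrow> real" where
  "share_ratio_deriv i \<alpha> = powr_ratio_deriv (p (i + 1)) (p (i + 2)) (p K) (p (K + 1)) (1 - 1/\<alpha>) * (1 / \<alpha>\<^sup>2)"

lemma r_vec_index: "i < K - 1 \<Longrightarrow> vec_index (r_vec c K p \<alpha>) i = share_ratio i \<alpha>"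
  by (simp add: r_vec_def share_ratio_def)

lemma pK: "0 < p K" "p K < p (K + 1)"
  using p_pos[of K] p_less[of K "K + 1"] K by auto

lemma mu_K_pos: "\<alpha> > 1 \<Longrightarrow> mu_k c p \<alpha> K > 0"
  unfolding mu_k_def using pK c by (intro mu_pos) auto

lemma share_ratio_eq: assumes "\<alpha> > 1"
  shows "share_ratio i \<alpha> = powr_ratio (p (i + 1)) (p (i + 2)) (p K) (p (K + 1)) (1 - 1/\<alpha>)"
proof -
  have "1 - 1/\<alpha> \<noteq> 0" using assms by simp
  then show ?thesis using c by (simp add: share_ratio_def mu_k_def mu_def Let_def powr_ratio_def)
qed

lemma DERIV_share_ratio:
  assumes i: "i < K - 1" and \<alpha>: "\<alpha> > 1"
  shows "(share_ratio i has_real_derivative share_ratio_deriv i \<alpha>) (at \<alpha>)"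
proof -
  have "i < K" using i by simp
  then have "0 < p (i + 1)" "0 < p (i + 2)" using p_step[of i] by auto
  then have "((\<lambda>\<alpha>. powr_ratio (p (i + 1)) (p (i + 2)) (p K) (p (K + 1)) (1 - 1/\<alpha>)) has_real_derivative share_ratio_deriv i \<alpha>) (at \<alpha>)"
    unfolding share_ratio_deriv_def using pK \<alpha>
    by (intro DERIV_chain2[OF DERIV_powr_ratio]) (auto intro!: derivative_eq_intros simp: power2_eq_square)
  moreover have "\<forall>\<^sub>F \<beta> in nhds \<alpha>. share_ratio i \<beta> = powr_ratio (p (i + 1)) (p (i + 2)) (p K) (p (K + 1)) (1 - 1/\<beta>)"
    using eventually_nhds_in_open[of "{1<..}" \<alpha>] \<alpha> by (auto elim!: eventually_mono simp: share_ratio_eq)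
  ultimately show ?thesis by (subst DERIV_cong_ev[OF refl _ refl])
qed

lemma R_vec_index:
  assumes "i < K - 1" "\<alpha> > 1" shows "vec_index (R_vec c K p \<alpha>) i = share_ratio_deriv i \<alpha>"
proof -
  have "(\<lambda>\<alpha>. vec_index (r_vec c K p \<alpha>) i) = share_ratio i" using assms by (auto simp: r_vec_index)
  then show ?thesis using assms DERIV_imp_deriv[OF DERIV_share_ratio[OF assms]] by (simp add: R_vec_def)
qed

lemma share_ratio_deriv_neg: "\<alpha> > 1 \<Longrightarrow> share_ratio_deriv 0 \<alpha> < 0"
  unfolding share_ratio_deriv_def using p_step[of 0] p_le[of 2 K] pK K
  by (intro mult_neg_pos powr_ratio_deriv_neg) (auto simp: numeral_2_eq_2)

text \<open>The first share alone identifies \<open>\<alpha>\<close>, at a linear rate, because its derivative has no zero.\<close>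

lemma share_ratio_rate:
  assumes A: "A \<subseteq> {1<..}" "compact A" and \<alpha>\<^sub>0: "\<alpha>\<^sub>0 \<in> A"
  shows "\<exists>C. \<forall>\<alpha>\<in>A. \<bar>\<alpha> - \<alpha>\<^sub>0\<bar> \<le> C * \<bar>share_ratio 0 \<alpha> - share_ratio 0 \<alpha>\<^sub>0\<bar>"
proof -
  have ne: "A \<noteq> {}" using \<alpha>\<^sub>0 by auto
  obtain a where a: "a \<in> A" "\<And>x. x \<in> A \<Longrightarrow> a \<le> x" using compact_attains_inf[OF A(2) ne] by blast
  obtain b where b: "b \<in> A" "\<And>x. x \<in> A \<Longrightarrow> x \<le> b" using compact_attains_sup[OF A(2) ne] by blast
  have a1: "a > 1" using a A by auto
  have pp: "0 < p 1" "0 < p 2" using p_step[of 0] K by (auto simp: numeral_2_eq_2)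
  have "continuous_on {a..b} (share_ratio_deriv 0)"
    unfolding share_ratio_deriv_def powr_ratio_deriv_def
  proof (intro continuous_intros ballI)
    fix \<alpha> assume "\<alpha> \<in> {a..b}"
    then have "p K powr (1 - 1/\<alpha>) < p (K + 1) powr (1 - 1/\<alpha>)"
      using a1 pK by (intro powr_less_mono2) auto
    then show "(p (K + 1) powr (1 - 1/\<alpha>) - p K powr (1 - 1/\<alpha>))\<^sup>2 \<noteq> 0" by simp
  qed (use a1 pp pK in \<open>auto simp: numeral_2_eq_2\<close>)
  then obtain x where x: "x \<in> {a..b}" "\<And>y. y \<in> {a..b} \<Longrightarrow> share_ratio_deriv 0 y \<le> share_ratio_deriv 0 x"
    using continuous_attains_sup[of "{a..b}" "share_ratio_deriv 0"] a b by (metis atLeastatMost_empty_iff compact_Icc)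
  define m where "m = - share_ratio_deriv 0 x"
  have m: "m > 0" using share_ratio_deriv_neg[of x] x a1 by (simp add: m_def)
  have bound: "m \<le> \<bar>share_ratio_deriv 0 y\<bar>" if "y \<in> {a..b}" for y
    using x(2)[OF that] m by (simp add: m_def)
  have lt: "m * (v - u) \<le> \<bar>share_ratio 0 v - share_ratio 0 u\<bar>" if "u < v" "u \<in> A" "v \<in> A" for u v
  proof -
    have uv: "u \<in> {a..b}" "v \<in> {a..b}" using that a b by auto
    have "\<exists>z. u < z \<and> z < v \<and> share_ratio 0 v - share_ratio 0 u = (v - u) * share_ratio_deriv 0 z"
      using uv a1 K that by (intro MVT2 DERIV_share_ratio) auto
    then obtain z where z: "u < z" "z < v" "share_ratio 0 v - share_ratio 0 u = (v - u) * share_ratio_deriv 0 z" by blast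
    have "m * (v - u) \<le> \<bar>share_ratio_deriv 0 z\<bar> * (v - u)"
      using bound[of z] uv z that by (intro mult_right_mono) auto
    then show ?thesis using z(3) that by (simp add: abs_mult mult.commute)
  qed
  have "\<bar>\<alpha> - \<alpha>\<^sub>0\<bar> \<le> 1 / m * \<bar>share_ratio 0 \<alpha> - share_ratio 0 \<alpha>\<^sub>0\<bar>" if "\<alpha> \<in> A" for \<alpha>
  proof -
    have "m * \<bar>\<alpha> - \<alpha>\<^sub>0\<bar> \<le> \<bar>share_ratio 0 \<alpha> - share_ratio 0 \<alpha>\<^sub>0\<bar>"
      using lt[of \<alpha> \<alpha>\<^sub>0] lt[of \<alpha>\<^sub>0 \<alpha>] that \<alpha>\<^sub>0
      by (cases \<alpha> \<alpha>\<^sub>0 rule: linorder_cases) (auto simp: abs_minus_commute)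
    then show ?thesis using m by (simp add: field_simps)
  qed
  then show ?thesis by blast
qed

lemma H_mat_carrier: "H_mat c K p \<alpha> \<in> carrier_mat (K - 1) K"
  by (simp add: H_mat_def)

lemma Sigma_mat_carrier: "Sigma_mat c K p \<alpha> \<in> carrier_mat K K"
  by (simp add: Sigma_mat_def)

lemma Omega_carrier: "Omega c K p \<alpha> \<in> carrier_mat (K - 1) (K - 1)"
  unfolding Omega_def using H_mat_carrier[of \<alpha>] Sigma_mat_carrier[of \<alpha>] by auto

lemma Omega_index:
  assumes "i < K - 1" "j < K - 1"
  shows "Omega c K p \<alpha> $$ (i, j) = (\<Sum>k<K. H_mat c K p \<alpha> $$ (i, k) *
    (\<Sum>l<K. Sigma_mat c K p \<alpha> $$ (k, l) * H_mat c K p \<alpha> $$ (j, l)))"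
  using assms H_mat_carrier[of \<alpha>] Sigma_mat_carrier[of \<alpha>] unfolding Omega_def
  by (auto simp: scalar_prod_def lessThan_atLeast0 intro!: sum.cong)

lemma isCont_Omega:
  assumes ij: "i < K - 1" "j < K - 1" and \<alpha>: "\<alpha> > 1"
  shows "isCont (\<lambda>\<alpha>. Omega c K p \<alpha> $$ (i, j)) \<alpha>"
proof -
  have mK: "isCont (\<lambda>\<alpha>. mu_k c p \<alpha> K) \<alpha>" "mu_k c p \<alpha> K \<noteq> 0"
    using mu_K_pos[OF \<alpha>] pK \<alpha> unfolding mu_k_def by (auto intro!: isCont_mu)
  have H: "isCont (\<lambda>\<alpha>. H_mat c K p \<alpha> $$ (i, k)) \<alpha>" if "i < K - 1" "k < K" for i k
  proof -
    have r: "isCont (share_ratio i) \<alpha>" using DERIV_share_ratio[OF that(1) \<alpha>] by (rule DERIV_isCont)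
    have "H_mat c K p \<beta> $$ (i, k) = 1 / mu_k c p \<beta> K *
        (if k < K - 1 then (if i = k then 1 else 0) else - share_ratio i \<beta>)" for \<beta>
      using that by (simp add: H_mat_def r_vec_index)
    moreover have "isCont (\<lambda>\<beta>. if k < K - 1 then (if i = k then 1 else 0) else - share_ratio i \<beta>) \<alpha>"
      using r by (cases "k < K - 1"; cases "i = k") (auto intro!: continuous_intros)
    ultimately show ?thesis using mK by (auto intro!: continuous_intros)
  qed
  have S: "isCont (\<lambda>\<alpha>. Sigma_mat c K p \<alpha> $$ (k, l)) \<alpha>" if "k < K" "l < K" for k l
  proof (cases "k = l")
    case True
    then show ?thesis using that p_step[of k] \<alpha> by (auto simp: Sigma_mat_def intro!: isCont_sigma2)
  next
    case False
    have "0 < p (min k l + 1)" "0 < p (min k l + 1 + 1)" "0 < p (max k l + 1)" "0 < p (max k l + 1 + 1)"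
      using that by (auto intro!: p_pos)
    then show ?thesis using that False \<alpha> by (auto simp: Sigma_mat_def intro!: isCont_sigma_offdiag)
  qed
  show ?thesis unfolding Omega_index[OF ij] by (intro continuous_intros H S ij) auto
qed

lemma Sigma_sym: "k < K \<Longrightarrow> l < K \<Longrightarrow> Sigma_mat c K p \<alpha> $$ (k, l) = Sigma_mat c K p \<alpha> $$ (l, k)"
  by (auto simp: Sigma_mat_def min.commute max.commute)

text \<open>\<open>H\<^sup>T x\<close> as a function; it holds the weights of the bands in \<open>x\<^sup>T (s - r)\<close>, up to vanishing terms.\<close>

definition band_weights :: "real \<Rightarrow> (nat \<Rightarrow> real) \<Rightarrow> nat \<Rightarrow> real" where
  "band_weights \<alpha> x k =
     (if k < K - 1 then x k else - (\<Sum>i<K-1. x i * share_ratio i \<alpha>)) / mu_k c p \<alpha> K"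

lemma Omega_qform:
  assumes \<alpha>: "\<alpha> > 1" and x: "x \<in> carrier_vec (K - 1)"
  shows "scalar_prod x (Omega c K p \<alpha> *\<^sub>v x) =
    qform K (\<lambda>i j. Sigma_mat c K p \<alpha> $$ (i, j)) (band_weights \<alpha> (vec_index x))"
proof -
  let ?H = "H_mat c K p \<alpha>" and ?S = "Sigma_mat c K p \<alpha>"
  note H = H_mat_carrier[of \<alpha>] and S = Sigma_mat_carrier[of \<alpha>]
  let ?y = "transpose_mat ?H *\<^sub>v x"
  have y: "?y \<in> carrier_vec K" using H x by simp
  have "Omega c K p \<alpha> *\<^sub>v x = ?H *\<^sub>v (?S *\<^sub>v ?y)"
    unfolding Omega_def using H S x y
    by (simp add: assoc_mult_mat_vec[of _ "K - 1" K _ "K - 1"] assoc_mult_mat_vec[of _ "K - 1" K _ K])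
  then have "scalar_prod x (Omega c K p \<alpha> *\<^sub>v x) = scalar_prod ?y (?S *\<^sub>v ?y)"
    using scalar_prod_transpose[OF H x, of "?S *\<^sub>v ?y"] S y by simp
  also have "\<dots> = qform K (\<lambda>i j. ?S $$ (i, j)) (vec_index ?y)" by (rule scalar_prod_eq_qform[OF S y])
  also have "\<dots> = qform K (\<lambda>i j. ?S $$ (i, j)) (band_weights \<alpha> (vec_index x))"
  proof (rule qform_cong)
    fix k assume k: "k < K"
    have "vec_index ?y k = (\<Sum>i<K-1. ?H $$ (i, k) * vec_index x i)"
      using k H x by (simp add: scalar_prod_def lessThan_atLeast0)
    also have "\<dots> = (\<Sum>i<K-1. (if k < K - 1 then (if i = k then 1 else 0) else - share_ratio i \<alpha>) * vec_index x i) / mu_k c p \<alpha> K"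
      unfolding sum_divide_distrib using k by (intro sum.cong refl) (simp add: H_mat_def r_vec_index)
    also have "(\<Sum>i<K-1. (if k < K - 1 then (if i = k then 1 else 0) else - share_ratio i \<alpha>) * vec_index x i) =
      (if k < K - 1 then vec_index x k else - (\<Sum>i<K-1. vec_index x i * share_ratio i \<alpha>))"
    proof (cases "k < K - 1")
      case True
      have "(\<Sum>i<K-1. (if i = k then 1 else 0) * vec_index x i) = (\<Sum>i<K-1. if i = k then vec_index x i else 0)"
        by (intro sum.cong) auto
      then show ?thesis using True by simp
    next
      case False
      then show ?thesis by (simp add: sum_negf mult.commute)
    qed
    finally show "vec_index ?y k = band_weights \<alpha> (vec_index x) k" by (simp add: band_weights_def)
  qed
  finally show ?thesis .
qed

lemma pos_def_Omega:
  assumes \<alpha>: "\<alpha> > 1"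
  shows "pos_def_mat (K - 1) (Omega c K p \<alpha>)"
  unfolding pos_def_mat_def
proof (intro conjI ballI impI)
  let ?H = "H_mat c K p \<alpha>" and ?S = "Sigma_mat c K p \<alpha>"
  note H = H_mat_carrier[of \<alpha>] and S = Sigma_mat_carrier[of \<alpha>]
  have "transpose_mat ?S = ?S" using S Sigma_sym by (intro eq_matI) auto
  then have "transpose_mat (?H * ?S) = ?S * transpose_mat ?H"
    using transpose_mult[OF H S] by simp
  moreover have "transpose_mat (?H * ?S * transpose_mat ?H) = ?H * transpose_mat (?H * ?S)"
    using transpose_mult[of "?H * ?S" "K - 1" K "transpose_mat ?H" "K - 1"] H S by simp
  ultimately show "transpose_mat (Omega c K p \<alpha>) = Omega c K p \<alpha>"
    unfolding Omega_def using assoc_mult_mat[OF H S, of "transpose_mat ?H" "K - 1"] H by simp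
  fix x :: "real Matrix.vec" assume x: "x \<in> carrier_vec (K - 1)" "x \<noteq> 0\<^sub>v (K - 1)"
  then obtain k where k: "k < K - 1" "vec_index x k \<noteq> 0"
    by (metis carrier_vecD eq_vecI index_zero_vec(1) index_zero_vec(2))
  then have "band_weights \<alpha> (vec_index x) k \<noteq> 0"
    using mu_K_pos[OF \<alpha>] by (simp add: band_weights_def)
  then show "0 < scalar_prod x (Omega c K p \<alpha> *\<^sub>v x)"
    unfolding Omega_qform[OF \<alpha> x(1)] using k by (intro Sigma_pos[OF \<alpha>, of k]) auto
qed (rule Omega_carrier)

lemma R_vec_carrier: "R_vec c K p \<alpha> \<in> carrier_vec (K - 1)" by (simp add: R_vec_def)

lemma R_vec_nonzero: assumes "\<alpha> > 1" shows "R_vec c K p \<alpha> \<noteq> 0\<^sub>v (K - 1)"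
proof
  assume "R_vec c K p \<alpha> = 0\<^sub>v (K - 1)"
  then have "vec_index (R_vec c K p \<alpha>) 0 = 0" using K by simp
  then show False using R_vec_index[of 0 \<alpha>] share_ratio_deriv_neg[OF assms] K assms by simp
qed

end

section \<open>Linearization of the income shares\<close>

text \<open>
  The gap \<open>d n\<close> between two expected counts exceeds their fluctuations of order \<open>\<surd>n\<close>; the additional
  \<open>1\<close> absorbs the rounding in \<open>\<lfloor>n p\<rfloor>\<close>.
\<close>

lemma eventually_sqrt_gap:
  assumes "d > 0"
  shows "\<forall>\<^sub>F n in sequentially. B * sqrt (real n) + 1 < d * real n"
proof -
  have "filterlim (\<lambda>n. sqrt (real n)) at_top sequentially"
    by (rule filterlim_compose[OF sqrt_at_top filterlim_real_sequentially])
  then have "\<forall>\<^sub>F n in sequentially. (\<bar>B\<bar> + 1) / d < sqrt (real n)"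
    by (simp add: filterlim_at_top_dense)
  moreover have "\<forall>\<^sub>F n in sequentially. n \<ge> (1::nat)" by (rule eventually_ge_at_top)
  ultimately show ?thesis
  proof eventually_elim
    case (elim n)
    have n1: "sqrt (real n) \<ge> 1" using elim(2) by simp
    have "B * sqrt (real n) + 1 \<le> (\<bar>B\<bar> + 1) * sqrt (real n)"
    proof -
      have "B * sqrt (real n) \<le> \<bar>B\<bar> * sqrt (real n)" by (intro mult_right_mono) auto
      then show ?thesis using n1 unfolding distrib_right by linarith
    qed
    also have "\<dots> < (d * sqrt (real n)) * sqrt (real n)"
      using elim(1) assms n1 by (intro mult_strict_right_mono) (auto simp: field_simps)
    also have "\<dots> = d * real n" by simp
    finally show ?case .
  qed
qed

locale pareto_sample = prob_space M + percentiles K p c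
  for M :: "'a measure" and K :: nat and p :: "nat \<Rightarrow> real" and c :: real +
  fixes Y :: "nat \<Rightarrow> 'a \<Rightarrow> real" and \<alpha>\<^sub>0 :: real
  assumes \<alpha>\<^sub>0: "\<alpha>\<^sub>0 > 1" and indep: "indep_vars (\<lambda>i. borel) Y {1..}"
    and pareto: "\<And>i. i \<ge> 1 \<Longrightarrow> cdf (distr M borel (Y i)) = pareto_cdf \<alpha>\<^sub>0 c"
begin

abbreviation \<xi> :: real where "\<xi> \<equiv> 1 / \<alpha>\<^sub>0"

definition law :: "real measure" where "law = distr M borel (Y 1)"

definition quant :: "nat \<Rightarrow> real" where "quant k = c * p k powr (- \<xi>)"

lemma measurable_Y: "i \<ge> 1 \<Longrightarrow> Y i \<in> borel_measurable M"
  using indep by (auto simp: indep_vars_def)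

lemma distr_Y: assumes "i \<ge> 1" shows "distr M borel (Y i) = law"
  unfolding law_def
  by (rule cdf_unique) (use assms measurable_Y in \<open>auto simp: pareto intro!: real_distribution_distr\<close>)

lemma real_distribution_law: "real_distribution law"
  unfolding law_def by (intro real_distribution_distr measurable_Y) simp

lemma cdf_law: "cdf law = pareto_cdf \<alpha>\<^sub>0 c"
  unfolding law_def by (rule pareto) simp

definition unif :: "real measure" where "unif = density lborel (indicator {0<..1})"

lemma measure_unif: assumes [measurable]: "S \<in> sets borel" shows "measure unif S = measure lborel (S \<inter> {0<..1})"
proof -
  have "emeasure unif S = emeasure lborel (S \<inter> {0<..1})"
    unfolding unif_def by (subst emeasure_density) (auto simp: nn_integral_indicator[symmetric] indicator_inter_arith mult.commute simp del: nn_integral_indicator)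
  then show ?thesis by (simp add: measure_def)
qed

lemma law_eq_distr_unif: "law = distr unif borel (\<lambda>u. c * u powr (- \<xi>))"
proof (rule cdf_unique)
  show "real_distribution law" by (rule real_distribution_law)
  have [measurable_cong]: "sets unif = sets borel" by (simp add: unif_def)
  interpret U: prob_space unif
  proof
    have "emeasure unif (space unif) = emeasure lborel {0<..1::real}"
      unfolding unif_def by (subst emeasure_density) (auto simp: nn_integral_indicator)
    then show "emeasure unif (space unif) = 1" by simp
  qed
  show "real_distribution (distr unif borel (\<lambda>u. c * u powr (- \<xi>)))"
    by (rule U.real_distribution_distr) measurable
  show "cdf law = cdf (distr unif borel (\<lambda>u. c * u powr (- \<xi>)))"
  proof
    fix y
    let ?S = "{u. c * u powr (- \<xi>) \<le> y}"
    have S[measurable]: "?S \<in> sets borel" by measurable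
    have "cdf (distr unif borel (\<lambda>u. c * u powr (- \<xi>))) y = measure unif ?S"
      unfolding cdf_def by (subst measure_distr) (auto simp: vimage_def unif_def)
    also have "\<dots> = measure lborel (?S \<inter> {0<..1})" by (rule measure_unif) (rule S)
    also have "\<dots> = pareto_cdf \<alpha>\<^sub>0 c y"
    proof (cases "c \<le> y")
      case True
      then have y: "y > 0" using c by simp
      define q where "q = (y / c) powr (- \<alpha>\<^sub>0)"
      have q: "0 < q" "q \<le> 1"
        using True y c \<alpha>\<^sub>0 powr_mono2'[of "- \<alpha>\<^sub>0" 1 "y / c"] by (auto simp: q_def)
      have qy: "c * q powr (- \<xi>) = y" using y c \<alpha>\<^sub>0 by (simp add: q_def powr_powr)
      have "?S \<inter> {0<..1} = {q..1}"
      proof (intro subset_antisym subsetI)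
        fix u assume u: "u \<in> ?S \<inter> {0<..1}"
        have "q \<le> u"
        proof (rule ccontr)
          assume "\<not> q \<le> u"
          then have "q powr (- \<xi>) < u powr (- \<xi>)" using u \<alpha>\<^sub>0 by (intro powr_less_mono2_neg) auto
          then have "c * q powr (- \<xi>) < c * u powr (- \<xi>)" using c by simp
          then show False using u qy by auto
        qed
        then show "u \<in> {q..1}" using u by auto
      next
        fix u assume u: "u \<in> {q..1}"
        then have "u powr (- \<xi>) \<le> q powr (- \<xi>)" using q \<alpha>\<^sub>0 by (intro powr_mono2') auto
        then have "c * u powr (- \<xi>) \<le> c * q powr (- \<xi>)" using c by simp
        then show "u \<in> ?S \<inter> {0<..1}" using u q qy by auto
      qed
      then show ?thesis using q True by (simp add: pareto_cdf_def q_def)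
    next
      case False
      have "?S \<inter> {0<..1} = {}"
      proof (intro equals0I)
        fix u assume u: "u \<in> ?S \<inter> {0<..1}"
        then have "1 \<le> u powr (- \<xi>)" using \<alpha>\<^sub>0 powr_mono2'[of "- \<xi>" u 1] by auto
        then have "c \<le> c * u powr (- \<xi>)" using c by simp
        then show False using u False by auto
      qed
      then show ?thesis using False by (simp add: pareto_cdf_def)
    qed
    finally show "cdf law y = cdf (distr unif borel (\<lambda>u. c * u powr (- \<xi>))) y" by (simp add: cdf_law)
  qed
qed

text \<open>
  Stated with the Henstock--Kurzweil integral of a continuous \<open>f\<close>, because that is how the integrals of
  the bands come from their antiderivatives.
\<close>

lemma integral_law:
  assumes [measurable]: "h \<in> borel_measurable borel"
    and hf: "\<And>u. 0 < u \<Longrightarrow> u \<le> 1 \<Longrightarrow> h (c * u powr (- \<xi>)) = f u"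
    and cont: "continuous_on {0..1} f" and I: "(f has_integral I) {0..1}"
  shows "(LINT y|law. h y) = (I :: real)"
proof -
  have [measurable_cong]: "sets unif = sets borel" by (simp add: unif_def)
  have si: "set_integrable lborel {0..1} f" using cont by (rule borel_integrable_atLeastAtMost')
  have "(LINT y|law. h y) = (LINT u|unif. h (c * u powr (- \<xi>)))"
    unfolding law_eq_distr_unif by (subst integral_distr) auto
  also have "\<dots> = (LINT u|lborel. indicator {0<..1} u *\<^sub>R h (c * u powr (- \<xi>)))"
    unfolding unif_def using integral_density[of "\<lambda>u. h (c * u powr (- \<xi>))" lborel "indicator {0<..1::real}"]
    by (simp add: ennreal_indicator)
  also have "\<dots> = (LINT u|lborel. indicator {0..1} u *\<^sub>R f u)"
  proof (rule integral_cong_AE)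
    show "(\<lambda>u. indicator {0..1} u *\<^sub>R f u) \<in> borel_measurable lborel"
      using si unfolding set_integrable_def by (rule borel_measurable_integrable)
    show "AE u in lborel. indicator {0<..1} u *\<^sub>R h (c * u powr (- \<xi>)) = indicator {0..1} u *\<^sub>R f u"
      using AE_lborel_singleton[of "0::real"] by eventually_elim (auto simp: hf indicator_def)
  qed measurable
  also have "\<dots> = integral {0..1} f"
    using set_borel_integral_eq_integral(2)[OF si] by (simp add: set_lebesgue_integral_def)
  also have "\<dots> = I" using I by (rule integral_unique)
  finally show ?thesis .
qed

lemma quant_pos: "1 \<le> k \<Longrightarrow> k \<le> K + 1 \<Longrightarrow> quant k > 0"
  using p_pos[of k] c by (simp add: quant_def)

lemma quant_ge_c: "1 \<le> k \<Longrightarrow> k \<le> K + 1 \<Longrightarrow> c \<le> quant k"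
  using p_pos[of k] p_le1[of k] c \<alpha>\<^sub>0 powr_mono2'[of "- \<xi>" "p k" 1] by (simp add: quant_def)

lemma tail_quant: "1 \<le> k \<Longrightarrow> k \<le> K + 1 \<Longrightarrow> (quant k / c) powr (- \<alpha>\<^sub>0) = p k"
  using p_pos[of k] c \<alpha>\<^sub>0 by (simp add: quant_def powr_powr)

definition top_count :: "nat \<Rightarrow> nat \<Rightarrow> nat" where "top_count k n = nat \<lfloor>real n * p k\<rfloor>"

abbreviation obs :: "'a \<Rightarrow> nat \<Rightarrow> real" where "obs \<omega> \<equiv> (\<lambda>i. Y i \<omega>)"

lemma top_count_bounds:
  assumes "1 \<le> k" "k \<le> K + 1"
  shows "real n * p k - 1 < top_count k n" "real (top_count k n) \<le> real n * p k" "top_count k n \<le> n"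
proof -
  have 0: "0 \<le> real n * p k" using p_pos[OF assms] by simp
  then have "real (top_count k n) = of_int \<lfloor>real n * p k\<rfloor>" by (simp add: top_count_def)
  then show "real n * p k - 1 < top_count k n" "real (top_count k n) \<le> real n * p k" by linarith+
  moreover have "real n * p k \<le> real n * 1" using p_le1[OF assms] by (intro mult_left_mono) auto
  ultimately have "real (top_count k n) \<le> real n" by linarith
  then show "top_count k n \<le> n" by simp
qed

lemma count_above_bounded:
  "bounded_in_prob (\<lambda>n \<omega>. (real (count_above n (obs \<omega>) s) - real n * (1 - pareto_cdf \<alpha>\<^sub>0 c s)) / sqrt (real n))"
proof -
  interpret L: real_distribution law by (rule real_distribution_law)
  have "measure law {s<..} = 1 - pareto_cdf \<alpha>\<^sub>0 c s"
    using L.prob_compl[of "{..s}"] by (simp add: cdf_law[symmetric] cdf_def Compl_eq_Diff_UNIV[symmetric])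
  then have m: "(LINT y|law. indicator {s<..} y) = 1 - pareto_cdf \<alpha>\<^sub>0 c s" by simp
  have "bounded_in_prob (\<lambda>n \<omega>. ((\<Sum>i=1..n. indicator {s<..} (Y i \<omega>)) - n * (LINT y|law. indicator {s<..} y)) / sqrt n)"
    by (rule bounded_in_prob_normalized_sum[OF indep distr_Y, where B=1]) (auto simp: indicator_def)
  moreover have "real (count_above n y s) = (\<Sum>i=1..n. indicator {s<..} (y i))" for n y
    unfolding count_above_eq_sum of_nat_sum by (intro sum.cong) auto
  ultimately show ?thesis unfolding m by (simp only:)
qed

lemma AE_ge_c: "AE \<omega> in M. \<forall>i\<in>{1..n}. s < Y i \<omega>" if "s < c"
proof (rule AE_finite_allI)
  fix i assume i: "i \<in> {1..n}"
  interpret L: real_distribution law by (rule real_distribution_law)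
  have [measurable]: "Y i \<in> borel_measurable M" using i by (intro measurable_Y) simp
  have "measure law {..s} = 0" using that cdf_law by (simp add: cdf_def pareto_cdf_def fun_eq_iff)
  then have "AE y in law. y \<notin> {..s}"
    by (intro AE_not_in) (simp add: null_sets_def L.emeasure_eq_measure)
  moreover have "distr M borel (Y i) = law" using i by (intro distr_Y) simp
  ultimately have "AE y in distr M borel (Y i). y \<notin> {..s}" by (simp only:)
  then show "AE \<omega> in M. s < Y i \<omega>" by (subst (asm) AE_distr_iff) (auto simp: not_le)
qed simp

lemma count_above_concentration:
  assumes d: "d > 0"
  shows "whp (\<lambda>n \<omega>. \<bar>real (count_above n (obs \<omega>) s) - real n * (1 - pareto_cdf \<alpha>\<^sub>0 c s)\<bar> + 1 < d * real n)"
proof (rule whp_of_bounded[OF count_above_bounded[of s]], rule whp_eventually)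
  fix B
  let ?N = "\<lambda>n \<omega>. real (count_above n (obs \<omega>) s) - real n * (1 - pareto_cdf \<alpha>\<^sub>0 c s)"
  have "\<forall>\<^sub>F n in sequentially. B * sqrt (real n) + 1 < d * real n" "\<forall>\<^sub>F n in sequentially. (1::nat) \<le> n"
    using d by (auto intro: eventually_sqrt_gap eventually_ge_at_top)
  then show "\<forall>\<^sub>F n in sequentially. \<forall>\<omega>\<in>space M. \<bar>?N n \<omega> / sqrt (real n)\<bar> \<le> B \<longrightarrow> \<bar>?N n \<omega>\<bar> + 1 < d * real n"
  proof (eventually_elim, intro ballI impI)
    fix n \<omega>
    assume g: "B * sqrt (real n) + 1 < d * real n" and n: "1 \<le> n" and B: "\<bar>?N n \<omega> / sqrt (real n)\<bar> \<le> B"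
    have "\<bar>?N n \<omega>\<bar> \<le> B * sqrt (real n)" using B n by (simp add: abs_divide pos_divide_le_eq)
    then show "\<bar>?N n \<omega>\<bar> + 1 < d * real n" using g by linarith
  qed
qed

lemma whp_count_above_less:
  assumes k: "1 \<le> k" "k \<le> K + 1" and q: "1 - pareto_cdf \<alpha>\<^sub>0 c s < p k"
  shows "whp (\<lambda>n \<omega>. count_above n (obs \<omega>) s < top_count k n)"
proof (rule whp_mono[OF count_above_concentration[of "p k - (1 - pareto_cdf \<alpha>\<^sub>0 c s)" s]],
    use q in simp, intro always_eventually allI ballI impI)
  fix n \<omega>
  let ?q = "1 - pareto_cdf \<alpha>\<^sub>0 c s"
  assume "\<bar>real (count_above n (obs \<omega>) s) - real n * ?q\<bar> + 1 < (p k - ?q) * real n"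
  then have "real (count_above n (obs \<omega>) s) - real n * ?q + 1 < (p k - ?q) * real n" by linarith
  then show "count_above n (obs \<omega>) s < top_count k n"
    using top_count_bounds(1)[OF k, of n] by (simp add: algebra_simps)
qed

lemma whp_count_above_ge:
  assumes k: "1 \<le> k" "k \<le> K + 1" and q: "p k < 1 - pareto_cdf \<alpha>\<^sub>0 c s"
  shows "whp (\<lambda>n \<omega>. top_count k n \<le> count_above n (obs \<omega>) s)"
proof (rule whp_mono[OF count_above_concentration[of "1 - pareto_cdf \<alpha>\<^sub>0 c s - p k" s]],
    use q in simp, intro always_eventually allI ballI impI)
  fix n \<omega>
  let ?q = "1 - pareto_cdf \<alpha>\<^sub>0 c s"
  assume "\<bar>real (count_above n (obs \<omega>) s) - real n * ?q\<bar> + 1 < (?q - p k) * real n"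
  then have "real n * ?q - real (count_above n (obs \<omega>) s) + 1 < (?q - p k) * real n" by linarith
  then show "top_count k n \<le> count_above n (obs \<omega>) s"
    using top_count_bounds(2)[OF k, of n] by (simp add: algebra_simps)
qed

text \<open>
  Equivalently, the order statistic of rank \<open>\<lfloor>n p\<^sub>k\<rfloor>\<close> lies within \<open>\<delta>\<close> of the quantile.  The expected
  proportions of incomes above \<open>t + \<delta>\<close> and \<open>t - \<delta>\<close> are separated from \<open>p\<^sub>k\<close>, except that \<open>p\<^sub>k = 1\<close> admits no
  larger proportion.
\<close>

lemma quantile_bracket:
  assumes k: "1 \<le> k" "k \<le> K + 1" and \<delta>: "\<delta> > 0"
  shows "whp (\<lambda>n \<omega>. count_above n (obs \<omega>) (quant k + \<delta>) < top_count k n \<and>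
    top_count k n \<le> count_above n (obs \<omega>) (quant k - \<delta>))"
proof (rule whp_conj)
  have "((quant k + \<delta>) / c) powr (- \<alpha>\<^sub>0) < (quant k / c) powr (- \<alpha>\<^sub>0)"
    using quant_pos[OF k] c \<delta> \<alpha>\<^sub>0 by (intro powr_less_mono2_neg divide_strict_right_mono) auto
  then show "whp (\<lambda>n \<omega>. count_above n (obs \<omega>) (quant k + \<delta>) < top_count k n)"
    using quant_ge_c[OF k] \<delta>
    by (intro whp_count_above_less k) (simp add: pareto_cdf_def tail_quant[OF k])
  show "whp (\<lambda>n \<omega>. top_count k n \<le> count_above n (obs \<omega>) (quant k - \<delta>))"
  proof (cases "p k = 1")
    case True
    \<comment> \<open>Here \<open>quant k = c\<close>, and all observations count.\<close>
    then have less: "quant k - \<delta> < c" using \<delta> by (simp add: quant_def)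
    show ?thesis
    proof (rule whp_AE, rule always_eventually, rule allI)
      fix n
      from AE_ge_c[OF less, of n]
      show "AE \<omega> in M. top_count k n \<le> count_above n (obs \<omega>) (quant k - \<delta>)"
      proof eventually_elim
        case (elim \<omega>)
        then have "{i\<in>{1..n}. quant k - \<delta> < obs \<omega> i} = {1..n}" by auto
        then show ?case using top_count_bounds(3)[OF k, of n] by (simp add: count_above_def)
      qed
    qed
  next
    case False
    then have pk: "p k < 1" using p_le1[OF k] by simp
    have "(quant k / c) powr (- \<alpha>\<^sub>0) < ((quant k - \<delta>) / c) powr (- \<alpha>\<^sub>0)" if "c \<le> quant k - \<delta>"
      using c \<delta> \<alpha>\<^sub>0 that by (intro powr_less_mono2_neg divide_strict_right_mono) auto
    then show ?thesis using pk by (intro whp_count_above_ge k) (simp add: pareto_cdf_def tail_quant[OF k])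
  qed
qed

lemma lim_const_over_sqrt: "(\<lambda>n. b / sqrt (real n)) \<longlonglongrightarrow> 0"
  by (intro tendsto_divide_0[OF tendsto_const] filterlim_at_top_imp_at_infinity
      filterlim_compose[OF sqrt_at_top filterlim_real_sequentially])

lemma vanishes_top_count: assumes k: "1 \<le> k" "k \<le> K + 1"
  shows "vanishes_in_prob (\<lambda>n \<omega>. (real (top_count k n) - real n * p k) / sqrt (real n))"
proof (rule vanishes_mono[OF vanishes_const[OF lim_const_over_sqrt[of 1]]], intro whp_eventually always_eventually allI ballI)
  fix n \<omega>
  have "\<bar>real (top_count k n) - real n * p k\<bar> \<le> 1" using top_count_bounds(1,2)[OF k, of n] by linarith
  then show "\<bar>(real (top_count k n) - real n * p k) / sqrt (real n)\<bar> \<le> \<bar>1 / sqrt (real n)\<bar>"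
    by (simp add: abs_divide divide_right_mono)
qed

text \<open>
  The remainder in \<open>top_sum_approx\<close>, divided by \<open>\<surd>n\<close>, is a product of a factor that is bounded in
  probability and an arbitrarily small \<open>\<delta>\<close>.
\<close>

lemma top_sum_linear:
  assumes k: "1 \<le> k" "k \<le> K + 1"
  shows "vanishes_in_prob (\<lambda>n \<omega>. (top_sum (obs \<omega>) n (top_count k n)
    - (real n * p k * quant k + (\<Sum>i=1..n. max (Y i \<omega> - quant k) 0))) / sqrt (real n))"
proof -
  let ?N = "\<lambda>n \<omega>. real (count_above n (obs \<omega>) (quant k))"
  let ?R = "\<lambda>n \<omega>. top_sum (obs \<omega>) n (top_count k n)
    - (real (top_count k n) * quant k + (\<Sum>i=1..n. max (Y i \<omega> - quant k) 0))"
  have q: "1 - pareto_cdf \<alpha>\<^sub>0 c (quant k) = p k"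
    using quant_ge_c[OF k] by (simp add: pareto_cdf_def tail_quant[OF k])
  have "bounded_in_prob (\<lambda>n \<omega>. (real (top_count k n) - real n * p k) / sqrt (real n)
      + (- 1) * ((?N n \<omega> - real n * p k) / sqrt (real n)))"
    using bounded_in_prob_add[OF vanishes_imp_bounded[OF vanishes_top_count[OF k]]
      bounded_in_prob_cmult[OF count_above_bounded[of "quant k"], of "- 1"]] unfolding q .
  then have bd: "bounded_in_prob (\<lambda>n \<omega>. (real (top_count k n) - ?N n \<omega>) / sqrt (real n))"
    by (simp add: diff_divide_distrib algebra_simps)
  have "vanishes_in_prob (\<lambda>n \<omega>. ?R n \<omega> / sqrt (real n))"
    unfolding vanishes_in_prob_def
  proof (intro allI impI)
    fix \<epsilon> :: real assume \<epsilon>: "\<epsilon> > 0"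
    show "whp (\<lambda>n \<omega>. \<bar>?R n \<omega> / sqrt (real n)\<bar> \<le> \<epsilon>)"
    proof (rule whp_of_bounded[OF bd])
      fix B :: real
      define \<delta> where "\<delta> = \<epsilon> / (\<bar>B\<bar> + 1)"
      have \<delta>: "\<delta> > 0" using \<epsilon> by (simp add: \<delta>_def add_nonneg_pos)
      have B\<delta>: "\<bar>B\<bar> * \<delta> \<le> \<epsilon>"
      proof -
        have "\<bar>B\<bar> * \<delta> \<le> (\<bar>B\<bar> + 1) * \<delta>" using \<delta> by simp
        also have "\<dots> = \<epsilon>" by (simp add: \<delta>_def)
        finally show ?thesis .
      qed
      show "whp (\<lambda>n \<omega>. \<bar>(real (top_count k n) - ?N n \<omega>) / sqrt (real n)\<bar> \<le> B \<longrightarrow> \<bar>?R n \<omega> / sqrt (real n)\<bar> \<le> \<epsilon>)"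
      proof (rule whp_mono[OF quantile_bracket[OF k \<delta>]], intro always_eventually allI ballI impI)
        fix n \<omega>
        assume br: "count_above n (obs \<omega>) (quant k + \<delta>) < top_count k n \<and>
            top_count k n \<le> count_above n (obs \<omega>) (quant k - \<delta>)"
          and B: "\<bar>(real (top_count k n) - ?N n \<omega>) / sqrt (real n)\<bar> \<le> B"
        have "\<bar>?R n \<omega>\<bar> \<le> \<bar>real (top_count k n) - ?N n \<omega>\<bar> * \<delta>"
          using br by (intro top_sum_approx top_count_bounds k) auto
        then have "\<bar>?R n \<omega>\<bar> / sqrt (real n) \<le> \<bar>real (top_count k n) - ?N n \<omega>\<bar> * \<delta> / sqrt (real n)"
          by (intro divide_right_mono) auto
        also have "\<dots> = \<bar>(real (top_count k n) - ?N n \<omega>) / sqrt (real n)\<bar> * \<delta>" by (simp add: abs_divide)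
        also have "\<dots> \<le> \<bar>B\<bar> * \<delta>" using B \<delta> by (intro mult_right_mono) auto
        finally show "\<bar>?R n \<omega> / sqrt (real n)\<bar> \<le> \<epsilon>" using B\<delta> by (simp add: abs_divide)
      qed
    qed
  qed
  then have "vanishes_in_prob (\<lambda>n \<omega>. ?R n \<omega> / sqrt (real n)
      + quant k * ((real (top_count k n) - real n * p k) / sqrt (real n)))"
    by (intro vanishes_add vanishes_cmult vanishes_top_count k)
  then show ?thesis
    by (simp add: diff_divide_distrib add_divide_distrib algebra_simps)
qed

text \<open>
  The contribution of an income \<open>y\<close> to the sum of the incomes between two neighbouring percentiles, up
  to a constant.  It is bounded, unlike the two positive parts.
\<close>

definition psi :: "nat \<Rightarrow> real \<Rightarrow> real" where
  "psi i y = max (y - quant (i + 2)) 0 - max (y - quant (i + 1)) 0"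

lemma quant_antimono: "i < K \<Longrightarrow> quant (i + 2) \<le> quant (i + 1)"
  using p_step[of i] \<alpha>\<^sub>0 c powr_mono2'[of "- \<xi>" "p (i + 1)" "p (i + 2)"] by (simp add: quant_def)

lemma psi_bound: "i < K \<Longrightarrow> \<bar>psi i y\<bar> \<le> quant (i + 1) - quant (i + 2)"
  using quant_antimono[of i] by (auto simp: psi_def max_def)

lemma measurable_psi[measurable]: "psi i \<in> borel_measurable borel"
  unfolding psi_def by measurable

lemma psi_quantile:
  assumes i: "i < K" and u: "0 < u"
  shows "psi i (c * u powr (- \<xi>)) = kband \<alpha>\<^sub>0 i u"
proof -
  have mono: "c * v powr (- \<xi>) \<le> c * u powr (- \<xi>)" if "0 < u" "u \<le> v" for u v
    using that c \<alpha>\<^sub>0 by (intro mult_left_mono powr_mono2') auto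
  have pp: "0 < p (i + 1)" "p (i + 1) < p (i + 2)" using p_step[OF i] by auto
  consider "u \<le> p (i + 1)" | "p (i + 1) \<le> u" "u \<le> p (i + 2)" | "p (i + 2) \<le> u" by linarith
  then show ?thesis
  proof cases
    case 1
    then show ?thesis using mono[OF u 1] mono[of "p (i+1)" "p (i+2)"] pp
      by (simp add: kband_def band_eq_full psi_def quant_def)
  next
    case 2
    then show ?thesis using mono[OF u 2(2)] mono[of "p (i+1)" u] pp
      by (simp add: kband_def band_eq_inside psi_def quant_def)
  next
    case 3
    then show ?thesis using mono[of "p (i+2)" u] mono[of "p (i+1)" "p (i+2)"] pp
      by (simp add: kband_def band_eq_0 psi_def quant_def)
  qed
qed

lemma continuous_on_kband: "i < K \<Longrightarrow> continuous_on S (kband \<alpha>\<^sub>0 i)"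
  unfolding kband_def using p_step[of i] by (intro continuous_on_band) auto

lemma mean_psi: assumes "i < K" shows "(LINT y|law. psi i y) = kband_mean \<alpha>\<^sub>0 i"
  by (rule integral_law[where f="kband \<alpha>\<^sub>0 i"])
    (use assms \<alpha>\<^sub>0 in \<open>auto intro!: psi_quantile continuous_on_kband integral_kband\<close>)

lemma mean_centered_psi: "(LINT y|law. (\<Sum>i<K. x i * (psi i y - kband_mean \<alpha>\<^sub>0 i))) = 0"
proof (rule integral_law[where f="\<lambda>u. \<Sum>i<K. x i * (kband \<alpha>\<^sub>0 i u - kband_mean \<alpha>\<^sub>0 i)"])
  have const: "((\<lambda>u::real. kband_mean \<alpha>\<^sub>0 i) has_integral kband_mean \<alpha>\<^sub>0 i) {0..1}" for i
    using has_integral_const_real[of "kband_mean \<alpha>\<^sub>0 i" 0 1] by simp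
  have "((\<lambda>u. \<Sum>i<K. x i * (kband \<alpha>\<^sub>0 i u - kband_mean \<alpha>\<^sub>0 i)) has_integral
      (\<Sum>i<K. x i * (kband_mean \<alpha>\<^sub>0 i - kband_mean \<alpha>\<^sub>0 i))) {0..1}"
    by (intro has_integral_sum has_integral_mult_right has_integral_diff[OF integral_kband[OF _ \<alpha>\<^sub>0] const]) auto
  then show "((\<lambda>u. \<Sum>i<K. x i * (kband \<alpha>\<^sub>0 i u - kband_mean \<alpha>\<^sub>0 i)) has_integral 0) {0..1}" by simp
qed (auto intro!: sum.cong continuous_intros continuous_on_kband simp: psi_quantile)

lemma variance_psi:
  "(LINT y|law. (\<Sum>i<K. x i * (psi i y - kband_mean \<alpha>\<^sub>0 i))\<^sup>2) = qform K (\<lambda>i j. Sigma_mat c K p \<alpha>\<^sub>0 $$ (i, j)) x"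
proof (rule integral_law[where f="\<lambda>u. (\<Sum>i<K. x i * (kband \<alpha>\<^sub>0 i u - kband_mean \<alpha>\<^sub>0 i))\<^sup>2"])
  show "((\<lambda>u. (\<Sum>i<K. x i * (kband \<alpha>\<^sub>0 i u - kband_mean \<alpha>\<^sub>0 i))\<^sup>2) has_integral
      qform K (\<lambda>i j. Sigma_mat c K p \<alpha>\<^sub>0 $$ (i, j)) x) {0..1}"
    by (rule Sigma_qform_eq_variance[OF \<alpha>\<^sub>0])
  show "(\<Sum>i<K. x i * (psi i (c * u powr (- \<xi>)) - kband_mean \<alpha>\<^sub>0 i))\<^sup>2 =
      (\<Sum>i<K. x i * (kband \<alpha>\<^sub>0 i u - kband_mean \<alpha>\<^sub>0 i))\<^sup>2" if "0 < u" for u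
    using that by (intro arg_cong[where f="\<lambda>x. x\<^sup>2"] sum.cong refl) (simp add: psi_quantile)
qed (auto intro!: continuous_intros continuous_on_kband)

definition psi_sum :: "nat \<Rightarrow> nat \<Rightarrow> 'a \<Rightarrow> real" where
  "psi_sum i n \<omega> = ((\<Sum>j=1..n. psi i (Y j \<omega>)) - real n * kband_mean \<alpha>\<^sub>0 i) / sqrt (real n)"

definition rank_average :: "nat \<Rightarrow> nat \<Rightarrow> 'a \<Rightarrow> real" where
  "rank_average i n \<omega> = (top_sum (obs \<omega>) n (top_count (i + 2) n) - top_sum (obs \<omega>) n (top_count (i + 1) n)) / real n"

abbreviation mu0 :: "nat \<Rightarrow> real" where "mu0 i \<equiv> mu_k c p \<alpha>\<^sub>0 (i + 1)"

lemma psi_sum_bounded: "i < K \<Longrightarrow> bounded_in_prob (psi_sum i)"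
  unfolding psi_sum_def mean_psi[symmetric]
  by (rule bounded_in_prob_normalized_sum[OF indep distr_Y]) (auto intro: psi_bound)

lemma rank_average_linear:
  assumes i: "i < K"
  shows "vanishes_in_prob (\<lambda>n \<omega>. sqrt (real n) * (rank_average i n \<omega> - mu0 i) - psi_sum i n \<omega>)"
proof -
  let ?R = "\<lambda>k n \<omega>. (top_sum (obs \<omega>) n (top_count k n)
    - (real n * p k * quant k + (\<Sum>i=1..n. max (Y i \<omega> - quant k) 0))) / sqrt (real n)"
  have van: "vanishes_in_prob (\<lambda>n \<omega>. ?R (i + 2) n \<omega> - ?R (i + 1) n \<omega>)"
    using i by (intro vanishes_diff top_sum_linear) auto
  have km: "kband_mean \<alpha>\<^sub>0 i = mu0 i + p (i + 1) * quant (i + 1) - p (i + 2) * quant (i + 2)"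
    using p_step[OF i] \<alpha>\<^sub>0 unfolding kband_mean_def
    by (subst band_mean_eq_mu) (auto simp: mu_k_def quant_def)
  show ?thesis
  proof (rule vanishes_cong[OF van], rule whp_eventually, rule eventually_sequentiallyI[of 1], rule ballI)
    fix n \<omega> assume n: "1 \<le> (n::nat)"
    have s: "sqrt (real n) * (x / real n - m) = (x - real n * m) / sqrt (real n)" for x m
      using n by (simp add: field_simps)
    show "sqrt (real n) * (rank_average i n \<omega> - mu0 i) - psi_sum i n \<omega> = ?R (i + 2) n \<omega> - ?R (i + 1) n \<omega>"
      unfolding rank_average_def psi_sum_def s diff_divide_distrib[symmetric] km psi_def sum_subtractf
      by (intro arg_cong[where f="\<lambda>x. x / sqrt (real n)"]) (simp add: algebra_simps)
  qed
qed

lemma sbar_eq: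
  assumes n: "(\<Sum>i=1..n. Y i \<omega>) \<noteq> 0" "n \<ge> 1" and i: "i < K - 1"
  shows "vec_index (sbar K p n (obs \<omega>)) i = rank_average i n \<omega> / rank_average (K - 1) n \<omega>"
proof -
  let ?S = "\<Sum>i=1..n. order_stat n (obs \<omega>) i"
  have S: "?S \<noteq> 0" using n(1) sum_order_stat[of "\<lambda>x. x" n "obs \<omega>"] by simp
  have ts: "top_share p n (obs \<omega>) k = top_sum (obs \<omega>) n (top_count k n) / ?S" for k
    by (simp add: top_share_def top_sum_def top_count_def)
  have K': "K - 1 + 2 = K + 1" "K - 1 + 1 = K" using K by auto
  show ?thesis using i S n(2) unfolding rank_average_def K'
    by (simp add: sbar_def ts diff_divide_distrib[symmetric])
qed

lemma whp_sbar_eq: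
  "whp (\<lambda>n \<omega>. \<forall>i<K - 1. vec_index (sbar K p n (obs \<omega>)) i = rank_average i n \<omega> / rank_average (K - 1) n \<omega>)"
proof (intro whp_AE eventually_sequentiallyI[of 1])
  fix n assume n: "1 \<le> (n::nat)"
  from AE_ge_c[OF c, of n]
  show "AE \<omega> in M. \<forall>i<K - 1. vec_index (sbar K p n (obs \<omega>)) i = rank_average i n \<omega> / rank_average (K - 1) n \<omega>"
  proof eventually_elim
    case (elim \<omega>)
    have "(\<Sum>i=1..n. Y i \<omega>) > 0" using elim n by (intro sum_pos) auto
    then show ?case using sbar_eq[where n=n and \<omega>=\<omega>] n by simp
  qed
qed

definition share_dev :: "nat \<Rightarrow> nat \<Rightarrow> 'a \<Rightarrow> real" where
  "share_dev i n \<omega> = sqrt (real n) * (vec_index (sbar K p n (obs \<omega>)) i - share_ratio i \<alpha>\<^sub>0)"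

definition share_lin :: "nat \<Rightarrow> nat \<Rightarrow> 'a \<Rightarrow> real" where
  "share_lin i n \<omega> = (psi_sum i n \<omega> - share_ratio i \<alpha>\<^sub>0 * psi_sum (K - 1) n \<omega>) / mu_k c p \<alpha>\<^sub>0 K"

text \<open>
  The first-order expansion of the quotient \<open>D / D'\<close> at \<open>m / \<mu>\<close>, with an exact remainder: in the first
  summand on the right \<open>v - w\<close> is small, in the second the linear approximations of \<open>D\<close> and \<open>D'\<close> are
  accurate.
\<close>

lemma ratio_expansion:
  fixes s :: real
  assumes v: "D' * v = 1" and w: "\<mu> * w = 1"
  shows "s * (D * v - m * w) - (L - m * w * L') * w =
      (v - w) * (s * (D - m) + (- (m * w)) * (s * (D' - \<mu>)))
      + (w * (s * (D - m) - L) - (w * (m * w)) * (s * (D' - \<mu>) - L'))"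
proof -
  have "(v - w) * (s * (D - m) + (- (m * w)) * (s * (D' - \<mu>)))
      + (w * (s * (D - m) - L) - (w * (m * w)) * (s * (D' - \<mu>) - L')) =
    v * s * D - v * s * m - m * w * s * (D' * v) + m * s * v * (\<mu> * w) - w * L + w * m * w * L'"
    by (simp add: algebra_simps)
  then show ?thesis unfolding v w by (simp add: algebra_simps)
qed

lemma share_dev_linear:
  assumes i: "i < K - 1"
  shows "vanishes_in_prob (\<lambda>n \<omega>. share_dev i n \<omega> - share_lin i n \<omega>)"
proof -
  let ?\<mu> = "mu_k c p \<alpha>\<^sub>0 K" and ?r = "share_ratio i \<alpha>\<^sub>0"
  have \<mu>: "?\<mu> > 0" by (rule mu_K_pos[OF \<alpha>\<^sub>0])
  have iK: "i < K" "K - 1 < K" using i by auto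
  have mu0K: "mu0 (K - 1) = ?\<mu>" using K by simp
  let ?X = "\<lambda>i n \<omega>. sqrt (real n) * (rank_average i n \<omega> - mu0 i)"
  let ?rhs = "\<lambda>n \<omega>. (inverse (rank_average (K - 1) n \<omega>) - inverse ?\<mu>) * (?X i n \<omega> + (- ?r) * ?X (K - 1) n \<omega>)
      + (inverse ?\<mu> * (?X i n \<omega> - psi_sum i n \<omega>) - (inverse ?\<mu> * ?r) * (?X (K - 1) n \<omega> - psi_sum (K - 1) n \<omega>))"
  have Xb: "bounded_in_prob (?X i)" if "i < K" for i
    by (rule bounded_in_prob_of_diff[OF rank_average_linear psi_sum_bounded]) (use that in auto)
  have DK: "vanishes_in_prob (\<lambda>n \<omega>. rank_average (K - 1) n \<omega> - ?\<mu>)"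
  proof (rule vanishes_cong)
    show "vanishes_in_prob (\<lambda>n \<omega>. (1 / sqrt (real n)) * ?X (K - 1) n \<omega>)"
      by (rule vanishes_mult_bounded[OF vanishes_const[OF lim_const_over_sqrt] Xb[OF iK(2)]])
    show "whp (\<lambda>n \<omega>. rank_average (K - 1) n \<omega> - ?\<mu> = (1 / sqrt (real n)) * ?X (K - 1) n \<omega>)"
      unfolding mu0K by (rule whp_eventually, rule eventually_sequentiallyI[of 1]) simp
  qed
  have "whp (\<lambda>n \<omega>. \<bar>rank_average (K - 1) n \<omega> - ?\<mu>\<bar> \<le> ?\<mu> / 2)" using \<mu> by (intro vanishesD[OF DK]) simp
  then have "whp (\<lambda>n \<omega>. \<bar>rank_average (K - 1) n \<omega> - ?\<mu>\<bar> \<le> ?\<mu> / 2 \<and>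
      (\<forall>i<K - 1. vec_index (sbar K p n (obs \<omega>)) i = rank_average i n \<omega> / rank_average (K - 1) n \<omega>))"
    by (rule whp_conj[OF _ whp_sbar_eq])
  then have eq: "whp (\<lambda>n \<omega>. share_dev i n \<omega> - share_lin i n \<omega> = ?rhs n \<omega>)"
  proof (rule whp_mono, intro always_eventually allI ballI impI)
    fix n \<omega>
    assume *: "\<bar>rank_average (K - 1) n \<omega> - ?\<mu>\<bar> \<le> ?\<mu> / 2 \<and>
      (\<forall>i<K - 1. vec_index (sbar K p n (obs \<omega>)) i = rank_average i n \<omega> / rank_average (K - 1) n \<omega>)"
    have "rank_average (K - 1) n \<omega> \<noteq> 0" using conjunct1[OF *] \<mu> by linarith
    then have v: "rank_average (K - 1) n \<omega> * inverse (rank_average (K - 1) n \<omega>) = 1" by (rule right_inverse)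
    have w: "?\<mu> * inverse ?\<mu> = 1" using \<mu> by (intro right_inverse) linarith
    have q: "vec_index (sbar K p n (obs \<omega>)) i = rank_average i n \<omega> / rank_average (K - 1) n \<omega>"
      using conjunct2[OF *] i by blast
    have z: "share_dev i n \<omega> = sqrt (real n) * (rank_average i n \<omega> * inverse (rank_average (K - 1) n \<omega>) - mu0 i * inverse ?\<mu>)"
      unfolding share_dev_def share_ratio_def q divide_inverse ..
    have l: "share_lin i n \<omega> = (psi_sum i n \<omega> - mu0 i * inverse ?\<mu> * psi_sum (K - 1) n \<omega>) * inverse ?\<mu>"
      unfolding share_lin_def share_ratio_def divide_inverse ..
    have r: "?r = mu0 i * inverse ?\<mu>" unfolding share_ratio_def divide_inverse ..
    show "share_dev i n \<omega> - share_lin i n \<omega> = ?rhs n \<omega>"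
      unfolding z l r mu0K by (rule ratio_expansion[OF v w])
  qed
  show ?thesis
  proof (rule vanishes_cong[OF _ eq])
    have "?\<mu> \<noteq> 0" using \<mu> by simp
    show "vanishes_in_prob ?rhs"
      by (rule vanishes_add[OF vanishes_mult_bounded[OF vanishes_inverse[OF DK \<open>?\<mu> \<noteq> 0\<close>]
          bounded_in_prob_add[OF Xb[OF iK(1)] bounded_in_prob_cmult[OF Xb[OF iK(2)]]]]
          vanishes_diff[OF vanishes_cmult[OF rank_average_linear[OF iK(1)]] vanishes_cmult[OF rank_average_linear[OF iK(2)]]]])
  qed
qed

lemma share_lin_bounded: "i < K - 1 \<Longrightarrow> bounded_in_prob (share_lin i)"
  using bounded_in_prob_cmult[OF bounded_in_prob_add[OF psi_sum_bounded[of i]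
      bounded_in_prob_cmult[OF psi_sum_bounded[of "K - 1"], of "- share_ratio i \<alpha>\<^sub>0"]], of "1 / mu_k c p \<alpha>\<^sub>0 K"]
  by (simp add: share_lin_def[abs_def])

lemma share_dev_bounded: "i < K - 1 \<Longrightarrow> bounded_in_prob (share_dev i)"
  by (rule bounded_in_prob_of_diff[OF share_dev_linear share_lin_bounded])

lemma sum_share_lin:
  "(\<Sum>i<K - 1. x i * share_lin i n \<omega>) = (\<Sum>j=1..n. \<Sum>k<K. band_weights \<alpha>\<^sub>0 x k * (psi k (Y j \<omega>) - kband_mean \<alpha>\<^sub>0 k)) / sqrt (real n)"
proof -
  have L: "psi_sum k n \<omega> = (\<Sum>j=1..n. psi k (Y j \<omega>) - kband_mean \<alpha>\<^sub>0 k) / sqrt (real n)" for k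
    by (simp add: psi_sum_def sum_subtractf)
  have KS: "{..<K} = insert (K - 1) {..<K - 1}" using K by auto
  have "(\<Sum>k<K. band_weights \<alpha>\<^sub>0 x k * psi_sum k n \<omega>) =
      (\<Sum>k<K-1. x k * psi_sum k n \<omega> / mu_k c p \<alpha>\<^sub>0 K) - (\<Sum>i<K-1. x i * share_ratio i \<alpha>\<^sub>0) / mu_k c p \<alpha>\<^sub>0 K * psi_sum (K - 1) n \<omega>"
    unfolding KS by (subst sum.insert) (auto simp: band_weights_def intro!: sum.cong)
  also have "\<dots> = (\<Sum>i<K-1. x i * psi_sum i n \<omega> / mu_k c p \<alpha>\<^sub>0 K
      - x i * share_ratio i \<alpha>\<^sub>0 * (psi_sum (K - 1) n \<omega> / mu_k c p \<alpha>\<^sub>0 K))"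
    unfolding sum_subtractf sum_distrib_right[symmetric] by simp
  also have "\<dots> = (\<Sum>i<K - 1. x i * share_lin i n \<omega>)"
    unfolding share_lin_def by (intro sum.cong refl) (simp add: diff_divide_distrib right_diff_distrib)
  finally have "(\<Sum>i<K - 1. x i * share_lin i n \<omega>) = (\<Sum>k<K. band_weights \<alpha>\<^sub>0 x k * psi_sum k n \<omega>)" ..
  also have "\<dots> = (\<Sum>k<K. \<Sum>j=1..n. band_weights \<alpha>\<^sub>0 x k * (psi k (Y j \<omega>) - kband_mean \<alpha>\<^sub>0 k)) / sqrt (real n)"
    unfolding L by (simp add: sum_distrib_left sum_divide_distrib)
  also have "(\<Sum>k<K. \<Sum>j=1..n. band_weights \<alpha>\<^sub>0 x k * (psi k (Y j \<omega>) - kband_mean \<alpha>\<^sub>0 k)) =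
    (\<Sum>j=1..n. \<Sum>k<K. band_weights \<alpha>\<^sub>0 x k * (psi k (Y j \<omega>) - kband_mean \<alpha>\<^sub>0 k))" by (rule sum.swap)
  finally show ?thesis .
qed

text \<open>
  The linear part is a normalized sum of bounded independent variables with mean \<open>0\<close>, whose variance is
  the form of \<open>\<Sigma>\<close> at \<open>H\<^sup>T x\<close>, that is, the form of \<open>\<Omega>\<close> at \<open>x\<close>.
\<close>

lemma asymptotic_normality_of_linear:
  assumes est: "\<And>n. est n \<in> borel_measurable M" and x: "x \<in> carrier_vec (K - 1)" "x \<noteq> 0\<^sub>v (K - 1)"
    and lin: "vanishes_in_prob (\<lambda>n \<omega>. sqrt (real n) * (est n \<omega> - \<alpha>\<^sub>0) - (\<Sum>i<K - 1. vec_index x i * share_dev i n \<omega>))"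
  shows "has_asymptotic_variance M \<alpha>\<^sub>0 est (scalar_prod x (Omega c K p \<alpha>\<^sub>0 *\<^sub>v x))"
proof -
  let ?v = "scalar_prod x (Omega c K p \<alpha>\<^sub>0 *\<^sub>v x)" and ?w = "band_weights \<alpha>\<^sub>0 (vec_index x)"
  let ?g = "\<lambda>y. \<Sum>k<K. ?w k * (psi k y - kband_mean \<alpha>\<^sub>0 k)"
  have v: "?v > 0" using pos_def_matD(3)[OF pos_def_Omega[OF \<alpha>\<^sub>0] x] .
  let ?Z = "\<lambda>n \<omega>. (\<Sum>j=1..n. ?g (Y j \<omega>)) / sqrt (real n)"
  have g[measurable]: "?g \<in> borel_measurable borel" by measurable
  have "weak_conv_m (\<lambda>n. distr M borel (?Z n)) (normal_distribution 0 ?v)"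
  proof (rule clt_bounded_function[OF indep distr_Y g])
    fix y
    have "\<bar>?g y\<bar> \<le> (\<Sum>k<K. \<bar>?w k * (psi k y - kband_mean \<alpha>\<^sub>0 k)\<bar>)" by (rule sum_abs)
    also have "\<dots> \<le> (\<Sum>k<K. \<bar>?w k\<bar> * (quant (k + 1) - quant (k + 2) + \<bar>kband_mean \<alpha>\<^sub>0 k\<bar>))"
      unfolding abs_mult
    proof (intro sum_mono mult_left_mono)
      fix k assume "k \<in> {..<K}"
      then have "k < K" by simp
      from psi_bound[OF this, of y]
      show "\<bar>psi k y - kband_mean \<alpha>\<^sub>0 k\<bar> \<le> quant (k + 1) - quant (k + 2) + \<bar>kband_mean \<alpha>\<^sub>0 k\<bar>"
        by linarith
    qed simp
    finally show "\<bar>?g y\<bar> \<le> (\<Sum>k<K. \<bar>?w k\<bar> * (quant (k + 1) - quant (k + 2) + \<bar>kband_mean \<alpha>\<^sub>0 k\<bar>))" .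
  next
    show "(LINT y|law. ?g y) = 0" by (rule mean_centered_psi)
    show "(LINT y|law. (?g y)\<^sup>2) = ?v" unfolding variance_psi Omega_qform[OF \<alpha>\<^sub>0 x(1)] ..
  qed (use v in auto)
  then show ?thesis
    unfolding has_asymptotic_variance_def
  proof (rule weak_conv_vanishing_diff[rotated 3])
    show "real_distribution (normal_distribution 0 ?v)" by (rule real_distribution_normal[OF v])
    show "(\<lambda>\<omega>. sqrt (real n) * (est n \<omega> - \<alpha>\<^sub>0)) \<in> borel_measurable M" for n using est by measurable
    have [measurable]: "Y j \<in> borel_measurable M" if "j \<in> {1..n}" for j n using that by (intro measurable_Y) simp
    show "?Z n \<in> borel_measurable M" for n by (intro borel_measurable_divide borel_measurable_sum measurable_compose[OF measurable_Y g]) auto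
    have "vanishes_in_prob (\<lambda>n \<omega>. \<Sum>i<K - 1. vec_index x i * (share_dev i n \<omega> - share_lin i n \<omega>))"
      by (intro vanishes_sum vanishes_cmult share_dev_linear) simp
    moreover have "sqrt (real n) * (est n \<omega> - \<alpha>\<^sub>0) - ?Z n \<omega> =
        sqrt (real n) * (est n \<omega> - \<alpha>\<^sub>0) - (\<Sum>i<K - 1. vec_index x i * share_dev i n \<omega>)
        + (\<Sum>i<K - 1. vec_index x i * (share_dev i n \<omega> - share_lin i n \<omega>))" for n \<omega>
      unfolding sum_share_lin[symmetric] by (simp add: right_diff_distrib sum_subtractf)
    ultimately show "vanishes_in_prob (\<lambda>n \<omega>. sqrt (real n) * (est n \<omega> - \<alpha>\<^sub>0) - ?Z n \<omega>)"
      using vanishes_add[OF lin] by (simp only:)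
  qed
qed

end

section \<open>Asymptotics of minimum distance estimators\<close>

context pareto_sample
begin

abbreviation Rv :: "real Matrix.vec" where "Rv \<equiv> R_vec c K p \<alpha>\<^sub>0"

text \<open>
  The coefficients of \<open>z\<close> in \<open>R\<^sup>T W z / (R\<^sup>T W R)\<close>, to which the rescaled estimator is asymptotically equal.
\<close>

definition influence :: "real mat \<Rightarrow> real Matrix.vec" where
  "influence W = inverse (scalar_prod Rv (W *\<^sub>v Rv)) \<cdot>\<^sub>v (W *\<^sub>v Rv)"

lemma R_form_pos: "pos_def_mat (K - 1) W \<Longrightarrow> 0 < scalar_prod Rv (W *\<^sub>v Rv)"
  by (rule pos_def_matD(3)[OF _ R_vec_carrier R_vec_nonzero[OF \<alpha>\<^sub>0]])

lemma influence_carrier: "pos_def_mat (K - 1) W \<Longrightarrow> influence W \<in> carrier_vec (K - 1)"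
  using pos_def_matD(1)[of "K - 1" W] R_vec_carrier by (auto simp: influence_def)

lemma influence_nonzero: assumes W: "pos_def_mat (K - 1) W" shows "influence W \<noteq> 0\<^sub>v (K - 1)"
proof
  assume "influence W = 0\<^sub>v (K - 1)"
  then have "scalar_prod Rv (influence W) = 0" using R_vec_carrier by simp
  moreover have "scalar_prod Rv (influence W) = 1"
    using R_form_pos[OF W] pos_def_matD(1)[OF W] R_vec_carrier[of \<alpha>\<^sub>0] by (simp add: influence_def)
  ultimately show False by simp
qed

lemma influence_variance:
  assumes W: "pos_def_mat (K - 1) W"
  shows "scalar_prod (influence W) (Omega c K p \<alpha>\<^sub>0 *\<^sub>v influence W) = cmd_variance c K p \<alpha>\<^sub>0 W"
proof -
  note Wc = pos_def_matD(1)[OF W] and O = Omega_carrier[of \<alpha>\<^sub>0] and R = R_vec_carrier[of \<alpha>\<^sub>0]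
  let ?O = "Omega c K p \<alpha>\<^sub>0" and ?x = "W *\<^sub>v Rv"
  have x: "?x \<in> carrier_vec (K - 1)" using Wc R by simp
  have Ox: "?O *\<^sub>v ?x \<in> carrier_vec (K - 1)" using O x by simp
  have "(W * ?O * W) *\<^sub>v Rv = W *\<^sub>v (?O *\<^sub>v ?x)"
  proof -
    have "W * ?O \<in> carrier_mat (K - 1) (K - 1)" using Wc O by simp
    from assoc_mult_mat_vec[OF this Wc R] show ?thesis unfolding assoc_mult_mat_vec[OF Wc O x] .
  qed
  then have "scalar_prod Rv ((W * ?O * W) *\<^sub>v Rv) = scalar_prod ?x (?O *\<^sub>v ?x)"
    using scalar_prod_transpose[OF Wc R Ox] pos_def_matD(2)[OF W] by simp
  moreover have "scalar_prod (influence W) (?O *\<^sub>v influence W) =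
      inverse (scalar_prod Rv ?x) * scalar_prod ?x (?O *\<^sub>v ?x) * inverse (scalar_prod Rv ?x)"
    unfolding influence_def using mult_mat_vec[OF O x] x Ox by simp
  ultimately show ?thesis by (simp add: cmd_variance_def Let_def)
qed

text \<open>
  Put \<open>x = W R\<close> and \<open>y = \<Omega>\<^sup>-\<^sup>1 R\<close>, so that \<open>x\<^sup>T \<Omega> y = R\<^sup>T W R\<close> and \<open>y\<^sup>T \<Omega> y = R\<^sup>T \<Omega>\<^sup>-\<^sup>1 R\<close>.
\<close>

lemma
  assumes W: "pos_def_mat (K - 1) W"
  shows cmd_variance_ge: "cumd_variance c K p \<alpha>\<^sub>0 \<le> cmd_variance c K p \<alpha>\<^sub>0 W"
    and cmd_variance_inv: "cmd_variance c K p \<alpha>\<^sub>0 (inv_mat (Omega c K p \<alpha>\<^sub>0)) = cumd_variance c K p \<alpha>\<^sub>0"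
proof -
  let ?O = "Omega c K p \<alpha>\<^sub>0"
  note PO = pos_def_Omega[OF \<alpha>\<^sub>0] and O = Omega_carrier[of \<alpha>\<^sub>0] and R = R_vec_carrier[of \<alpha>\<^sub>0]
  note B = inv_mat[OF O pos_def_det[OF PO]] and PB = pos_def_inv[OF PO]
  let ?y = "inv_mat ?O *\<^sub>v Rv"
  have y: "?y \<in> carrier_vec (K - 1)" using B R by simp
  have Oy: "?O *\<^sub>v ?y = Rv" using assoc_mult_mat_vec[OF O B(1) R] B(2) R by simp
  have var: "cmd_variance c K p \<alpha>\<^sub>0 V = scalar_prod (V *\<^sub>v Rv) (?O *\<^sub>v (V *\<^sub>v Rv)) / (scalar_prod Rv (V *\<^sub>v Rv))\<^sup>2"
    if V: "pos_def_mat (K - 1) V" for V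
  proof -
    have x: "V *\<^sub>v Rv \<in> carrier_vec (K - 1)" using pos_def_matD(1)[OF V] R by simp
    have Ox: "?O *\<^sub>v (V *\<^sub>v Rv) \<in> carrier_vec (K - 1)" using O x by simp
    show ?thesis
      unfolding influence_variance[OF V, symmetric] influence_def
      using mult_mat_vec[OF O x] x Ox by (simp add: power2_eq_square divide_inverse)
  qed
  have yR: "scalar_prod ?y Rv = scalar_prod Rv ?y" by (rule comm_scalar_prod[OF y R])
  have e: "scalar_prod Rv ?y > 0" by (rule R_form_pos[OF PB])
  show "cmd_variance c K p \<alpha>\<^sub>0 (inv_mat ?O) = cumd_variance c K p \<alpha>\<^sub>0"
    unfolding var[OF PB] Oy yR using e by (simp add: cumd_variance_def Let_def power2_eq_square divide_inverse)
  let ?x = "W *\<^sub>v Rv"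
  have x: "?x \<in> carrier_vec (K - 1)" using pos_def_matD(1)[OF W] R by simp
  have a: "scalar_prod Rv ?x > 0" by (rule R_form_pos[OF W])
  have "(scalar_prod ?x Rv)\<^sup>2 \<le> scalar_prod ?x (?O *\<^sub>v ?x) * scalar_prod ?y Rv"
    using pos_def_cauchy_schwarz[OF PO x y] unfolding Oy .
  then have "(scalar_prod Rv ?x)\<^sup>2 \<le> scalar_prod ?x (?O *\<^sub>v ?x) * scalar_prod Rv ?y"
    unfolding yR comm_scalar_prod[OF x R] .
  then have "inverse (scalar_prod Rv ?y) \<le> scalar_prod ?x (?O *\<^sub>v ?x) / (scalar_prod Rv ?x)\<^sup>2"
    using a e by (simp add: field_simps)
  then show "cumd_variance c K p \<alpha>\<^sub>0 \<le> cmd_variance c K p \<alpha>\<^sub>0 W"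
    unfolding var[OF W] by (simp add: cumd_variance_def Let_def)
qed

lemma md_criterion_eq_qform:
  assumes "W \<in> carrier_mat (K - 1) (K - 1)"
  shows "md_criterion c K p W (sbar K p n y) \<alpha> =
    qform (K - 1) (\<lambda>i j. W $$ (i, j)) (\<lambda>i. share_ratio i \<alpha> - vec_index (sbar K p n y) i)"
proof -
  have d: "r_vec c K p \<alpha> - sbar K p n y \<in> carrier_vec (K - 1)" by (simp add: r_vec_def sbar_def)
  show ?thesis unfolding md_criterion_def scalar_prod_eq_qform[OF assms d]
  proof (rule qform_cong)
    fix i assume i: "i < K - 1"
    show "vec_index (r_vec c K p \<alpha> - sbar K p n y) i = share_ratio i \<alpha> - vec_index (sbar K p n y) i"
      using i r_vec_index[OF i, of \<alpha>] by (simp add: sbar_def)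
  qed
qed

lemma min_dist_at_argmin:
  assumes arg: "is_arg_min (\<lambda>\<alpha>. md_criterion c K p (V \<alpha>) (sbar K p n y) \<alpha>) (\<lambda>\<alpha>. \<alpha> \<in> A) a"
    and car: "\<And>\<alpha>. \<alpha> \<in> A \<Longrightarrow> V \<alpha> \<in> carrier_mat (K - 1) (K - 1)"
    and close: "\<And>\<alpha> i j. \<alpha> \<in> A \<Longrightarrow> i < K - 1 \<Longrightarrow> j < K - 1 \<Longrightarrow> \<bar>V \<alpha> $$ (i, j) - G \<alpha> i j\<bar> \<le> \<delta>"
    and lower: "\<And>\<alpha> x. \<alpha> \<in> A \<Longrightarrow> \<kappa> * (\<Sum>i<K - 1. (x i)\<^sup>2) \<le> qform (K - 1) (\<lambda>i j. V \<alpha> $$ (i, j)) x"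
  shows "min_dist_at (K - 1) share_ratio G A \<kappa> \<delta> (vec_index (sbar K p n y)) (\<lambda>\<alpha> i j. V \<alpha> $$ (i, j)) a"
proof -
  have a: "a \<in> A" using arg by (simp add: is_arg_min_def)
  have "md_criterion c K p (V a) (sbar K p n y) a \<le> md_criterion c K p (V \<alpha>) (sbar K p n y) \<alpha>" if "\<alpha> \<in> A" for \<alpha>
    using arg that by (auto simp: is_arg_min_def not_less)
  then show ?thesis
    using a close lower car unfolding min_dist_at_def by (simp only: md_criterion_eq_qform) blast
qed

text \<open>
  Covers both kinds of estimators: constant \<open>G\<close> and random weights \<open>V\<close> near \<open>G\<close> for given weighting
  matrices, and \<open>V = G = \<Omega>\<^sup>-\<^sup>1\<close> for the continuously updated estimator.
\<close>

lemma minimum_distance_normality: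
  fixes est :: "nat \<Rightarrow> 'a \<Rightarrow> real" and G :: "real \<Rightarrow> real mat"
  assumes A: "A \<subseteq> {1<..}" "compact A" and int: "\<alpha>\<^sub>0 \<in> interior A"
    and G: "\<And>i j. i < K - 1 \<Longrightarrow> j < K - 1 \<Longrightarrow> isCont (\<lambda>\<alpha>. G \<alpha> $$ (i, j)) \<alpha>\<^sub>0"
    and W: "pos_def_mat (K - 1) (G \<alpha>\<^sub>0)" and \<kappa>: "\<kappa> > 0"
    and meas: "\<And>n. est n \<in> borel_measurable M"
    and min: "\<And>\<delta>. \<delta> > 0 \<Longrightarrow> whp (\<lambda>n \<omega>. \<exists>V. min_dist_at (K - 1) share_ratio (\<lambda>\<alpha> i j. G \<alpha> $$ (i, j)) A \<kappa> \<delta>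
      (vec_index (sbar K p n (obs \<omega>))) V (est n \<omega>))"
  shows "has_asymptotic_variance M \<alpha>\<^sub>0 est (cmd_variance c K p \<alpha>\<^sub>0 (G \<alpha>\<^sub>0))"
  unfolding influence_variance[OF W, symmetric]
proof (rule asymptotic_normality_of_linear[OF meas influence_carrier[OF W] influence_nonzero[OF W]])
  let ?d = "K - 1"
  let ?G = "\<lambda>\<alpha> i j. G \<alpha> $$ (i, j)"
  let ?R = "vec_index Rv"
  note Wc = pos_def_matD(1)[OF W] and R = R_vec_carrier[of \<alpha>\<^sub>0]
  have d: "?d > 0" using K by simp
  have \<alpha>\<^sub>0A: "\<alpha>\<^sub>0 \<in> A" using int interior_subset by blast
  obtain C where C: "\<And>\<alpha>. \<alpha> \<in> A \<Longrightarrow> \<bar>\<alpha> - \<alpha>\<^sub>0\<bar> \<le> C * \<bar>share_ratio 0 \<alpha> - share_ratio 0 \<alpha>\<^sub>0\<bar>"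
    using share_ratio_rate[OF A \<alpha>\<^sub>0A] by blast
  have form: "scalar_prod Rv (G \<alpha>\<^sub>0 *\<^sub>v Rv) = qform ?d (?G \<alpha>\<^sub>0) ?R"
    by (rule scalar_prod_eq_qform[OF Wc R])
  have infl: "vec_index (influence (G \<alpha>\<^sub>0)) i = (\<Sum>j<?d. ?G \<alpha>\<^sub>0 i j * ?R j) / qform ?d (?G \<alpha>\<^sub>0) ?R" if "i < ?d" for i
    using that Wc R unfolding influence_def form
    by (simp add: scalar_prod_def lessThan_atLeast0 divide_inverse mult.commute)
  show "vanishes_in_prob (\<lambda>n \<omega>. sqrt (real n) * (est n \<omega> - \<alpha>\<^sub>0) - (\<Sum>i<?d. vec_index (influence (G \<alpha>\<^sub>0)) i * share_dev i n \<omega>))"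
    unfolding vanishes_in_prob_def
  proof (intro allI impI)
    fix \<epsilon> :: real assume \<epsilon>: "\<epsilon> > 0"
    have "bounded_in_prob (\<lambda>n \<omega>. \<Sum>i<?d. \<bar>share_dev i n \<omega>\<bar>)"
      by (intro bounded_in_prob_sum bounded_in_prob_abs share_dev_bounded) simp
    then show "whp (\<lambda>n \<omega>. \<bar>sqrt (real n) * (est n \<omega> - \<alpha>\<^sub>0)
        - (\<Sum>i<?d. vec_index (influence (G \<alpha>\<^sub>0)) i * share_dev i n \<omega>)\<bar> \<le> \<epsilon>)"
    proof (rule whp_of_bounded)
      fix B :: real
      have "\<exists>\<delta>>0. \<exists>N. \<forall>n\<ge>N. \<forall>s V a.
        (\<forall>i<?d. \<bar>sqrt (real n) * (s i - share_ratio i \<alpha>\<^sub>0)\<bar> \<le> B) \<longrightarrow> min_dist_at ?d share_ratio ?G A \<kappa> \<delta> s V a \<longrightarrow>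
        \<bar>sqrt (real n) * (a - \<alpha>\<^sub>0) - (\<Sum>i<?d. (\<Sum>j<?d. ?G \<alpha>\<^sub>0 i j * ?R j) / qform ?d (?G \<alpha>\<^sub>0) ?R
          * (sqrt (real n) * (s i - share_ratio i \<alpha>\<^sub>0)))\<bar> \<le> \<epsilon>" (is "\<exists>\<delta>>0. \<exists>N. ?key \<delta> N")
      proof (rule argmin_expansion[where r=share_ratio and R="?R" and G="?G" and C=C and \<kappa>=\<kappa>])
        show "0 < ?d" "\<alpha>\<^sub>0 \<in> interior A" "0 < \<epsilon>" "0 < \<kappa>" by fact+
        show "\<bar>\<alpha> - \<alpha>\<^sub>0\<bar> \<le> C * \<bar>share_ratio 0 \<alpha> - share_ratio 0 \<alpha>\<^sub>0\<bar>" if "\<alpha> \<in> A" for \<alpha> by (rule C[OF that])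
        show "isCont (\<lambda>\<alpha>. ?G \<alpha> i j) \<alpha>\<^sub>0" if "i < ?d" "j < ?d" for i j by (rule G[OF that])
        show "(share_ratio i has_real_derivative ?R i) (at \<alpha>\<^sub>0)" if "i < ?d" for i
          using DERIV_share_ratio[OF that \<alpha>\<^sub>0] R_vec_index[OF that \<alpha>\<^sub>0] by simp
        show "?G \<alpha>\<^sub>0 i j = ?G \<alpha>\<^sub>0 j i" if "i < ?d" "j < ?d" for i j by (rule pos_def_matD(4)[OF W that])
        show "qform ?d (?G \<alpha>\<^sub>0) ?R > 0" using R_form_pos[OF W] unfolding form .
      qed
      then obtain \<delta> N where \<delta>: "\<delta> > 0" and key: "?key \<delta> N" by blast
      show "whp (\<lambda>n \<omega>. \<bar>\<Sum>i<?d. \<bar>share_dev i n \<omega>\<bar>\<bar> \<le> B \<longrightarrow> \<bar>sqrt (real n) * (est n \<omega> - \<alpha>\<^sub>0)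
        - (\<Sum>i<?d. vec_index (influence (G \<alpha>\<^sub>0)) i * share_dev i n \<omega>)\<bar> \<le> \<epsilon>)"
      proof (rule whp_mono[OF min[OF \<delta>]], rule eventually_sequentiallyI[of N], intro ballI impI, elim exE)
        fix n \<omega> V
        let ?s = "vec_index (sbar K p n (obs \<omega>))"
        assume n: "N \<le> n" and V: "min_dist_at ?d share_ratio ?G A \<kappa> \<delta> ?s V (est n \<omega>)"
          and B: "\<bar>\<Sum>i<?d. \<bar>share_dev i n \<omega>\<bar>\<bar> \<le> B"
        have zB: "\<forall>i<?d. \<bar>sqrt (real n) * (?s i - share_ratio i \<alpha>\<^sub>0)\<bar> \<le> B"
        proof (intro allI impI)
          fix i assume "i < ?d"
          then have "\<bar>share_dev i n \<omega>\<bar> \<le> (\<Sum>i<?d. \<bar>share_dev i n \<omega>\<bar>)" by (intro member_le_sum) auto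
          then show "\<bar>sqrt (real n) * (?s i - share_ratio i \<alpha>\<^sub>0)\<bar> \<le> B" using B unfolding share_dev_def by linarith
        qed
        have "(\<Sum>i<?d. vec_index (influence (G \<alpha>\<^sub>0)) i * share_dev i n \<omega>) =
          (\<Sum>i<?d. (\<Sum>j<?d. ?G \<alpha>\<^sub>0 i j * ?R j) / qform ?d (?G \<alpha>\<^sub>0) ?R * (sqrt (real n) * (?s i - share_ratio i \<alpha>\<^sub>0)))"
          unfolding share_dev_def by (intro sum.cong refl) (simp add: infl)
        then show "\<bar>sqrt (real n) * (est n \<omega> - \<alpha>\<^sub>0) - (\<Sum>i<?d. vec_index (influence (G \<alpha>\<^sub>0)) i * share_dev i n \<omega>)\<bar> \<le> \<epsilon>"
          using key n zB V by (simp only:)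
      qed
    qed
  qed
qed

text \<open>
  On the compact set \<open>A\<close> the entries of \<open>\<Omega>\<close> are bounded, so \<open>\<Omega>\<^sup>-\<^sup>1\<close> is bounded below by
  \<open>inverse_qform_lower\<close>.
\<close>

lemma cumde_normality:
  assumes A: "A \<subseteq> {1<..}" "compact A" and int: "\<alpha>\<^sub>0 \<in> interior A"
    and est: "cumd_estimator M Y c K p A est"
  shows "has_asymptotic_variance M \<alpha>\<^sub>0 est (cumd_variance c K p \<alpha>\<^sub>0)"
proof -
  let ?d = "K - 1"
  let ?G = "\<lambda>\<alpha>. inv_mat (Omega c K p \<alpha>)"
  have A1: "\<alpha> > 1" if "\<alpha> \<in> A" for \<alpha> using A that by auto
  have "\<exists>b. \<forall>\<alpha>\<in>A. \<bar>Omega c K p \<alpha> $$ (i, j)\<bar> \<le> b" if "i < ?d" "j < ?d" for i j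
  proof -
    have "continuous_on A (\<lambda>\<alpha>. Omega c K p \<alpha> $$ (i, j))"
      using isCont_Omega[OF that] A1 by (intro continuous_at_imp_continuous_on) auto
    then have "bounded ((\<lambda>\<alpha>. Omega c K p \<alpha> $$ (i, j)) ` A)"
      using compact_continuous_image[OF _ A(2)] compact_imp_bounded by blast
    then show ?thesis unfolding bounded_iff by auto
  qed
  then obtain b where b: "\<And>i j \<alpha>. i < ?d \<Longrightarrow> j < ?d \<Longrightarrow> \<alpha> \<in> A \<Longrightarrow> \<bar>Omega c K p \<alpha> $$ (i, j)\<bar> \<le> b i j"
    by metis
  define U where "U = (\<Sum>i<?d. \<Sum>j<?d. \<bar>b i j\<bar>) + 1"
  have U0: "U > 0" unfolding U_def by (intro add_nonneg_pos sum_nonneg) auto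
  have U: "\<bar>Omega c K p \<alpha> $$ (i, j)\<bar> \<le> U" if "i < ?d" "j < ?d" "\<alpha> \<in> A" for i j \<alpha>
    using b[OF that] entry_le_sum[OF that(1,2), of b] by (simp add: U_def)
  have "has_asymptotic_variance M \<alpha>\<^sub>0 est (cmd_variance c K p \<alpha>\<^sub>0 (?G \<alpha>\<^sub>0))"
  proof (rule minimum_distance_normality[OF A int, where \<kappa>="1 / (U * (real ?d)\<^sup>2 + 1)"])
    fix i j assume ij: "i < ?d" "j < ?d"
    show "isCont (\<lambda>\<alpha>. ?G \<alpha> $$ (i, j)) \<alpha>\<^sub>0"
    proof (rule continuous_inv_mat[OF Omega_carrier _ _ ij])
      have "\<forall>\<^sub>F \<alpha> in nhds \<alpha>\<^sub>0. \<alpha> \<in> {1<..}" using \<alpha>\<^sub>0 by (intro eventually_nhds_in_open) auto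
      then show "\<forall>\<^sub>F \<alpha> in nhds \<alpha>\<^sub>0. Determinant.det (Omega c K p \<alpha>) \<noteq> 0"
        by eventually_elim (use pos_def_det[OF pos_def_Omega] in auto)
    qed (rule isCont_Omega[OF _ _ \<alpha>\<^sub>0])
  next
    show "pos_def_mat ?d (?G \<alpha>\<^sub>0)" by (rule pos_def_inv[OF pos_def_Omega[OF \<alpha>\<^sub>0]])
    show "0 < 1 / (U * (real ?d)\<^sup>2 + 1)" using U0 by (simp add: add_nonneg_pos)
    show "est n \<in> borel_measurable M" for n using est by (simp add: cumd_estimator_def)
    have arg: "\<forall>\<^sub>F n in sequentially. AE \<omega> in M.
      is_arg_min (\<lambda>\<alpha>. md_criterion c K p (?G \<alpha>) (sbar K p n (obs \<omega>)) \<alpha>) (\<lambda>\<alpha>. \<alpha> \<in> A) (est n \<omega>)"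
      using est by (simp add: cumd_estimator_def)
    show "whp (\<lambda>n \<omega>. \<exists>V. min_dist_at ?d share_ratio (\<lambda>\<alpha> i j. ?G \<alpha> $$ (i, j)) A (1 / (U * (real ?d)\<^sup>2 + 1)) \<delta>
      (vec_index (sbar K p n (obs \<omega>))) V (est n \<omega>))" if "\<delta> > 0" for \<delta>
    proof (rule whp_mono[OF whp_AE[OF arg]], intro always_eventually allI ballI impI exI, rule min_dist_at_argmin)
      fix \<alpha> x assume "\<alpha> \<in> A"
      then show "?G \<alpha> \<in> carrier_mat ?d ?d" by (intro pos_def_matD(1)[OF pos_def_inv[OF pos_def_Omega[OF A1]]])
      show "1 / (U * (real ?d)\<^sup>2 + 1) * (\<Sum>i<?d. (x i)\<^sup>2) \<le> qform ?d (\<lambda>i j. ?G \<alpha> $$ (i, j)) x"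
        using inverse_qform_lower[OF pos_def_Omega[OF A1] U U0] \<open>\<alpha> \<in> A\<close> by simp
    qed (use that in auto)
  qed
  then show ?thesis using cmd_variance_inv[OF pos_def_Omega[OF \<alpha>\<^sub>0]] by simp
qed

text \<open>
  Entrywise closeness to \<open>W\<close> preserves half of the lower bound \<open>\<kappa>\<close> for the form of \<open>W\<close>.
\<close>

lemma cmd_normality:
  assumes A: "A \<subseteq> {1<..}" "compact A" and int: "\<alpha>\<^sub>0 \<in> interior A"
    and est: "cmd_estimator M Y c K p A What W est"
  shows "has_asymptotic_variance M \<alpha>\<^sub>0 est (cmd_variance c K p \<alpha>\<^sub>0 W)"
proof -
  let ?d = "K - 1"
  have W: "pos_def_mat ?d W" using est by (simp add: cmd_estimator_def)
  obtain \<kappa> where \<kappa>: "\<kappa> > 0" "\<And>x. \<kappa> * (\<Sum>i<?d. (x i)\<^sup>2) \<le> qform ?d (\<lambda>i j. W $$ (i, j)) x"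
    using pos_def_qform_lower[OF W] by blast
  have close: "whp (\<lambda>n \<omega>. \<forall>i<?d. \<forall>j<?d. \<bar>What n \<omega> $$ (i, j) - W $$ (i, j)\<bar> \<le> \<delta>)" if "\<delta> > 0" for \<delta>
  proof -
    have "whp (\<lambda>n \<omega>. \<forall>i\<in>{..<?d}. \<forall>j\<in>{..<?d}. \<bar>What n \<omega> $$ (i, j) - W $$ (i, j)\<bar> \<le> \<delta>)"
      using est that unfolding cmd_estimator_def
      by (intro whp_ball vanishesD[OF conv_in_prob_imp_vanishes]) auto
    then show ?thesis by (rule whp_mono) auto
  qed
  define \<delta> where "\<delta> = \<kappa> / 2 / ((real ?d)\<^sup>2 + 1)"
  have \<delta>: "\<delta> > 0" unfolding \<delta>_def using \<kappa>(1) by (intro divide_pos_pos) (auto simp: add_nonneg_pos)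
  have d\<delta>: "(real ?d)\<^sup>2 * \<delta> \<le> \<kappa> / 2"
  proof -
    have "(real ?d)\<^sup>2 * \<delta> \<le> ((real ?d)\<^sup>2 + 1) * \<delta>" using \<delta> by simp
    also have "\<dots> = \<kappa> / 2"
    proof -
      have "(real ?d)\<^sup>2 + 1 \<noteq> 0" using zero_le_power2[of "real ?d"] by linarith
      moreover have "x * (y / x) = y" if "x \<noteq> 0" for x y :: real using that by simp
      ultimately show ?thesis unfolding \<delta>_def by blast
    qed
    finally show ?thesis .
  qed
  have lower: "\<kappa> / 2 * (\<Sum>i<?d. (x i)\<^sup>2) \<le> qform ?d (\<lambda>i j. V $$ (i, j)) x"
    if cl: "\<forall>i<?d. \<forall>j<?d. \<bar>V $$ (i, j) - W $$ (i, j)\<bar> \<le> \<delta>" for V x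
  proof -
    define S where "S = (\<Sum>i<?d. (x i)\<^sup>2)"
    have S0: "S \<ge> 0" by (simp add: S_def sum_nonneg)
    have "qform ?d (\<lambda>i j. W $$ (i, j) - V $$ (i, j)) x \<le> (\<Sum>i<?d. \<Sum>j<?d. \<delta>) * (sqrt S)\<^sup>2"
    proof (rule qform_le)
      fix i assume "i < ?d"
      then have "(x i)\<^sup>2 \<le> S" unfolding S_def by (intro member_le_sum) auto
      then show "\<bar>x i\<bar> \<le> sqrt S" by (simp add: real_le_rsqrt)
    qed (use cl in \<open>simp add: abs_minus_commute\<close>)
    also have "\<dots> = (real ?d)\<^sup>2 * \<delta> * S" using S0 K by (simp add: power2_eq_square of_nat_diff)
    also have "\<dots> \<le> \<kappa> / 2 * S" using d\<delta> S0 by (rule mult_right_mono)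
    finally have "qform ?d (\<lambda>i j. W $$ (i, j)) x - qform ?d (\<lambda>i j. V $$ (i, j)) x \<le> \<kappa> / 2 * S"
      by (simp add: qform_def sum_subtractf[symmetric] algebra_simps)
    then show ?thesis using \<kappa>(2)[of x] unfolding S_def by linarith
  qed
  have arg: "\<forall>\<^sub>F n in sequentially. AE \<omega> in M. pos_def_mat ?d (What n \<omega>) \<and>
      is_arg_min (\<lambda>\<alpha>. md_criterion c K p (What n \<omega>) (sbar K p n (obs \<omega>)) \<alpha>) (\<lambda>\<alpha>. \<alpha> \<in> A) (est n \<omega>)"
    using est by (simp add: cmd_estimator_def)
  show ?thesis
  proof (rule minimum_distance_normality[OF A int, where G="\<lambda>_. W" and \<kappa>="\<kappa> / 2"])
    show "pos_def_mat ?d W" by (rule W)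
    show "0 < \<kappa> / 2" using \<kappa>(1) by simp
    show "est n \<in> borel_measurable M" for n using est by (simp add: cmd_estimator_def)
    show "whp (\<lambda>n \<omega>. \<exists>V. min_dist_at ?d share_ratio (\<lambda>\<alpha> i j. W $$ (i, j)) A (\<kappa> / 2) \<delta>'
      (vec_index (sbar K p n (obs \<omega>))) V (est n \<omega>))" if \<delta>': "\<delta>' > 0" for \<delta>'
    proof (rule whp_mono[OF whp_conj[OF whp_AE[OF arg] whp_conj[OF close[OF \<delta>] close[OF \<delta>']]]],
        intro always_eventually allI ballI impI exI, elim conjE, rule min_dist_at_argmin)
      fix n \<omega> \<alpha> and x :: "nat \<Rightarrow> real"
      assume PD: "pos_def_mat ?d (What n \<omega>)" and cl: "\<forall>i<?d. \<forall>j<?d. \<bar>What n \<omega> $$ (i, j) - W $$ (i, j)\<bar> \<le> \<delta>"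
      show "What n \<omega> \<in> carrier_mat ?d ?d" by (rule pos_def_matD(1)[OF PD])
      show "\<kappa> / 2 * (\<Sum>i<?d. (x i)\<^sup>2) \<le> qform ?d (\<lambda>i j. What n \<omega> $$ (i, j)) x" by (rule lower[OF cl])
    qed auto
  qed simp
qed

end

theorem corollary3p5:
  fixes M :: "'a measure" and Y :: "nat \<Rightarrow> 'a \<Rightarrow> real" and p :: "nat \<Rightarrow> real"
    and K :: nat and A :: "real set" and \<alpha>\<^sub>0 c :: real and \<alpha>hat :: "nat \<Rightarrow> 'a \<Rightarrow> real"
  assumes K: "K \<ge> 2"
    and p: "0 < p 1" "strict_mono_on {1..K + 1} p" "p (K + 1) \<le> 1"
    and A: "A \<subseteq> {1<..}" "compact A"
    and \<alpha>\<^sub>0: "\<alpha>\<^sub>0 \<in> interior A"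
    and c: "c > 0"
    and M: "prob_space M"
    and indep: "prob_space.indep_vars M (\<lambda>i. borel) Y {1..}"
    and pareto: "\<And>i. i \<ge> 1 \<Longrightarrow> cdf (distr M borel (Y i)) = pareto_cdf \<alpha>\<^sub>0 c"
    and \<alpha>hat: "cumd_estimator M Y c K p A \<alpha>hat"
  shows "has_asymptotic_variance M \<alpha>\<^sub>0 \<alpha>hat (cumd_variance c K p \<alpha>\<^sub>0) \<and>
    (\<forall>What W \<alpha>tilde. cmd_estimator M Y c K p A What W \<alpha>tilde \<longrightarrow>
       has_asymptotic_variance M \<alpha>\<^sub>0 \<alpha>tilde (cmd_variance c K p \<alpha>\<^sub>0 W) \<and>
       cumd_variance c K p \<alpha>\<^sub>0 \<le> cmd_variance c K p \<alpha>\<^sub>0 W)"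
proof -
  note int = \<alpha>\<^sub>0
  have "\<alpha>\<^sub>0 > 1" using \<alpha>\<^sub>0 A(1) interior_subset by blast
  then interpret pareto_sample M K p c Y \<alpha>\<^sub>0
    using K p c M indep pareto by (auto intro!: pareto_sample.intro percentiles.intro pareto_sample_axioms.intro)
  show ?thesis
  proof (intro conjI allI impI)
    show "has_asymptotic_variance M \<alpha>\<^sub>0 \<alpha>hat (cumd_variance c K p \<alpha>\<^sub>0)"
      by (rule cumde_normality[OF A int \<alpha>hat])
    fix What W \<alpha>tilde assume est: "cmd_estimator M Y c K p A What W \<alpha>tilde"
    show "has_asymptotic_variance M \<alpha>\<^sub>0 \<alpha>tilde (cmd_variance c K p \<alpha>\<^sub>0 W)"
      by (rule cmd_normality[OF A int est])
    show "cumd_variance c K p \<alpha>\<^sub>0 \<le> cmd_variance c K p \<alpha>\<^sub>0 W"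
      by (rule cmd_variance_ge) (use est in \<open>simp add: cmd_estimator_def\<close>)
  qed
qed

end
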